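(* The following two assertions are equivalent. (i) For every integer $r\ge 2$ and all finite families of graphs $\mathcal H_1,\dots,\mathcal H_r$ with $m_2(\mathcal H_1)\ge\dots\ge m_2(\mathcal H_r)$ and $m_2(\mathcal H_2)>1$, there exists $c>0$ such that $\lim_{n\to\infty}\Pr\big(G_{n,p}\text{ is Ramsey for }(\mathcal H_1,\dots,\mathcal H_r)\big)=0$ for every $p=p(n)\le c\,n^{-1/m_2(\mathcal H_1,\mathcal H_2)}$. (ii) For every strictly balanced pair $(\mathcal H_1,\mathcal H_2)$ of finite families of graphs with $m_2(\mathcal H_1)\ge m_2(\mathcal H_2)>1$, every graph $G$ that is Ramsey for $(\mathcal H_1,\mathcal H_2)$ satisfies $m(G)>m_2(\mathcal H_1,\mathcal H_2)$.
   Context: For a graph $J$, $v_J,e_J$ are its numbers of vertices and edges; $m(G)=\max\{e_J/v_J: J\subseteq G, v_J\ge1\}$. For a graph $H$: $m_2(H)=\max\{(e_J-1)/(v_J-2): J\subseteq H, v_J\ge 3\}$ if $H$ has an edge and $v_H\ge3$; $m_2(K_2)=1/2$; $m_2(H)=0$ if $H$ has no edges. For a finite (nonempty) family $\mathcal H$, $m_2(\mathcal H)=\min_{H\in\mathcal H}m_2(H)$. For a graph $H$ and a family $\mathcal L$ with $m_2(\mathcal L)>0$, $m_2(H,\mathcal L)=\max\{e_J/(v_J-2+1/m_2(\mathcal L)): J\subseteq H, v_J\ge 2\}$, and for families $\mathcal H,\mathcal L$, $m_2(\mathcal H,\mathcal L)=\min_{H\in\mathcal H}m_2(H,\mathcal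 L)$. A graph $L$ is strictly $2$-balanced if $m_2(L')<m_2(L)$ for every proper subgraph $L'\subsetneq L$; a graph $H$ is strictly $m_2(\cdot,\mathcal L)$-balanced if $m_2(H',\mathcal L)<m_2(H,\mathcal L)$ for every proper subgraph $H'\subsetneq H$. A pair $(\mathcal H,\mathcal L)$ is strictly balanced if every graph in $\mathcal L$ is strictly $2$-balanced and every graph in $\mathcal H$ is strictly $m_2(\cdot,\mathcal L)$-balanced. $G$ is Ramsey for $(\mathcal H_1,\dots,\mathcal H_r)$ if every $r$-coloring of $E(G)$ contains, for some $i$, a copy of some member of $\mathcal H_i$ all of whose edges have color $i$. $G_{n,p}$ is the binomial random graph.
   Formalization: In (i) every graph in every family is assumed to have at least one edge; otherwise, e.g. if the third family contains an edgeless graph, every large graph is vacuously Ramsey and (i) fails trivially while (ii) is unaffected. *)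

theory Defs
  imports "HOL-Probability.Probability" "HOL-Probability.Product_PMF"
begin

section \<open>Finite simple graphs\<close>

text \<open>
  A graph is a pair of a vertex set and a set of two-element edges. All graphs are finite, so
  vertices are taken to be natural numbers without loss of generality up to isomorphism.
\<close>

type_synonym graph = "nat set \<times> nat set set"

abbreviation verts :: "graph \<Rightarrow> nat set" where "verts \<equiv> fst"
abbreviation edges :: "graph \<Rightarrow> nat set set" where "edges \<equiv> snd"

definition simple_graph :: "graph \<Rightarrow> bool" where
  "simple_graph G \<longleftrightarrow> finite (verts G) \<and> (\<forall>e\<in>edges G. e \<subseteq> verts G \<and> card e = 2)"

definition subgraph :: "graph \<Rightarrow> graph \<Rightarrow> bool" where
  "subgraph J G \<longleftrightarrow> simple_graph J \<and> verts J \<subseteq> verts G \<and> edges J \<subseteq> edges G"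

definition proper_subgraph :: "graph \<Rightarrow> graph \<Rightarrow> bool" where
  "proper_subgraph J G \<longleftrightarrow> subgraph J G \<and> J \<noteq> G"

abbreviation nv :: "graph \<Rightarrow> nat" where "nv G \<equiv> card (verts G)"
abbreviation ne :: "graph \<Rightarrow> nat" where "ne G \<equiv> card (edges G)"

definition graph_family :: "graph set \<Rightarrow> bool" where
  "graph_family F \<longleftrightarrow> finite F \<and> F \<noteq> {} \<and> (\<forall>H\<in>F. simple_graph H)"


section \<open>Densities\<close>

text \<open>
  A maximum over an empty set of subgraphs (the graph without vertices for \<open>max_density\<close>,
  a graph with fewer than two vertices for \<open>m2_asym\<close>) is set to 0.
\<close>

definition max_density :: "graph \<Rightarrow> real" where
  "max_density G =
     (if nv G = 0 then 0
      else Max {real (ne J) / real (nv J) | J. subgraph J G \<and> nv J \<ge> 1})"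

text \<open>A graph with an edge and fewer than three vertices is \<open>K\<^sub>2\<close>.\<close>

definition m2 :: "graph \<Rightarrow> real" where
  "m2 H =
     (if edges H = {} then 0
      else if nv H < 3 then 1 / 2
      else Max {(real (ne J) - 1) / (real (nv J) - 2) | J. subgraph J H \<and> nv J \<ge> 3})"

definition m2_fam :: "graph set \<Rightarrow> real" where
  "m2_fam F = Min (m2 ` F)"

text \<open>The next two definitions are meant for \<open>m2_fam L > 0\<close>.\<close>

definition m2_asym :: "graph \<Rightarrow> graph set \<Rightarrow> real" where
  "m2_asym H L =
     (if nv H < 2 then 0
      else Max {real (ne J) / (real (nv J) - 2 + 1 / m2_fam L) | J. subgraph J H \<and> nv J \<ge> 2})"

definition m2_asym_fam :: "graph set \<Rightarrow> graph set \<Rightarrow> real" where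
  "m2_asym_fam F L = Min ((\<lambda>H. m2_asym H L) ` F)"

definition strictly_2_balanced :: "graph \<Rightarrow> bool" where
  "strictly_2_balanced L \<longleftrightarrow> (\<forall>L'. proper_subgraph L' L \<longrightarrow> m2 L' < m2 L)"

definition strictly_asym_balanced :: "graph set \<Rightarrow> graph \<Rightarrow> bool" where
  "strictly_asym_balanced L H \<longleftrightarrow>
     (\<forall>H'. proper_subgraph H' H \<longrightarrow> m2_asym H' L < m2_asym H L)"

definition strictly_balanced_pair :: "graph set \<Rightarrow> graph set \<Rightarrow> bool" where
  "strictly_balanced_pair F L \<longleftrightarrow>
     (\<forall>K\<in>L. strictly_2_balanced K) \<and> (\<forall>H\<in>F. strictly_asym_balanced L H)"


section \<open>Ramsey property\<close>

text \<open>
  \<open>f\<close> embeds \<open>H\<close> as a (not necessarily induced) subgraph of \<open>G\<close>. For a graph \<open>H\<close> without edges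
  the colour condition is vacuous, so a family containing an edgeless graph makes every
  sufficiently large \<open>G\<close> Ramsey.
\<close>

definition has_coloured_copy :: "graph \<Rightarrow> (nat set \<Rightarrow> nat) \<Rightarrow> nat \<Rightarrow> graph \<Rightarrow> bool" where
  "has_coloured_copy G col i H \<longleftrightarrow>
     (\<exists>f. inj_on f (verts H) \<and> f ` verts H \<subseteq> verts G \<and>
          (\<forall>e\<in>edges H. f ` e \<in> edges G \<and> col (f ` e) = i))"

text \<open>
  The families \<open>H\<^sub>1, \<dots>, H\<^sub>r\<close> are given as a list of length \<open>r\<close>, so families and
  colours are indexed from 0.
\<close>

definition ramsey_for :: "graph \<Rightarrow> graph set list \<Rightarrow> bool" where
  "ramsey_for G Hs \<longleftrightarrow>
     (\<forall>col. (\<forall>e\<in>edges G. col e < length Hs) \<longrightarrow>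
          (\<exists>i<length Hs. \<exists>H\<in>Hs ! i. has_coloured_copy G col i H))"


section \<open>The binomial random graph\<close>

definition all_edges :: "nat \<Rightarrow> nat set set" where
  "all_edges n = {e. e \<subseteq> {1..n} \<and> card e = 2}"

definition Gnp :: "nat \<Rightarrow> real \<Rightarrow> graph pmf" where
  "Gnp n p = map_pmf (\<lambda>b. ({1..n}, {e \<in> all_edges n. b e}))
               (Pi_pmf (all_edges n) False (\<lambda>_. bernoulli_pmf p))"

end

theory Submission
  imports Defs
begin

text \<open>Let \<open>\<alpha>\<close> be the asymmetric density. If a Ramsey graph \<open>G\<close> had \<open>m(G) \<le> \<alpha>\<close>, a second moment computation
  shows that \<open>G\<close> appears in the random graph at \<open>p = c n powr (- 1 / \<alpha>)\<close> with probability bounded away from 0,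
  so the probabilistic assertion implies the deterministic one.

  Conversely, only two colours are used and the families are replaced by strictly balanced ones. A
  Ramsey subgraph contains a minimal core, in which any edge of a copy is the whole intersection with
  some copy from the other family. The core is explored copy by copy. No step increases the weight
  \<open>v - e / \<alpha>\<close>; a step that meets the explored part in more than an edge decreases it by a constant, and
  any other step leaves more open vertices than it closes. Hence an exploration with few degenerate
  steps has bounded length or goes on for \<open>3 log n\<close> steps, and a first moment bound excludes the long ones,
  as well as those whose weight drops below \<open>-1\<close>. A core of bounded size is Ramsey, hence has a subgraph
  of density above \<open>\<alpha>\<close>, and these do not appear either.\<close>

text \<open>The constant \<open>c\<close> pays only a fixed factor per step, whereas an exploration
  free to continue at any vertex seen so far has about \<open>t\<close> choices at step
  \<open>t\<close>, and no constant beats that over logarithmically many steps. So the order of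
  exploration matters: after a regular step the next copy is sought at a vertex of the piece just
  added, where boundedly many positions exist; free choices occur only at a degenerate step and
  right after one. As weights start at most at 2 and each degenerate step costs \<open>d\<close>,
  only boundedly many free choices happen before the weight is below -1, and together they cost a
  power of \<open>t\<close>. The length \<open>3 log n\<close> lets the gain
  \<open>exp (- t)\<close> beat the initial \<open>n powr 2\<close>. If the two densities agree, the
  proof rests instead on splitting the edges of a graph with \<open>m(G) <= m\<close> into two
  classes without subgraphs of \<open>m2\<close> at least \<open>m\<close>. A vertex of minimum
  degree is reinserted; submodularity of \<open>m v - e\<close> settles all cases but cubic graphs
  with \<open>m = 3 / 2\<close> and K5 components with \<open>m = 2\<close>, which are coloured by
  hand.\<close>

section \<open>Weights of edge sets\<close>

text \<open>A graph with vertex set \<open>V\<close> and edge set \<open>E\<close> has about \<open>n powr lam a V E\<close> copies in the random graph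
  with edge probability \<open>n powr (- 1 / a)\<close>.\<close>

definition lam :: "real \<Rightarrow> 'a set \<Rightarrow> 'a set set \<Rightarrow> real" where
  "lam a V E = real (card V) - real (card E) / a"

lemma lam_union:
  assumes "finite V" "finite V'" "finite E" "finite E'"
  shows "lam a (V \<union> V') (E \<union> E') = lam a V E + lam a V' E' - lam a (V \<inter> V') (E \<inter> E')"
proof -
  have "real (card (V \<union> V')) = real (card V) + real (card V') - real (card (V \<inter> V'))"
    using card_Un_Int[OF assms(1,2)] by linarith
  moreover have "real (card (E \<union> E')) = real (card E) + real (card E') - real (card (E \<inter> E'))"
    using card_Un_Int[OF assms(3,4)] by linarith
  ultimately show ?thesis unfolding lam_def by (simp add: add_divide_distrib diff_divide_distrib)
qed

text \<open>Each edge \<open>s\<close> of \<open>S\<close> gets a graph \<open>H s\<close> attached. As soon as some of them share two vertices,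
  their union is grown to a maximal cluster \<open>C\<close> of weight at most \<open>2 - 1 / l\<close>; every other \<open>H s\<close> meets the
  cluster in at most one vertex, and the balancedness of \<open>L\<close> forces the cluster to contain so many
  vertices of \<open>L\<close> that its total weight is paid for.\<close>

lemma cluster:
  fixes L :: "'a set set" and H :: "'a set \<Rightarrow> 'a set set"
  assumes "finite S" and "finite V" and "finite E" and fL: "finite (\<Union>L)"
    and SL: "S \<subseteq> L" and LV: "\<Union>L \<subseteq> V"
    and ml: "1 / m \<le> 1 / l" and d0: "0 \<le> d" and d1: "d \<le> 1"
    and S2: "\<And>s. s \<in> S \<Longrightarrow> card s = 2"
    and L1: "\<And>C W. C \<subseteq> S \<Longrightarrow> W \<subseteq> \<Union>L \<Longrightarrow> \<Union>C \<subseteq> W \<Longrightarrow> 2 \<le> card C \<Longrightarrow>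
          (real (card C) - 1) / m + d \<le> real (card W) - 2"
    and Hs: "\<And>s. s \<in> S \<Longrightarrow> s \<in> H s" and Hfin: "\<And>s. s \<in> S \<Longrightarrow> finite (H s)"
    and H2: "\<And>s e. s \<in> S \<Longrightarrow> e \<in> H s \<Longrightarrow> card e = 2"
    and Hlam: "\<And>s. s \<in> S \<Longrightarrow> lam a (\<Union>(H s)) (H s) \<le> 2 - 1 / l"
    and Hsub: "\<And>s W B. s \<in> S \<Longrightarrow> W \<subseteq> \<Union>(H s) \<Longrightarrow> B \<subseteq> H s \<Longrightarrow> \<Union>B \<subseteq> W \<Longrightarrow> 2 \<le> card W \<Longrightarrow>
          lam a (\<Union>(H s)) (H s) \<le> lam a W B"
    and HE: "\<And>s. s \<in> S \<Longrightarrow> H s \<inter> E = {}"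
  shows "lam a (V \<union> \<Union>(\<Union>s\<in>S. H s)) (E \<union> (\<Union>s\<in>S. H s)) \<le> lam a V E - card S / m - d \<or>
     lam a (V \<union> \<Union>(\<Union>s\<in>S. H s)) (E \<union> (\<Union>s\<in>S. H s)) \<le> lam a V E - card S / m \<and>
     (\<forall>s\<in>S. \<Union>(H s) \<inter> V = s) \<and> (\<forall>s\<in>S. \<forall>t\<in>S. s \<noteq> t \<longrightarrow> \<Union>(H s) \<inter> \<Union>(H t) \<subseteq> V)"
  using assms(1,2,3) SL LV S2 L1 Hs Hfin H2 Hlam Hsub HE
proof (induction S arbitrary: V E rule: finite_psubset_induct)
  case (psubset S)
  note finV' = psubset.prems(1) and finE' = psubset.prems(2) and SL' = psubset.prems(3) and LV' = psubset.prems(4)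
    and S2' = psubset.prems(5) and L1' = psubset.prems(6) and Hs' = psubset.prems(7) and Hfin' = psubset.prems(8)
    and H2' = psubset.prems(9) and Hlam' = psubset.prems(10) and Hsub' = psubset.prems(11) and HE' = psubset.prems(12)
  note fS = psubset.hyps
  let ?U = "\<lambda>C. \<Union>s\<in>C. H s"
  have finU: "finite (?U C)" if "C \<subseteq> S" for C
    using that fS Hfin' by (meson finite_UN finite_subset subsetD)
  have fine: "finite e" if "s \<in> S" "e \<in> H s" for s e
    using H2'[OF that] by (metis card.infinite zero_neq_numeral)
  have finVU: "finite (\<Union>(?U C))" if "C \<subseteq> S" for C
    using finU[OF that] fine that by (auto intro!: finite_Union)
  show ?case
  proof (cases "S = {}")
    case True
    then show ?thesis by simp
  next
    case False
    then obtain s0 where s0: "s0 \<in> S" by auto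
    define P where "P = (\<lambda>C. C \<subseteq> S \<and> C \<noteq> {} \<and> lam a (\<Union>(?U C)) (?U C) \<le> 2 - 1 / l)"
    have "P {s0}" using s0 Hlam' by (simp add: P_def)
    moreover have "\<forall>C. P C \<longrightarrow> card C \<le> card S" using fS by (auto simp: P_def intro: card_mono)
    ultimately obtain C where C: "P C" and Cmax: "\<And>C'. P C' \<Longrightarrow> card C' \<le> card C"
      using ex_has_greatest_nat[of P "{s0}" card "Suc (card S)"] by (auto simp: less_Suc_eq_le)
    have CS: "C \<subseteq> S" and C0: "C \<noteq> {}" and lamC: "lam a (\<Union>(?U C)) (?U C) \<le> 2 - 1 / l"
      using C by (auto simp: P_def)
    have fC: "finite C" using CS fS finite_subset by blast
    \<comment> \<open>If \<open>H t\<close> met the cluster in two vertices, the intersection would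
      weigh at least as much as \<open>H t\<close> itself by \<open>Hsub\<close>. Adding
      \<open>H t\<close> would then not raise the weight, against the maximality of
      \<open>C\<close>.\<close>
    have apart: "card (\<Union>(H t) \<inter> \<Union>(?U C)) \<le> 1" if t: "t \<in> S" "t \<notin> C" for t
    proof (rule ccontr)
      assume "\<not> ?thesis"
      then have c2: "2 \<le> card (\<Union>(H t) \<inter> \<Union>(?U C))" by simp
      have "lam a (\<Union>(H t)) (H t) \<le> lam a (\<Union>(H t) \<inter> \<Union>(?U C)) (H t \<inter> ?U C)"
        using c2 by (intro Hsub'[OF t(1)]) auto
      moreover have "lam a (\<Union>(H t) \<union> \<Union>(?U C)) (H t \<union> ?U C) = lam a (\<Union>(H t)) (H t) + lam a (\<Union>(?U C)) (?U C)
          - lam a (\<Union>(H t) \<inter> \<Union>(?U C)) (H t \<inter> ?U C)"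
        using finVU[OF CS] finU[OF CS] Hfin'[OF t(1)] fine[OF t(1)]
        by (intro lam_union) auto
      ultimately have "lam a (\<Union>(H t) \<union> \<Union>(?U C)) (H t \<union> ?U C) \<le> 2 - 1 / l" using lamC by linarith
      moreover have e1: "\<Union>(H t) \<union> \<Union>(?U C) = \<Union>(?U (insert t C))" "H t \<union> ?U C = ?U (insert t C)" by auto
      ultimately have "lam a (\<Union>(?U (insert t C))) (?U (insert t C)) \<le> 2 - 1 / l" by metis
      then have "P (insert t C)" unfolding P_def using CS t(1) by blast
      from Cmax[OF this] show False using fC t by simp
    qed
    have edis: "H t \<inter> ?U C = {}" if t: "t \<in> S" "t \<notin> C" for t
    proof (rule ccontr)
      assume "H t \<inter> ?U C \<noteq> {}"
      then obtain e where e: "e \<in> H t" "e \<in> ?U C" by auto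
      then have "e \<subseteq> \<Union>(H t) \<inter> \<Union>(?U C)" by auto
      then have "card e \<le> card (\<Union>(H t) \<inter> \<Union>(?U C))"
        using finVU[OF CS] by (intro card_mono) auto
      then show False using apart[OF t] H2'[OF t(1) e(1)] by simp
    qed
    define V1 where "V1 = V \<union> \<Union>(?U C)"
    define E1 where "E1 = E \<union> ?U C"
    have CL: "\<Union>C \<subseteq> \<Union>(?U C)" using Hs' CS by blast
    have inte: "E \<inter> ?U C = {}" using HE' CS by blast
    let ?w = "card (\<Union>(?U C) \<inter> \<Union>L)"
    have wle: "?w \<le> card (V \<inter> \<Union>(?U C))" using LV' finVU[OF CS] by (intro card_mono) auto
    have lam1: "lam a V1 E1 = lam a V E + lam a (\<Union>(?U C)) (?U C) - card (V \<inter> \<Union>(?U C))"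
      unfolding V1_def E1_def
      using lam_union[OF finV' finVU[OF CS] finE' finU[OF CS], of a] inte by (simp add: lam_def)
    have split: "V \<union> \<Union>(?U S) = V1 \<union> \<Union>(?U (S - C))" "E \<union> ?U S = E1 \<union> ?U (S - C)"
      unfolding V1_def E1_def using CS by blast+
    have cardS: "card S = card C + card (S - C)"
      using fC CS fS by (metis card_Diff_subset card_mono le_add_diff_inverse)
    have IH: "lam a (V1 \<union> \<Union>(?U (S - C))) (E1 \<union> ?U (S - C)) \<le> lam a V1 E1 - card (S - C) / m - d \<or>
       lam a (V1 \<union> \<Union>(?U (S - C))) (E1 \<union> ?U (S - C)) \<le> lam a V1 E1 - card (S - C) / m \<and>
       (\<forall>s\<in>S - C. \<Union>(H s) \<inter> V1 = s) \<and> (\<forall>s\<in>S - C. \<forall>t\<in>S - C. s \<noteq> t \<longrightarrow> \<Union>(H s) \<inter> \<Union>(H t) \<subseteq> V1)"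
    proof (rule psubset.IH)
      show "S - C \<subset> S" using C0 CS by auto
      show "finite V1" using finV' finVU[OF CS] by (simp add: V1_def)
      show "finite E1" using finE' finU[OF CS] by (simp add: E1_def)
      show "\<And>s. s \<in> S - C \<Longrightarrow> H s \<inter> E1 = {}" using edis HE' unfolding E1_def by blast
      show "\<Union>L \<subseteq> V1" using LV' by (auto simp: V1_def)
      show "\<And>C' W. C' \<subseteq> S - C \<Longrightarrow> W \<subseteq> \<Union>L \<Longrightarrow> \<Union>C' \<subseteq> W \<Longrightarrow> 2 \<le> card C' \<Longrightarrow>
          (real (card C') - 1) / m + d \<le> real (card W) - 2"
        using L1' by (metis Diff_subset subset_trans)
    qed (use psubset.prems in auto)
    have cs: "card (S - C) / m + card C / m = card S / m"
      using cardS by (simp add: add_divide_distrib)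
    show ?thesis
    proof (cases "2 \<le> card C")
      case True
      \<comment> \<open>The cluster lies on so many vertices of \<open>L\<close> that
        \<open>(card C - 1) / m + d\<close> is lost besides \<open>1 / l\<close>; as
        \<open>1 / m <= 1 / l\<close>, this adds up to \<open>card C / m + d\<close>.\<close>
      have "(real (card C) - 1) / m + d \<le> real ?w - 2"
        using SL' CS CL True by (intro L1') auto
      then have "lam a V1 E1 \<le> lam a V E + 2 - 1 / l - ((real (card C) - 1) / m + d + 2)"
        using lam1 lamC wle by linarith
      also have "\<dots> \<le> lam a V E - card C / m - d" using ml by (simp add: diff_divide_distrib)
      finally have "lam a V1 E1 \<le> lam a V E - card C / m - d" .
      moreover have "lam a (V1 \<union> \<Union>(?U (S - C))) (E1 \<union> ?U (S - C)) \<le> lam a V1 E1 - card (S - C) / m \<or>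
         lam a (V1 \<union> \<Union>(?U (S - C))) (E1 \<union> ?U (S - C)) \<le> lam a V1 E1 - card (S - C) / m - d" using IH by argo
      ultimately have "lam a (V1 \<union> \<Union>(?U (S - C))) (E1 \<union> ?U (S - C)) \<le> lam a V E - card S / m - d"
        using cs d0 by linarith
      then show ?thesis unfolding split by blast
    next
      case False
      then have "card C = 1" using fC C0 by (metis One_nat_def Suc_1 Suc_leI card_gt_0_iff le_neq_implies_less)
      then obtain s where Cs: "C = {s}" by (metis card_1_singletonE)
      have sS: "s \<in> S" using Cs CS by auto
      have UC: "?U C = H s" using Cs by auto
      have sin: "s \<subseteq> \<Union>(H s) \<inter> V" using Hs'[OF sS] SL' LV' sS by blast
      have fHs: "finite (\<Union>(H s))" using finVU[OF CS] UC by simp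
      show ?thesis
      proof (cases "\<Union>(H s) \<inter> V = s")
        case True
        have c2: "card (\<Union>(H s) \<inter> V) = 2" using True S2'[OF sS] by simp
        have l1: "lam a V1 E1 \<le> lam a V E - card C / m"
          using lam1 lamC c2 ml \<open>card C = 1\<close> unfolding UC by (simp add: Int_commute)
        from IH show ?thesis
        proof
          assume "lam a (V1 \<union> \<Union>(?U (S - C))) (E1 \<union> ?U (S - C)) \<le> lam a V1 E1 - card (S - C) / m - d"
          then have "lam a (V1 \<union> \<Union>(?U (S - C))) (E1 \<union> ?U (S - C)) \<le> lam a V E - card S / m - d"
            using l1 cs by linarith
          then show ?thesis unfolding split by blast
        next
          assume A: "lam a (V1 \<union> \<Union>(?U (S - C))) (E1 \<union> ?U (S - C)) \<le> lam a V1 E1 - card (S - C) / m \<and>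
            (\<forall>s\<in>S - C. \<Union>(H s) \<inter> V1 = s) \<and> (\<forall>s\<in>S - C. \<forall>t\<in>S - C. s \<noteq> t \<longrightarrow> \<Union>(H s) \<inter> \<Union>(H t) \<subseteq> V1)"
          have tV: "t \<subseteq> V" if "t \<in> S" for t using that SL' LV' by blast
          \<comment> \<open>The induction speaks of the enlarged vertex set \<open>V1\<close>. Since
            \<open>V1\<close> contains the vertices of \<open>H s\<close>, it also yields that the
            other members avoid \<open>H s\<close> outside \<open>V\<close>.\<close>
          have B: "\<Union>(H t) \<inter> V1 = t" if "t \<in> S" "t \<noteq> s" for t using A that Cs by blast
          have D: "\<Union>(H t) \<inter> V = t" if "t \<in> S" for t
          proof (cases "t = s")
            case False
            have "t \<subseteq> \<Union>(H t)" using Hs'[OF that] by blast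
            then show ?thesis using B[OF that False] tV[OF that] unfolding V1_def by blast
          qed (use True in simp)
          have E: "\<Union>(H t) \<inter> \<Union>(H s) \<subseteq> V" if "t \<in> S" "t \<noteq> s" for t
            using B[OF that] tV[OF that(1)] unfolding V1_def UC by blast
          have F: "\<Union>(H t) \<inter> \<Union>(H t') \<subseteq> V" if "t \<in> S" "t' \<in> S" "t \<noteq> t'" for t t'
          proof (cases "t = s \<or> t' = s")
            case True
            then show ?thesis using E that by blast
          next
            case False
            then have "\<Union>(H t) \<inter> \<Union>(H t') \<subseteq> V1" using A that Cs by blast
            then show ?thesis using B[OF that(1)] False tV[OF that(1)] by blast
          qed
          have "lam a (V1 \<union> \<Union>(?U (S - C))) (E1 \<union> ?U (S - C)) \<le> lam a V E - card S / m"
            using A l1 cs by linarith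
          then show ?thesis unfolding split using D F by blast
        qed
      next
        case False
        then have "s \<subset> \<Union>(H s) \<inter> V" using sin by blast
        then have "card s < card (\<Union>(H s) \<inter> V)" using fHs by (intro psubset_card_mono) auto
        \<comment> \<open>A third common vertex costs a full 1, which is at least
          \<open>d\<close>.\<close>
        then have "3 \<le> card (V \<inter> \<Union>(H s))" using S2'[OF sS] by (simp add: Int_commute)
        then have "lam a V1 E1 \<le> lam a V E - card C / m - d"
          using lam1 lamC ml d1 \<open>card C = 1\<close> unfolding UC by simp
        then have "lam a (V1 \<union> \<Union>(?U (S - C))) (E1 \<union> ?U (S - C)) \<le> lam a V E - card S / m - d"
          using cs IH d0 by argo
        then show ?thesis unfolding split by blast
      qed
    qed
  qed
qed

text \<open>A vertex owned by \<open>Q\<close> still has to be touched by a later step: the crossing property of cores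
  provides a member meeting \<open>Q\<close> in a single edge at that vertex.\<close>

definition owned :: "'a set set set \<Rightarrow> 'a set set \<Rightarrow> 'a \<Rightarrow> 'a set set \<Rightarrow> bool" where
  "owned F X z Q \<longleftrightarrow> Q \<in> F \<and> Q \<subseteq> X \<and> z \<in> \<Union>Q \<and> (\<forall>e\<in>X. z \<in> e \<longrightarrow> e \<in> Q)"

section \<open>The two kinds of exploration steps\<close>

definition degenerate_step :: "'a set set set \<Rightarrow> real \<Rightarrow> real \<Rightarrow> nat \<Rightarrow> 'a set set \<Rightarrow> 'a set set \<Rightarrow> bool" where
  "degenerate_step F a d M X T \<longleftrightarrow> T \<subseteq> \<Union>F \<and> card (\<Union>T) \<le> M \<and> \<not> T \<subseteq> X \<and>
     lam a (\<Union>(X \<union> T)) (X \<union> T) \<le> lam a (\<Union>X) X - d"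

text \<open>The two witnesses are new, owned and non-adjacent in \<open>T\<close>, so both may join
  an independent set of open vertices; two of them outweigh the single open vertex that the edge
  \<open>e\<close> may contain.\<close>

definition regular_step :: "'a set set set \<Rightarrow> real \<Rightarrow> nat \<Rightarrow> 'a set set \<Rightarrow> 'a set \<Rightarrow> 'a set set \<Rightarrow> bool" where
  "regular_step F a M X e T \<longleftrightarrow> T \<subseteq> \<Union>F \<and> card (\<Union>T) \<le> M \<and> \<not> T \<subseteq> X \<and>
     lam a (\<Union>(X \<union> T)) (X \<union> T) \<le> lam a (\<Union>X) X \<and> \<Union>T \<inter> \<Union>X \<subseteq> e \<and>
     (\<exists>z1 z2 Q1 Q2. z1 \<notin> \<Union>X \<and> z2 \<notin> \<Union>X \<and> z1 \<noteq> z2 \<and> (\<forall>e\<in>T. \<not> (z1 \<in> e \<and> z2 \<in> e)) \<and>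
        owned F T z1 Q1 \<and> owned F T z2 Q2)"

lemma regular_stepI:
  assumes "T \<subseteq> \<Union>F" "card (\<Union>T) \<le> M" "\<not> T \<subseteq> X" "lam a (\<Union>(X \<union> T)) (X \<union> T) \<le> lam a (\<Union>X) X"
    "\<Union>T \<inter> \<Union>X \<subseteq> e" "z1 \<notin> \<Union>X" "z2 \<notin> \<Union>X" "z1 \<noteq> z2" "\<forall>e\<in>T. \<not> (z1 \<in> e \<and> z2 \<in> e)"
    "owned F T z1 Q1" "owned F T z2 Q2"
  shows "regular_step F a M X e T"
  unfolding regular_step_def using assms by blast

lemma two_elements:
  assumes "2 \<le> card A"
  obtains x y where "x \<in> A" "y \<in> A" "x \<noteq> y"
proof -
  obtain B where "B \<subseteq> A" "card B = 2" using assms ex_card by metis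
  then obtain x y where "B = {x, y}" "x \<noteq> y" by (meson card_2_iff)
  with \<open>B \<subseteq> A\<close> that show thesis by blast
qed

text \<open>The step adds \<open>L\<close> and, through each new edge \<open>s\<close> of
  \<open>L\<close>, a member meeting \<open>L\<close> only in \<open>s\<close>. These members supply
  the edges of \<open>L - X\<close>, so adding \<open>L\<close> beforehand contributes vertices
  only, and \<open>Ltot\<close> makes their number match the loss of \<open>1 / m\<close> per new
  edge granted by \<open>cluster\<close>. A surplus \<open>d\<close> appears if \<open>L\<close>
  meets \<open>X\<close> in three vertices or if the attached members overlap or touch too much.
  Otherwise they are disjoint outside \<open>L\<close> and \<open>X\<close>; as \<open>L\<close> has
  at least three edges and only \<open>e\<close> is old, two members with private vertices
  exist.\<close>

lemma attach_compound:
  fixes L X :: "'a set set" and H :: "'a set \<Rightarrow> 'a set set"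
  assumes finX: "finite X" and finL: "finite L" and X2: "\<And>e. e \<in> X \<Longrightarrow> card e = 2" and L2: "\<And>e. e \<in> L \<Longrightarrow> card e = 2"
    and e: "e \<in> L" "e \<in> X" and nLX: "\<not> L \<subseteq> X"
    and ml: "1 / m \<le> 1 / l" and d0: "0 \<le> d" and d1: "d \<le> 1"
    and Lsub: "\<And>W B. W \<subseteq> \<Union>L \<Longrightarrow> B \<subseteq> L \<Longrightarrow> \<Union>B \<subseteq> W \<Longrightarrow> 3 \<le> card W \<Longrightarrow> B \<noteq> L \<Longrightarrow>
          (real (card B) - 1) / m + d \<le> real (card W) - 2"
    and Ltot: "(real (card L) - 1) / m = real (card (\<Union>L)) - 2" and L3: "3 \<le> card L"
    and HF: "\<And>s. s \<in> L - X \<Longrightarrow> H s \<in> F" and LF: "L \<in> F"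
    and HL: "\<And>s. s \<in> L - X \<Longrightarrow> H s \<inter> L = {s}" and Hfin: "\<And>s. s \<in> L - X \<Longrightarrow> finite (H s)"
    and H2: "\<And>s e. s \<in> L - X \<Longrightarrow> e \<in> H s \<Longrightarrow> card e = 2"
    and H3: "\<And>s. s \<in> L - X \<Longrightarrow> 3 \<le> card (\<Union>(H s))"
    and Hlam: "\<And>s. s \<in> L - X \<Longrightarrow> lam a (\<Union>(H s)) (H s) \<le> 2 - 1 / l"
    and Hsub: "\<And>s W B. s \<in> L - X \<Longrightarrow> W \<subseteq> \<Union>(H s) \<Longrightarrow> B \<subseteq> H s \<Longrightarrow> \<Union>B \<subseteq> W \<Longrightarrow> 2 \<le> card W \<Longrightarrow>
          lam a (\<Union>(H s)) (H s) \<le> lam a W B"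
    and HX: "\<And>s. s \<in> L - X \<Longrightarrow> card (\<Union>(H s) \<inter> \<Union>X) \<le> 1"
    and M: "card (\<Union>(L \<union> (\<Union>s\<in>L - X. H s))) \<le> M"
  shows "degenerate_step F a d M X (L \<union> (\<Union>s\<in>L - X. H s)) \<or> regular_step F a M X e (L \<union> (\<Union>s\<in>L - X. H s))"
proof -
  let ?S = "L - X"
  let ?R = "\<Union>s\<in>?S. H s"
  let ?T = "L \<union> ?R"
  let ?V = "\<Union>X \<union> \<Union>L"
  have fe: "finite f" if "f \<in> X \<or> f \<in> L" for f
    using X2 L2 that by (metis card.infinite zero_neq_numeral)
  have fUL: "finite (\<Union>L)" and fUX: "finite (\<Union>X)" using finL finX fe by auto
  have fUH: "finite (\<Union>(H s))" if "s \<in> ?S" for s using H3[OF that] by (metis card.infinite not_numeral_le_zero)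
  have Hs: "s \<in> H s" if "s \<in> ?S" for s using HL[OF that] by auto
  have HE: "H s \<inter> X = {}" if s: "s \<in> ?S" for s
  proof (rule ccontr)
    assume "H s \<inter> X \<noteq> {}"
    then obtain f where f: "f \<in> H s" "f \<in> X" by auto
    then have "card f \<le> card (\<Union>(H s) \<inter> \<Union>X)" using fUX by (intro card_mono) auto
    then show False using HX[OF s] X2[OF f(2)] by simp
  qed
  have clus: "lam a (?V \<union> \<Union>?R) (X \<union> ?R) \<le> lam a ?V X - card ?S / m - d \<or>
     lam a (?V \<union> \<Union>?R) (X \<union> ?R) \<le> lam a ?V X - card ?S / m \<and>
     (\<forall>s\<in>?S. \<Union>(H s) \<inter> ?V = s) \<and> (\<forall>s\<in>?S. \<forall>t\<in>?S. s \<noteq> t \<longrightarrow> \<Union>(H s) \<inter> \<Union>(H t) \<subseteq> ?V)"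
  proof (rule cluster[where L = L])
    fix C W assume C: "C \<subseteq> ?S" "W \<subseteq> \<Union>L" "\<Union>C \<subseteq> W" "2 \<le> card C"
    show "(real (card C) - 1) / m + d \<le> real (card W) - 2"
    proof (rule Lsub)
      show "C \<noteq> L" using C(1) e by auto
      have fW: "finite W" using C(2) fUL finite_subset by blast
      have fC: "finite C" using C(4) by (metis card.infinite not_numeral_le_zero)
      obtain c1 c2 where c: "c1 \<in> C" "c2 \<in> C" "c1 \<noteq> c2"
        using C(4) by (metis card_2_iff' ex_card subset_iff)
      have k: "card c1 = 2" "card c2 = 2" using c C(1) L2 by auto
      have "c1 \<subset> c1 \<union> c2"
        using c k by (metis card_subset_eq finite_Un fW C(3) Sup_upper finite_subset sup_ge1 sup_ge2 psubsetI)
      then have "2 < card (c1 \<union> c2)" using k psubset_card_mono[of "c1 \<union> c2" c1] fW C(3) c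
        by (metis Sup_upper finite_Un finite_subset)
      also have "card (c1 \<union> c2) \<le> card W" using c C(3) fW by (intro card_mono) auto
      finally show "3 \<le> card W" by simp
    qed (use C in auto)
  qed (use finX finL fUL fUX ml d0 d1 L2 Hs Hfin H2 Hlam Hsub HE in auto)
  have eqV: "?V \<union> \<Union>?R = \<Union>(X \<union> ?T)" by blast
  have eqE: "X \<union> ?R = X \<union> ?T" using Hs by blast
  let ?J = "L \<inter> X"
  let ?W = "\<Union>L \<inter> \<Union>X"
  have lamV: "lam a ?V X = lam a (\<Union>X) X + card (\<Union>L) - card ?W"
    using lam_union[OF fUX fUL finX finite.emptyI, of a] by (simp add: lam_def Int_commute)
  have "card L = card ?S + card ?J" using finL by (metis card_Diff_subset_Int card_mono finite_Int inf_le1 le_add_diff_inverse2)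
  then have sm: "card ?S / m = (real (card L) - 1) / m - (real (card ?J) - 1) / m"
    by (simp add: diff_divide_distrib add_divide_distrib)
  have change: "lam a ?V X - card ?S / m = lam a (\<Union>X) X + ((real (card ?J) - 1) / m - (real (card ?W) - 2))"
    using lamV sm Ltot by linarith
  have eW: "e \<subseteq> ?W" using e by auto
  have W2: "2 \<le> card ?W" using card_mono[OF _ eW] fUL L2[OF e(1)] by simp
  have TF: "?T \<subseteq> \<Union>F" using HF LF by blast
  have nT: "\<not> ?T \<subseteq> X" using nLX by blast
  show ?thesis
  proof (cases "3 \<le> card ?W")
    case True
    have "(real (card ?J) - 1) / m + d \<le> real (card ?W) - 2"
      using True nLX by (intro Lsub) auto
    then have "lam a (\<Union>(X \<union> ?T)) (X \<union> ?T) \<le> lam a (\<Union>X) X - d"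
      using clus change d0 unfolding eqV eqE by linarith
    then show ?thesis unfolding degenerate_step_def using TF nT M by blast
  next
    case False
    then have cW: "card ?W = 2" using W2 by linarith
    have We: "?W = e" using card_subset_eq[OF _ eW] fUL cW L2[OF e(1)] by simp
    have "?J = {e}"
    proof -
      have "f = e" if "f \<in> ?J" for f
      proof (rule card_subset_eq)
        have "f \<subseteq> ?W" using that by auto
        then show "f \<subseteq> e" using We by simp
      qed (use that L2[of f] L2[OF e(1)] fe[of e] e in auto)
      then show ?thesis using e by blast
    qed
    then have cJ: "card ?J = 1" by simp
    have ch0: "lam a ?V X - card ?S / m = lam a (\<Union>X) X" using change cW cJ by simp
    from clus show ?thesis
    proof
      assume "lam a (?V \<union> \<Union>?R) (X \<union> ?R) \<le> lam a ?V X - card ?S / m - d"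
      then have "lam a (\<Union>(X \<union> ?T)) (X \<union> ?T) \<le> lam a (\<Union>X) X - d" using ch0 unfolding eqV eqE by linarith
      then show ?thesis unfolding degenerate_step_def using TF nT M by blast
    next
      assume A: "lam a (?V \<union> \<Union>?R) (X \<union> ?R) \<le> lam a ?V X - card ?S / m \<and>
         (\<forall>s\<in>?S. \<Union>(H s) \<inter> ?V = s) \<and> (\<forall>s\<in>?S. \<forall>t\<in>?S. s \<noteq> t \<longrightarrow> \<Union>(H s) \<inter> \<Union>(H t) \<subseteq> ?V)"
      have "card ?S = card L - 1" using \<open>card L = card ?S + card ?J\<close> cJ by simp
      then have "2 \<le> card ?S" using L3 by simp
      then obtain s t where st: "s \<in> ?S" "t \<in> ?S" "s \<noteq> t"
        by (rule two_elements)
      have HV: "\<Union>(H r) \<inter> ?V = r" if "r \<in> ?S" for r using A that by blast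
      have HH: "\<Union>(H r) \<inter> \<Union>(H u) \<subseteq> ?V" if "r \<in> ?S" "u \<in> ?S" "r \<noteq> u" for r u using A that by blast
      \<comment> \<open>\<open>H r\<close> has at least three vertices, and only the two ends of
        \<open>r\<close> lie in \<open>?V\<close>.\<close>
      have ex: "\<exists>z. z \<in> \<Union>(H r) \<and> z \<notin> ?V" if "r \<in> ?S" for r
      proof (rule ccontr)
        assume "\<not> ?thesis"
        then have "\<Union>(H r) \<inter> ?V = \<Union>(H r)" by blast
        then show False using HV[OF that] H3[OF that] L2[of r] that by simp
      qed
      obtain z1 z2 where z: "z1 \<in> \<Union>(H s)" "z1 \<notin> ?V" "z2 \<in> \<Union>(H t)" "z2 \<notin> ?V"
        using ex[OF st(1)] ex[OF st(2)] by blast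
      have only: "f \<in> H r" if "f \<in> ?T" "x \<in> f" "x \<notin> ?V" "x \<in> \<Union>(H r)" "r \<in> ?S" for f x r
      proof -
        have "f \<notin> L" using that(2,3) by auto
        then have "f \<in> ?R" using that(1) by blast
        then obtain u where u: "u \<in> ?S" "f \<in> H u" by auto
        then have "x \<in> \<Union>(H u) \<inter> \<Union>(H r)" using that(2,4) by auto
        then have "u = r" using HH[OF u(1) that(5)] that(3) by blast
        then show ?thesis using u by simp
      qed
      have zz: "z1 \<noteq> z2" using z HH[OF st] by blast
      have k1: "\<forall>f\<in>?T. \<not> (z1 \<in> f \<and> z2 \<in> f)"
      proof (intro ballI notI)
        fix f assume f: "f \<in> ?T" "z1 \<in> f \<and> z2 \<in> f"
        then have "f \<in> H s" "f \<in> H t" using only[of f z1 s] only[of f z2 t] z st by auto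
        then have "z1 \<in> \<Union>(H s) \<inter> \<Union>(H t)" using f by auto
        then show False using HH[OF st] z(2) by blast
      qed
      have k2: "owned F ?T z1 (H s)"
        unfolding owned_def using HF[OF st(1)] st(1) z(1) only[OF _ _ z(2,1) st(1)] by auto
      have k3: "owned F ?T z2 (H t)"
        unfolding owned_def using HF[OF st(2)] st(2) z(3) only[OF _ _ z(4,3) st(2)] by auto
      have k4: "\<Union>?T \<inter> \<Union>X \<subseteq> e"
      proof
        fix x assume x: "x \<in> \<Union>?T \<inter> \<Union>X"
        have "x \<in> \<Union>L"
        proof (cases "x \<in> \<Union>L")
          case False
          then obtain r where r: "r \<in> ?S" "x \<in> \<Union>(H r)" using x by auto
          then have "x \<in> r" using HV[OF r(1)] x by blast
          then show ?thesis using r by auto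
        qed simp
        then show "x \<in> e" using We x by auto
      qed
      have k5: "lam a (\<Union>(X \<union> ?T)) (X \<union> ?T) \<le> lam a (\<Union>X) X"
        using A ch0 unfolding eqV eqE by linarith
      have k6: "z1 \<notin> \<Union>X" "z2 \<notin> \<Union>X" using z(2,4) by simp_all
      have "regular_step F a M X e ?T"
        using TF M nT k5 k4 k6 zz k1 k2 k3 by (rule regular_stepI)
      then show ?thesis by blast
    qed
  qed
qed

section \<open>Exploration of a core\<close>

lemma finite_all_edges: "finite (all_edges n)"
  unfolding all_edges_def by (rule finite_subset[of _ "Pow {1..n}"]) auto

text \<open>In a state \<open>(X, Q)\<close> the graph \<open>X\<close> has been explored. A tight step meets \<open>X\<close> only inside the bounded
  set \<open>Q\<close>, so there are boundedly many ways to place it; a loose step has polynomially many. \<open>t\<close> counts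
  all steps and \<open>j\<close> the loose ones.\<close>

inductive reach :: "nat \<Rightarrow> nat \<Rightarrow> nat \<Rightarrow> nat \<Rightarrow> nat set set \<Rightarrow> nat set \<Rightarrow> bool" for n M where
  start: "reach n M 0 0 {} {}"
| tight: "reach n M t j X Q \<Longrightarrow> T \<subseteq> all_edges n \<Longrightarrow> card (\<Union>T) \<le> M \<Longrightarrow> \<Union>T \<inter> \<Union>X \<subseteq> Q \<Longrightarrow> Q' \<subseteq> \<Union>T \<Longrightarrow>
    reach n M (Suc t) j (X \<union> T) Q'"
| loose: "reach n M t j X Q \<Longrightarrow> T \<subseteq> all_edges n \<Longrightarrow> card (\<Union>T) \<le> M \<Longrightarrow> Q' \<subseteq> \<Union>T \<Longrightarrow>
    reach n M (Suc t) (Suc j) (X \<union> T) Q'"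

text \<open>This is what the exploration uses of a minimal core. Keeping the existence of a step as
  the assumption \<open>F_attach\<close> lets the cases of different and of equal densities share
  the argument.\<close>

locale exploration =
  fixes F :: "nat set set set" and a d :: real and M n :: nat
  assumes F_start: "\<exists>A\<in>F. lam a (\<Union>A) A \<le> 2"
    and F_edges: "\<Union>F \<subseteq> all_edges n"
    and F_M: "A \<in> F \<Longrightarrow> card (\<Union>A) \<le> M"
    and F_nonempty: "A \<in> F \<Longrightarrow> A \<noteq> {}"
    and F_mindeg: "A \<in> F \<Longrightarrow> x \<in> \<Union>A \<Longrightarrow> \<exists>e\<in>A. \<exists>f\<in>A. e \<noteq> f \<and> x \<in> e \<and> x \<in> f"
    and F_cross: "A \<in> F \<Longrightarrow> e \<in> A \<Longrightarrow> \<exists>B\<in>F. A \<inter> B = {e}"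
    and F_conn: "X \<subseteq> \<Union>F \<Longrightarrow> X \<noteq> {} \<Longrightarrow> (\<And>A. A \<in> F \<Longrightarrow> A \<inter> X \<noteq> {} \<Longrightarrow> A \<subseteq> X) \<Longrightarrow> X = \<Union>F"
    and F_attach: "X \<subseteq> \<Union>F \<Longrightarrow> A \<in> F \<Longrightarrow> \<not> A \<subseteq> X \<Longrightarrow> e \<in> A \<Longrightarrow> e \<in> X \<Longrightarrow>
      \<exists>T. degenerate_step F a d M X T \<or> regular_step F a M X e T"
    and d_nonneg: "0 \<le> d"
begin

lemma fin_sub: "X \<subseteq> \<Union>F \<Longrightarrow> finite X"
  using F_edges finite_all_edges by (meson finite_subset)

lemma fin_verts: "X \<subseteq> \<Union>F \<Longrightarrow> finite (\<Union>X)"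
  using F_edges by (rule_tac finite_subset[of _ "{1..n}"]) (auto simp: all_edges_def)

text \<open>Take an edge \<open>e\<close> of \<open>Q\<close> at \<open>z\<close> and a member
  crossing \<open>Q\<close> exactly in \<open>e\<close>. By minimum degree two it has a second edge
  at \<open>z\<close>; that edge is not in \<open>Q\<close>, and \<open>Q\<close> contains all
  explored edges at \<open>z\<close>, so it is still unexplored.\<close>

lemma owned_open:
  assumes "owned F X z Q"
  shows "\<exists>A\<in>F. \<exists>e\<in>Q. e \<in> A \<and> e \<in> X \<and> \<not> A \<subseteq> X"
proof -
  have Q: "Q \<in> F" "Q \<subseteq> X" "z \<in> \<Union>Q" "\<And>e. e \<in> X \<Longrightarrow> z \<in> e \<Longrightarrow> e \<in> Q"
    using assms by (auto simp: owned_def)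
  obtain e where e: "e \<in> Q" "z \<in> e" using Q(3) by auto
  obtain A where A: "A \<in> F" "Q \<inter> A = {e}" using F_cross[OF Q(1) e(1)] by auto
  have "z \<in> \<Union>A" using A e by auto
  from F_mindeg[OF A(1) this] obtain g where g: "g \<in> A" "g \<noteq> e" "z \<in> g" by metis
  have "g \<notin> X" using Q(4)[OF _ g(3)] g A by auto
  then show ?thesis using A e Q g by (intro bexI[of _ A] bexI[of _ e]) auto
qed

text \<open>The size of such a set measures progress: as long as it is nonempty, the exploration
  cannot be finished. Independence ensures that an edge meets it at most once.\<close>

definition open_set :: "nat set set \<Rightarrow> nat set \<Rightarrow> bool" where
  "open_set X Z \<longleftrightarrow> Z \<subseteq> \<Union>X \<and> (\<forall>f\<in>X. \<forall>z\<in>Z. \<forall>w\<in>Z. z \<in> f \<longrightarrow> w \<in> f \<longrightarrow> z = w) \<and> (\<forall>z\<in>Z. \<exists>Q. owned F X z Q)"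

text \<open>Open vertices outside \<open>e\<close> are not touched by \<open>T\<close>, so their
  owners persist. At most one open vertex is lost and two are gained.\<close>

lemma open_set_regular:
  assumes X: "X \<subseteq> \<Union>F" and Z: "open_set X Z" and T: "regular_step F a M X e T" and e: "e \<in> X"
  obtains Z' z Q where "open_set (X \<union> T) Z'" "card Z + 1 \<le> card Z'" "owned F (X \<union> T) z Q" "Q \<subseteq> T"
proof -
  obtain z1 z2 Q1 Q2 where z: "z1 \<notin> \<Union>X" "z2 \<notin> \<Union>X" "z1 \<noteq> z2" "\<forall>e\<in>T. \<not> (z1 \<in> e \<and> z2 \<in> e)"
    "owned F T z1 Q1" "owned F T z2 Q2" and TX: "\<Union>T \<inter> \<Union>X \<subseteq> e"
    using T unfolding regular_step_def by (elim exE conjE) (rule that; assumption)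
  have ZX: "Z \<subseteq> \<Union>X" and ind: "\<And>f z w. f \<in> X \<Longrightarrow> z \<in> Z \<Longrightarrow> w \<in> Z \<Longrightarrow> z \<in> f \<Longrightarrow> w \<in> f \<Longrightarrow> z = w"
    and own: "\<And>z. z \<in> Z \<Longrightarrow> \<exists>Q. owned F X z Q" using Z unfolding open_set_def by simp_all
  have fZ: "finite Z" using ZX fin_verts[OF X] finite_subset by blast
  have new: "owned F (X \<union> T) z1 Q1" "owned F (X \<union> T) z2 Q2"
    using z unfolding owned_def by auto
  have zT: "z1 \<in> \<Union>T" "z2 \<in> \<Union>T" using z(5,6) unfolding owned_def by auto
  let ?Z = "insert z1 (insert z2 (Z - e))"
  have old: "w \<notin> f" if "w \<in> Z - e" "f \<in> T" for w f
    using that TX ZX by blast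
  have "open_set (X \<union> T) ?Z"
    unfolding open_set_def
  proof (intro conjI ballI impI)
    show "?Z \<subseteq> \<Union>(X \<union> T)" using zT ZX by auto
    fix f u w assume f: "f \<in> X \<union> T" and uw: "u \<in> ?Z" "w \<in> ?Z" "u \<in> f" "w \<in> f"
    show "u = w"
    proof (cases "f \<in> T")
      case True
      then show ?thesis using old uw z(4) by blast
    next
      case False
      then have "f \<in> X" using f by auto
      then have "u \<in> Z" "w \<in> Z" using uw z(1,2) by blast+
      then show ?thesis using ind \<open>f \<in> X\<close> uw by blast
    qed
  next
    fix w assume "w \<in> ?Z"
    then consider "w = z1" | "w = z2" | "w \<in> Z - e" by auto
    then show "\<exists>Q. owned F (X \<union> T) w Q"
    proof cases
      case 3
      then obtain Q where "owned F X w Q" using own by auto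
      then have "owned F (X \<union> T) w Q" using old[OF 3] unfolding owned_def by auto
      then show ?thesis by blast
    qed (use new in auto)
  qed
  moreover have "card (Z \<inter> e) \<le> 1"
    using ind[OF e] fZ by (metis (no_types, lifting) IntE One_nat_def card_le_Suc0_iff_eq finite_Int)
  then have "card Z + 1 \<le> card ?Z"
  proof -
    have "z1 \<notin> Z - e" "z2 \<notin> Z - e" using z(1,2) ZX by auto
    then have "card ?Z = card (Z - e) + 2" using z(3) fZ by simp
    moreover have "card Z = card (Z - e) + card (Z \<inter> e)"
      using fZ by (metis card_Int_Diff add.commute)
    ultimately show ?thesis using \<open>card (Z \<inter> e) \<le> 1\<close> by simp
  qed
  moreover have "Q1 \<subseteq> T" using z(5) unfolding owned_def by auto
  ultimately show thesis using that new(1) by blast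
qed

lemma open_set_degenerate:
  assumes X: "X \<subseteq> \<Union>F" and Z: "open_set X Z" and T: "degenerate_step F a d M X T"
  obtains Z' where "open_set (X \<union> T) Z'" "card Z \<le> card Z' + M"
proof -
  have cT: "card (\<Union>T) \<le> M" and TF: "T \<subseteq> \<Union>F" using T unfolding degenerate_step_def by auto
  have fZ: "finite Z" using Z fin_verts[OF X] finite_subset unfolding open_set_def by blast
  have "open_set (X \<union> T) (Z - \<Union>T)"
    unfolding open_set_def
  proof (intro conjI ballI impI)
    show "Z - \<Union>T \<subseteq> \<Union>(X \<union> T)" using Z unfolding open_set_def by auto
    fix f u w assume f: "f \<in> X \<union> T" and uw: "u \<in> Z - \<Union>T" "w \<in> Z - \<Union>T" "u \<in> f" "w \<in> f"
    then have "f \<in> X" by auto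
    then show "u = w" using uw Z unfolding open_set_def by blast
  next
    fix w assume w: "w \<in> Z - \<Union>T"
    then obtain Q where "owned F X w Q" using Z unfolding open_set_def by blast
    then have "owned F (X \<union> T) w Q" using w unfolding owned_def by auto
    then show "\<exists>Q. owned F (X \<union> T) w Q" by blast
  qed
  moreover have "card Z \<le> card (Z - \<Union>T) + M"
  proof -
    have "card Z = card (Z - \<Union>T) + card (Z \<inter> \<Union>T)" using fZ by (metis card_Int_Diff add.commute)
    moreover have "card (Z \<inter> \<Union>T) \<le> card (\<Union>T)" using fin_verts[OF TF] by (intro card_mono) auto
    ultimately show ?thesis using cT by linarith
  qed
  ultimately show thesis using that by blast
qed

text \<open>\<open>k\<close> counts degenerate steps; the last conjunct says that the next step is tight
  unless the previous one was degenerate.\<close>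

definition explored :: "nat \<Rightarrow> nat \<Rightarrow> nat \<Rightarrow> nat set set \<Rightarrow> nat set \<Rightarrow> bool" where
  "explored t j k X Q \<longleftrightarrow> reach n M t j X Q \<and> X \<subseteq> \<Union>F \<and> X \<noteq> {} \<and> t \<le> card X \<and>
     lam a (\<Union>X) X \<le> 2 - d * real k \<and> card (\<Union>X) \<le> M * t \<and>
     (\<exists>Z. open_set X Z \<and> t \<le> card Z + (M + 1) * k + 1) \<and>
     ((\<exists>z P. owned F X z P \<and> \<Union>P \<subseteq> Q \<and> j \<le> 2 * k) \<or> j + 1 \<le> 2 * k)"

lemma explored_start: "\<exists>X Q. explored 1 0 0 X Q"
proof -
  obtain A where A: "A \<in> F" and A2: "lam a (\<Union>A) A \<le> 2" using F_start by auto
  have AF: "A \<subseteq> \<Union>F" using A by auto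
  obtain z where z: "z \<in> \<Union>A"
  proof -
    obtain e where e: "e \<in> A" using F_nonempty[OF A] by auto
    then have "card e = 2" using AF F_edges by (auto simp: all_edges_def)
    then have "e \<noteq> {}" by auto
    then show thesis using e that by auto
  qed
  have "reach n M (Suc 0) 0 ({} \<union> A) (\<Union>A)"
    using F_edges AF F_M[OF A] by (intro reach.tight[OF reach.start]) auto
  moreover have "1 \<le> card A" using F_nonempty[OF A] fin_sub[OF AF] by (simp add: Suc_leI card_gt_0_iff)
  moreover have "open_set A {}" by (auto simp: open_set_def)
  moreover have "owned F A z A" using A z by (auto simp: owned_def)
  ultimately have "explored 1 0 0 A (\<Union>A)"
    unfolding explored_def using A2 F_nonempty[OF A] F_M[OF A] AF by (auto intro!: exI[of _ "{}"] exI[of _ z] exI[of _ A])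
  then show ?thesis by blast
qed

lemma card_union_step:
  assumes X: "X \<subseteq> \<Union>F" and T: "T \<subseteq> \<Union>F" "\<not> T \<subseteq> X" "card (\<Union>T) \<le> M"
    and h: "t \<le> card X" "card (\<Union>X) \<le> M * t"
  shows "Suc t \<le> card (X \<union> T)" "card (\<Union>(X \<union> T)) \<le> M * Suc t"
proof -
  have "X \<subset> X \<union> T" using T(2) by auto
  then have "card X < card (X \<union> T)" using fin_sub[OF X] fin_sub[OF T(1)] by (intro psubset_card_mono) auto
  then show "Suc t \<le> card (X \<union> T)" using h by simp
  have "card (\<Union>(X \<union> T)) \<le> card (\<Union>X) + card (\<Union>T)" by (simp add: Union_Un_distrib card_Un_le)
  then show "card (\<Union>(X \<union> T)) \<le> M * Suc t" using T(3) h by simp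
qed

text \<open>If an owned vertex of the last piece is recorded, the next attachment edge can be taken
  inside \<open>Q\<close>, and a regular step is tight. Otherwise the budget for loose steps has
  room for one more, and any member that is partly explored may be used.\<close>

lemma explored_step:
  assumes st: "explored t j k X Q" and ncl: "\<exists>A\<in>F. A \<inter> X \<noteq> {} \<and> \<not> A \<subseteq> X"
  shows "\<exists>j' k' X' Q'. explored (Suc t) j' k' X' Q' \<and> k' \<le> Suc k"
proof -
  have st': "reach n M t j X Q" "X \<subseteq> \<Union>F" "X \<noteq> {}" "t \<le> card X"
     "lam a (\<Union>X) X \<le> 2 - d * real k" "card (\<Union>X) \<le> M * t"
    and rdy: "(\<exists>z P. owned F X z P \<and> \<Union>P \<subseteq> Q \<and> j \<le> 2 * k) \<or> j + 1 \<le> 2 * k"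
    using st unfolding explored_def by blast+
  obtain Z where Z: "open_set X Z" "t \<le> card Z + (M + 1) * k + 1" using st unfolding explored_def by blast
  have deg: "\<exists>Q'. explored (Suc t) (Suc j) (Suc k) (X \<union> T) Q'" if T: "degenerate_step F a d M X T" for T
  proof -
    obtain Z' where Z': "open_set (X \<union> T) Z'" "card Z \<le> card Z' + M"
      using open_set_degenerate[OF st'(2) Z(1) T] .
    have T': "T \<subseteq> \<Union>F" "card (\<Union>T) \<le> M" "\<not> T \<subseteq> X" "lam a (\<Union>(X \<union> T)) (X \<union> T) \<le> lam a (\<Union>X) X - d"
      using T unfolding degenerate_step_def by auto
    have "reach n M (Suc t) (Suc j) (X \<union> T) {}"
      using T' F_edges by (intro reach.loose[OF st'(1)]) auto
    moreover have "lam a (\<Union>(X \<union> T)) (X \<union> T) \<le> 2 - d * real (Suc k)"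
      using T'(4) st'(5) by (simp add: algebra_simps)
    \<comment> \<open>A degenerate step is charged \<open>M + 1\<close>: one for itself and
      \<open>M\<close> for the open vertices it may destroy. The final 1 accounts for the initial
      member, after which the recorded open set is empty.\<close>
    moreover have "Suc t \<le> card Z' + (M + 1) * Suc k + 1" using Z' Z(2) by simp
    \<comment> \<open>Each degenerate step brings a credit of two loose steps: itself and the step
      that follows it.\<close>
    moreover have "Suc j + 1 \<le> 2 * Suc k" using rdy by auto
    ultimately have "explored (Suc t) (Suc j) (Suc k) (X \<union> T) {}"
      unfolding explored_def using card_union_step[OF st'(2) T'(1,3,2) st'(4,6)] st'(2,3) T'(1) Z'(1) by blast
    then show ?thesis by blast
  qed
  have reg: "\<exists>Q'. explored (Suc t) j' k (X \<union> T) Q'"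
    if T: "regular_step F a M X e T" and e: "e \<in> X" and j': "j' = Suc j \<and> j + 1 \<le> 2 * k \<or> j' = j \<and> e \<subseteq> Q \<and> j \<le> 2 * k" for T e j'
  proof -
    obtain Z' z P where Z': "open_set (X \<union> T) Z'" "card Z + 1 \<le> card Z'" "owned F (X \<union> T) z P" "P \<subseteq> T"
      using open_set_regular[OF st'(2) Z(1) T e] .
    have T': "T \<subseteq> \<Union>F" "card (\<Union>T) \<le> M" "\<not> T \<subseteq> X" "lam a (\<Union>(X \<union> T)) (X \<union> T) \<le> lam a (\<Union>X) X"
      "\<Union>T \<inter> \<Union>X \<subseteq> e"
      using T unfolding regular_step_def by auto
    have "reach n M (Suc t) j' (X \<union> T) (\<Union>P)"
      using j'
    proof
      assume "j' = Suc j \<and> j + 1 \<le> 2 * k"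
      then show ?thesis using T' F_edges Z'(4) by (auto intro!: reach.loose[OF st'(1)])
    next
      assume "j' = j \<and> e \<subseteq> Q \<and> j \<le> 2 * k"
      then show ?thesis using T' F_edges Z'(4) by (auto intro!: reach.tight[OF st'(1)])
    qed
    moreover have "lam a (\<Union>(X \<union> T)) (X \<union> T) \<le> 2 - d * real k"
      using T'(4) st'(5) by linarith
    moreover have "Suc t \<le> card Z' + (M + 1) * k + 1" using Z' Z(2) by simp
    moreover have "j' \<le> 2 * k" using j' by auto
    ultimately have "explored (Suc t) j' k (X \<union> T) (\<Union>P)"
      unfolding explored_def using card_union_step[OF st'(2) T'(1,3,2) st'(4,6)] st'(2,3) T'(1) Z'(1,3) by blast
    then show ?thesis by blast
  qed
  from rdy show ?thesis
  proof
    assume "\<exists>z P. owned F X z P \<and> \<Union>P \<subseteq> Q \<and> j \<le> 2 * k"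
    then obtain z P where zP: "owned F X z P" "\<Union>P \<subseteq> Q" "j \<le> 2 * k" by blast
    obtain A e where A: "A \<in> F" "e \<in> P" "e \<in> A" "e \<in> X" "\<not> A \<subseteq> X" using owned_open[OF zP(1)] by blast
    obtain T where "degenerate_step F a d M X T \<or> regular_step F a M X e T"
      using F_attach[OF st'(2) A(1,5,3,4)] by blast
    moreover have "e \<subseteq> Q" using A zP by auto
    ultimately show ?thesis using deg[of T] reg[of e T j] A(4) zP(3) by (metis le_refl le_SucI)
  next
    assume "j + 1 \<le> 2 * k"
    obtain A e where A: "A \<in> F" "e \<in> A" "e \<in> X" "\<not> A \<subseteq> X" using ncl by blast
    obtain T where "degenerate_step F a d M X T \<or> regular_step F a M X e T"
      using F_attach[OF st'(2) A(1,4,2,3)] by blast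
    then show ?thesis using deg[of T] reg[of e T "Suc j"] A(3) \<open>j + 1 \<le> 2 * k\<close> by (metis le_refl le_SucI)
  qed
qed

text \<open>A closed exploration has no owned vertex left, so its open set is empty and the
  invariant bounds \<open>t\<close> by the number of degenerate steps. Connectedness then identifies
  \<open>X\<close> with the whole core.\<close>

lemma explored_closed:
  assumes st: "explored t j k X Q" and cl: "\<And>A. A \<in> F \<Longrightarrow> A \<inter> X \<noteq> {} \<Longrightarrow> A \<subseteq> X"
  shows "card (\<Union>(\<Union>F)) \<le> M * ((M + 1) * k + 1)"
proof -
  have st': "X \<subseteq> \<Union>F" "X \<noteq> {}" "card (\<Union>X) \<le> M * t"
    using st unfolding explored_def by simp_all
  obtain Z where Z: "open_set X Z" "t \<le> card Z + (M + 1) * k + 1" using st unfolding explored_def by blast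
  have "Z = {}"
  proof (rule ccontr)
    assume "Z \<noteq> {}"
    then obtain z P where zP: "owned F X z P" using Z(1) unfolding open_set_def by blast
    obtain A e where "A \<in> F" "e \<in> A" "e \<in> X" "\<not> A \<subseteq> X" using owned_open[OF zP] by blast
    then show False using cl[of A] by blast
  qed
  then have "t \<le> (M + 1) * k + 1" using Z by simp
  then have "M * t \<le> M * ((M + 1) * k + 1)" by (rule mult_le_mono2)
  moreover have "X = \<Union>F" by (rule F_conn[OF st'(1,2) cl])
  ultimately show ?thesis using st'(3) by simp
qed

text \<open>Getting stuck before the \<open>D\<close>-th degenerate step means a core of bounded
  size; reaching that step ends the run early with low weight. A run meeting neither lasts for
  \<open>s\<close> steps.\<close>

theorem exploration_outcome:
  assumes "1 \<le> D" "1 \<le> s"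
  shows "card (\<Union>(\<Union>F)) \<le> M * ((M + 1) * D + 1) \<or>
    (\<exists>t j X Q. reach n M t j X Q \<and> X \<subseteq> \<Union>F \<and> j \<le> 2 * D \<and> t \<le> card X \<and>
       (t = s \<and> lam a (\<Union>X) X \<le> 2 \<or> t \<le> s \<and> lam a (\<Union>X) X \<le> 2 - d * real D))"
  (is "?small \<or> ?found")
proof (rule ccontr)
  assume neg: "\<not> ?thesis"
  have "\<exists>j k X Q. explored t j k X Q \<and> k < D" if "1 \<le> t" "t \<le> s" for t
    using that
  proof (induction t rule: dec_induct)
    case base
    obtain X Q where "explored 1 0 0 X Q" using explored_start by blast
    moreover have "0 < D" using assms(1) by simp
    ultimately show ?case by blast
  next
    case (step t)
    then obtain j k X Q where st: "explored t j k X Q" "k < D" by auto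
    have ncl: "\<exists>A\<in>F. A \<inter> X \<noteq> {} \<and> \<not> A \<subseteq> X"
    proof (rule ccontr)
      assume "\<not> ?thesis"
      then have "card (\<Union>(\<Union>F)) \<le> M * ((M + 1) * k + 1)" using explored_closed[OF st(1)] by blast
      also have "\<dots> \<le> M * ((M + 1) * D + 1)" using st(2) by (intro mult_le_mono add_le_mono) auto
      finally show False using neg by blast
    qed
    obtain j' k' X' Q' where st': "explored (Suc t) j' k' X' Q'" "k' \<le> Suc k"
      using explored_step[OF st(1) ncl] by blast
    have "k' < D"
    proof (rule ccontr)
      assume "\<not> k' < D"
      then have "k' = D" using st' st by simp
      then have ?found using st'(1) step unfolding explored_def by (intro exI[of _ "Suc t"] exI[of _ j'] exI[of _ X'] exI[of _ Q']) auto
      then show False using neg by blast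
    qed
    then show ?case using st' by blast
  qed
  from this[of s] obtain j k X Q where st: "explored s j k X Q" "k < D" using assms by auto
  then have "lam a (\<Union>X) X \<le> 2 - d * k" "0 \<le> d * k" "j \<le> 2 * k"
    using d_nonneg unfolding explored_def by auto
  then have "lam a (\<Union>X) X \<le> 2" "j \<le> 2 * D" using st(2) by linarith+
  then have ?found using st(1) unfolding explored_def by (intro exI[of _ s] exI[of _ j] exI[of _ X] exI[of _ Q]) auto
  then show False using neg by blast
qed

end

section \<open>Counting explorations\<close>

lemma bounded_subsets_eq: "{B. B \<subseteq> U \<and> card B \<le> M} = (\<Union>b\<le>M. {B. B \<subseteq> U \<and> card B = b})"
  by auto

lemma sum_bounded_subsets:
  fixes x :: real
  assumes "finite U" "0 \<le> x"
  shows "(\<Sum>B | B \<subseteq> U \<and> card B \<le> M. x ^ card B) \<le> (\<Sum>b\<le>M. (card U * x) ^ b)"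
proof -
  have "(\<Sum>B | B \<subseteq> U \<and> card B \<le> M. x ^ card B) = (\<Sum>b\<le>M. \<Sum>B | B \<subseteq> U \<and> card B = b. x ^ card B)"
    unfolding bounded_subsets_eq
    by (rule sum.UNION_disjoint) (use assms in auto)
  also have "\<dots> = (\<Sum>b\<le>M. real (card U choose b) * x ^ b)"
    by (intro sum.cong) (auto simp: n_subsets[OF assms(1)])
  also have "\<dots> \<le> (\<Sum>b\<le>M. real (card U) ^ b * x ^ b)"
  proof (intro sum_mono mult_right_mono)
    fix b show "real (card U choose b) \<le> real (card U) ^ b"
    proof (cases "b \<le> card U")
      case True
      then have "card U choose b \<le> card U ^ b" by (rule binomial_le_pow)
      then show ?thesis by (metis of_nat_le_iff of_nat_power)
    qed (simp add: binomial_eq_0)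
  qed (use assms in auto)
  finally show ?thesis by (simp add: power_mult_distrib)
qed

lemma card_bounded_subsets:
  assumes "finite U"
  shows "card {B. B \<subseteq> U \<and> card B \<le> M} \<le> (M + 1) * (card U + 1) ^ M"
proof -
  have "real (card {B. B \<subseteq> U \<and> card B \<le> M}) \<le> (\<Sum>b\<le>M. real (card U) ^ b)"
    using sum_bounded_subsets[OF assms, of 1 M] by simp
  also have "\<dots> \<le> (\<Sum>b\<le>M. (real (card U) + 1) ^ M)"
  proof (rule sum_mono)
    fix b assume "b \<in> {..M}"
    then have "real (card U) ^ b \<le> (real (card U) + 1) ^ b" "(real (card U) + 1) ^ b \<le> (real (card U) + 1) ^ M"
      by (auto intro: power_mono power_increasing)
    then show "real (card U) ^ b \<le> (real (card U) + 1) ^ M" by linarith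
  qed
  also have "\<dots> = real ((M + 1) * (card U + 1) ^ M)" by (simp add: algebra_simps)
  finally show ?thesis by linarith
qed

text \<open>\<open>A\<close> restricts the trace of the new piece on the explored vertices
  \<open>V\<close>: subsets of \<open>Q\<close> for tight steps, all small subsets of
  \<open>V\<close> for loose ones.\<close>

definition extensions :: "nat \<Rightarrow> nat \<Rightarrow> nat set \<Rightarrow> nat set set \<Rightarrow> (nat set set \<times> nat set) set" where
  "extensions n M V A = {(T, Q). T \<subseteq> all_edges n \<and> card (\<Union>T) \<le> M \<and> \<Union>T \<inter> V \<in> A \<and> Q \<subseteq> \<Union>T}"

text \<open>\<open>2 ^ 2 ^ M\<close> bounds the edge sets on a given set of at most \<open>M\<close>
  vertices, \<open>2 ^ M\<close> the choices of the marked set, and \<open>M + 1\<close> the numbers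
  of new vertices.\<close>

definition ext_const :: "nat \<Rightarrow> nat" where
  "ext_const M = (M + 1) * (2 ^ 2 ^ M * 2 ^ M)"

lemma Union_all_edges: "T \<subseteq> all_edges n \<Longrightarrow> \<Union>T \<subseteq> {1..n}"
  by (auto simp: all_edges_def)

lemma finite_extensions: "finite (extensions n M V A)"
proof (rule finite_subset)
  show "extensions n M V A \<subseteq> Pow (all_edges n) \<times> Pow {1..n}"
    using Union_all_edges unfolding extensions_def by blast
qed (simp add: finite_all_edges)

text \<open>Every new vertex has at most \<open>n\<close> choices, which its weight
  \<open>1 / n\<close> cancels. What remains is the choice of the trace and a constant independent
  of \<open>n\<close>.\<close>

lemma extensions_weight:
  assumes n: "1 \<le> n" and fA: "finite A"
  shows "(\<Sum>(T, Q)\<in>extensions n M V A. (1 / real n) ^ card (\<Union>T - V)) \<le> real (card A * ext_const M)"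
proof -
  let ?x = "1 / real n"
  define Bs where "Bs = {B. B \<subseteq> {1..n} \<and> card B \<le> M}"
  define K where "K = (\<lambda>W :: nat set. if card W \<le> M \<and> finite W then Pow (Pow W) \<times> Pow W else {})"
  \<comment> \<open>The old trace and the new vertices determine the vertex set of the piece; this
    leaves boundedly many edge sets and marked sets.\<close>
  define G where "G = (\<lambda>(T, Q). (\<Union>T \<inter> V, \<Union>T - V, T, Q) :: nat set \<times> nat set \<times> nat set set \<times> nat set)"
  have fBs: "finite Bs" unfolding Bs_def by simp
  have fK: "finite (K W)" for W unfolding K_def by auto
  have cK: "card (K W) \<le> 2 ^ 2 ^ M * 2 ^ M" for W
  proof (cases "card W \<le> M \<and> finite W")
    case True
    then have "card (K W) = 2 ^ 2 ^ card W * 2 ^ card W" by (simp add: K_def card_Pow card_cartesian_product)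
    also have "\<dots> \<le> 2 ^ 2 ^ M * 2 ^ M" using True by (intro mult_le_mono power_increasing) auto
    finally show ?thesis .
  qed (auto simp: K_def)
  have inj: "inj_on G (extensions n M V A)" by (auto simp: G_def inj_on_def)
  have sub: "G ` extensions n M V A \<subseteq> (SIGMA a:A. SIGMA b:Bs. K (a \<union> b))"
  proof (rule image_subsetI)
    fix TQ assume TQ: "TQ \<in> extensions n M V A"
    then obtain T Q where eq: "TQ = (T, Q)" by (cases TQ)
    then have h: "T \<subseteq> all_edges n" "card (\<Union>T) \<le> M" "\<Union>T \<inter> V \<in> A" "Q \<subseteq> \<Union>T"
      using TQ by (auto simp: extensions_def)
    have fT: "finite (\<Union>T)" using Union_all_edges[OF h(1)] finite_subset by blast
    have "card (\<Union>T - V) \<le> M" using h(2) fT by (meson card_mono Diff_subset le_trans)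
    then have "\<Union>T - V \<in> Bs" using Union_all_edges[OF h(1)] by (auto simp: Bs_def)
    moreover have "\<Union>T \<inter> V \<union> (\<Union>T - V) = \<Union>T" by blast
    moreover have "T \<in> Pow (Pow (\<Union>T))" by blast
    ultimately show "G TQ \<in> (SIGMA a:A. SIGMA b:Bs. K (a \<union> b))"
      using h fT eq by (auto simp: G_def K_def)
  qed
  have "(\<Sum>(T, Q)\<in>extensions n M V A. ?x ^ card (\<Union>T - V)) = (\<Sum>(a, b, TQ)\<in>G ` extensions n M V A. ?x ^ card b)"
    by (subst sum.reindex[OF inj]) (auto simp: G_def intro!: sum.cong)
  also have "\<dots> \<le> (\<Sum>(a, b, TQ)\<in>(SIGMA a:A. SIGMA b:Bs. K (a \<union> b)). ?x ^ card b)"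
    using sub fA fBs fK by (intro sum_mono2) auto
  also have "\<dots> = (\<Sum>a\<in>A. \<Sum>b\<in>Bs. \<Sum>TQ\<in>K (a \<union> b). ?x ^ card b)"
  proof -
    have "(\<Sum>(a, b, TQ)\<in>(SIGMA a:A. SIGMA b:Bs. K (a \<union> b)). ?x ^ card b) = (\<Sum>a\<in>A. \<Sum>bTQ\<in>(SIGMA b:Bs. K (a \<union> b)). case bTQ of (b, TQ) \<Rightarrow> ?x ^ card b)"
      by (subst sum.Sigma[symmetric]) (use fA fBs fK in auto)
    also have "\<dots> = (\<Sum>a\<in>A. \<Sum>b\<in>Bs. \<Sum>TQ\<in>K (a \<union> b). ?x ^ card b)"
      by (intro sum.cong refl, subst sum.Sigma[symmetric]) (use fBs fK in auto)
    finally show ?thesis .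
  qed
  also have "\<dots> \<le> (\<Sum>a\<in>A. \<Sum>b\<in>Bs. real (2 ^ 2 ^ M * 2 ^ M) * ?x ^ card b)"
  proof (intro sum_mono)
    fix a b
    have "(\<Sum>TQ\<in>K (a \<union> b). ?x ^ card b) = real (card (K (a \<union> b))) * ?x ^ card b" by simp
    also have "\<dots> \<le> real (2 ^ 2 ^ M * 2 ^ M) * ?x ^ card b"
      using cK[of "a \<union> b"] by (intro mult_right_mono) (simp_all only: of_nat_le_iff, simp)
    finally show "(\<Sum>TQ\<in>K (a \<union> b). ?x ^ card b) \<le> real (2 ^ 2 ^ M * 2 ^ M) * ?x ^ card b" .
  qed
  also have "\<dots> = real (card A) * (real (2 ^ 2 ^ M * 2 ^ M) * (\<Sum>b\<in>Bs. ?x ^ card b))"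
    by (simp add: sum_distrib_left)
  also have "\<dots> \<le> real (card A) * (real (2 ^ 2 ^ M * 2 ^ M) * real (M + 1))"
  proof (intro mult_left_mono)
    have "(\<Sum>b\<in>Bs. ?x ^ card b) \<le> (\<Sum>b\<le>M. (card {1..n} * ?x) ^ b)"
      unfolding Bs_def by (rule sum_bounded_subsets) auto
    also have "\<dots> = real (M + 1)" using n by simp
    finally show "(\<Sum>b\<in>Bs. ?x ^ card b) \<le> real (M + 1)" .
  qed auto
  also have "\<dots> = real (card A * ext_const M)" by (simp add: ext_const_def algebra_simps)
  finally show ?thesis .
qed

lemma reach_bounds:
  assumes "reach n M t j X Q"
  shows "X \<subseteq> all_edges n" "Q \<subseteq> {1..n}" "card Q \<le> M" "card (\<Union>X) \<le> M * t" "finite (\<Union>X)"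
proof -
  have "X \<subseteq> all_edges n \<and> Q \<subseteq> {1..n} \<and> card Q \<le> M \<and> card (\<Union>X) \<le> M * t"
    using assms
  proof induction
    case (tight t j X Q T Q')
    have fT: "finite (\<Union>T)" using Union_all_edges[OF tight(2)] finite_subset by blast
    have "card Q' \<le> card (\<Union>T)" using tight(5) fT by (intro card_mono) auto
    moreover have "card (\<Union>(X \<union> T)) \<le> card (\<Union>X) + card (\<Union>T)" by (simp add: Union_Un_distrib card_Un_le)
    ultimately show ?case using tight Union_all_edges[OF tight(2)] by auto
  next
    case (loose t j X Q T Q')
    have fT: "finite (\<Union>T)" using Union_all_edges[OF loose(2)] finite_subset by blast
    have "card Q' \<le> card (\<Union>T)" using loose(4) fT by (intro card_mono) auto
    moreover have "card (\<Union>(X \<union> T)) \<le> card (\<Union>X) + card (\<Union>T)" by (simp add: Union_Un_distrib card_Un_le)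
    ultimately show ?case using loose Union_all_edges[OF loose(2)] by auto
  qed auto
  then show "X \<subseteq> all_edges n" "Q \<subseteq> {1..n}" "card Q \<le> M" "card (\<Union>X) \<le> M * t" by auto
  then have "\<Union>X \<subseteq> {1..n}" by (intro Union_all_edges)
  then show "finite (\<Union>X)" by (rule finite_subset) simp
qed

definition states :: "nat \<Rightarrow> nat \<Rightarrow> nat \<Rightarrow> nat \<Rightarrow> (nat set set \<times> nat set) set" where
  "states n M t j = {(X, Q). reach n M t j X Q}"

text \<open>The factor \<open>n powr - v\<close> compensates for the number of ways to place
  \<open>v\<close> vertices. An upper bound on this sum becomes a bound on the expected number of
  states once it is combined with \<open>power_le_lam\<close>.\<close>

definition states_weight :: "nat \<Rightarrow> nat \<Rightarrow> nat \<Rightarrow> nat \<Rightarrow> real" where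
  "states_weight n M t j = (\<Sum>(X, Q)\<in>states n M t j. (1 / real n) ^ card (\<Union>X))"

lemma finite_states: "finite (states n M t j)"
proof (rule finite_subset)
  show "states n M t j \<subseteq> Pow (all_edges n) \<times> Pow {1..n}"
    unfolding states_def using reach_bounds by blast
qed (simp add: finite_all_edges)

text \<open>The weight factors over old and new vertices, so the sum over the choices at a fixed
  state is that of \<open>extensions_weight\<close>. Several choices may lead to the same state,
  hence only an inequality for the image.\<close>

lemma successors_weight:
  assumes n: "1 \<le> n" and A: "\<And>X Q. (X, Q) \<in> states n M t j \<Longrightarrow> finite (A X Q) \<and> card (A X Q) \<le> c"
  shows "(\<Sum>(X', Q')\<in>(\<lambda>((X, Q), (T, Q')). (X \<union> T, Q')) ` (SIGMA (X, Q):states n M t j. extensions n M (\<Union>X) (A X Q)).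
      (1 / real n) ^ card (\<Union>X')) \<le> real (c * ext_const M) * states_weight n M t j"
proof -
  let ?x = "1 / real n"
  let ?h = "\<lambda>((X, Q), (T, Q')). (X \<union> T, Q') :: nat set set \<times> nat set"
  let ?S = "SIGMA (X, Q):states n M t j. extensions n M (\<Union>X) (A X Q)"
  have fS: "finite ?S" using finite_states finite_extensions by (intro finite_SigmaI) auto
  have "(\<Sum>(X', Q')\<in>?h ` ?S. ?x ^ card (\<Union>X')) \<le> (\<Sum>s\<in>?S. ((\<lambda>(X', Q'). ?x ^ card (\<Union>X')) \<circ> ?h) s)"
    by (rule sum_image_le[OF fS]) (auto split: prod.splits)
  also have "\<dots> = (\<Sum>XQ\<in>states n M t j. \<Sum>TQ\<in>(case XQ of (X, Q) \<Rightarrow> extensions n M (\<Union>X) (A X Q)).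
       ?x ^ card (\<Union>(fst XQ \<union> fst TQ)))"
    by (subst sum.Sigma) (auto simp: finite_states finite_extensions intro!: sum.cong split: prod.splits)
  also have "\<dots> \<le> (\<Sum>XQ\<in>states n M t j. real (c * ext_const M) * ?x ^ card (\<Union>(fst XQ)))"
  proof (rule sum_mono)
    fix XQ assume "XQ \<in> states n M t j"
    then obtain X Q where XQ: "XQ = (X, Q)" "(X, Q) \<in> states n M t j" by (cases XQ) auto
    have fX: "finite (\<Union>X)" using XQ(2) reach_bounds(5) unfolding states_def by auto
    have "(\<Sum>TQ\<in>extensions n M (\<Union>X) (A X Q). ?x ^ card (\<Union>(X \<union> fst TQ)))
       = (\<Sum>TQ\<in>extensions n M (\<Union>X) (A X Q). ?x ^ card (\<Union>X) * (case TQ of (T, Q) \<Rightarrow> ?x ^ card (\<Union>T - \<Union>X)))"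
    proof (rule sum.cong[OF refl])
      fix TQ assume "TQ \<in> extensions n M (\<Union>X) (A X Q)"
      then obtain T Q' where TQ: "TQ = (T, Q')" "T \<subseteq> all_edges n" by (auto simp: extensions_def)
      have fT: "finite (\<Union>T)" using Union_all_edges[OF TQ(2)] finite_subset by blast
      have "\<Union>(X \<union> T) = \<Union>X \<union> (\<Union>T - \<Union>X)" by blast
      then have "card (\<Union>(X \<union> T)) = card (\<Union>X) + card (\<Union>T - \<Union>X)"
        using fX fT by (metis Diff_disjoint card_Un_disjoint finite_Diff)
      then show "?x ^ card (\<Union>(X \<union> fst TQ)) = ?x ^ card (\<Union>X) * (case TQ of (T, Q) \<Rightarrow> ?x ^ card (\<Union>T - \<Union>X))"
        using TQ by (simp add: power_add)
    qed
    also have "\<dots> = ?x ^ card (\<Union>X) * (\<Sum>(T, Q)\<in>extensions n M (\<Union>X) (A X Q). ?x ^ card (\<Union>T - \<Union>X))"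
      by (simp add: sum_distrib_left)
    also have "\<dots> \<le> ?x ^ card (\<Union>X) * real (card (A X Q) * ext_const M)"
      using A[OF XQ(2)] by (intro mult_left_mono extensions_weight[OF n]) auto
    also have "\<dots> \<le> ?x ^ card (\<Union>X) * real (c * ext_const M)"
      using A[OF XQ(2)] by (intro mult_left_mono) (auto simp only: of_nat_le_iff intro!: mult_le_mono, simp)
    finally show "(\<Sum>TQ\<in>(case XQ of (X, Q) \<Rightarrow> extensions n M (\<Union>X) (A X Q)). ?x ^ card (\<Union>(fst XQ \<union> fst TQ)))
        \<le> real (c * ext_const M) * ?x ^ card (\<Union>(fst XQ))"
      unfolding XQ(1) by (simp add: mult.commute)
  qed
  also have "\<dots> = real (c * ext_const M) * states_weight n M t j"
    unfolding states_weight_def sum_distrib_left by (auto intro!: sum.cong)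
  finally show ?thesis .
qed

text \<open>The first summand is the cost of a tight step, whose trace is one of at most
  \<open>2 ^ M\<close> subsets of \<open>Q\<close>. The second is the cost of a loose step without
  its factor \<open>(t + 2) ^ M\<close>, which \<open>states_weight_bound\<close> keeps
  apart.\<close>

definition growth :: "nat \<Rightarrow> nat" where
  "growth M = 2 ^ M * ext_const M + (M + 1) * (M + 1) ^ M * ext_const M"

lemma states_Suc:
  "states n M (Suc t) j \<subseteq>
    (\<lambda>((X, Q), (T, Q')). (X \<union> T, Q')) ` (SIGMA (X, Q):states n M t j. extensions n M (\<Union>X) (Pow Q)) \<union>
    (if j = 0 then {} else (\<lambda>((X, Q), (T, Q')). (X \<union> T, Q')) `
       (SIGMA (X, Q):states n M t (j - 1). extensions n M (\<Union>X) {A. A \<subseteq> \<Union>X \<and> card A \<le> M}))"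
  (is "_ \<subseteq> ?tight \<union> ?loose")
proof clarify
  fix X' Q' assume "(X', Q') \<in> states n M (Suc t) j" and nl: "(X', Q') \<notin> ?loose"
  then have "reach n M (Suc t) j X' Q'" by (simp add: states_def)
  then show "(X', Q') \<in> ?tight"
  proof cases
    case (tight X Q T)
    then have "((X, Q), (T, Q')) \<in> (SIGMA (X, Q):states n M t j. extensions n M (\<Union>X) (Pow Q))"
      by (auto simp: states_def extensions_def)
    then show ?thesis using tight(1) by (auto intro!: image_eqI[of _ _ "((X, Q), (T, Q'))"])
  next
    case (loose i X Q T)
    have fT: "finite (\<Union>T)" using Union_all_edges[OF loose(4)] finite_subset by blast
    have "card (\<Union>T \<inter> \<Union>X) \<le> M" using loose(5) fT by (meson card_mono inf_le1 le_trans)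
    then have "((X, Q), (T, Q')) \<in> (SIGMA (X, Q):states n M t i. extensions n M (\<Union>X) {A. A \<subseteq> \<Union>X \<and> card A \<le> M})"
      using loose by (auto simp: states_def extensions_def)
    then have "(X', Q') \<in> ?loose" using loose(1,2) by (auto intro!: image_eqI[of _ _ "((X, Q), (T, Q'))"])
    then show ?thesis using nl by blast
  qed
qed

text \<open>Only the \<open>j\<close> loose steps pay a power of \<open>t\<close>, because only they
  choose their trace among all explored vertices, of which there are at most
  \<open>M * t\<close>.\<close>

lemma states_weight_bound:
  assumes n: "1 \<le> n"
  shows "states_weight n M t j \<le> real (growth M) ^ t * real (t + 2) ^ (M * j)"
proof (induction t arbitrary: j)
  case 0
  have "reach n M 0 j X Q \<longleftrightarrow> j = 0 \<and> X = {} \<and> Q = {}" for X Q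
    by (auto elim: reach.cases intro: reach.start)
  then have "states n M 0 j = (if j = 0 then {({}, {})} else {})" by (auto simp: states_def)
  then show ?case by (simp add: states_weight_def)
next
  case (Suc t)
  let ?x = "1 / real n"
  let ?h = "\<lambda>((X, Q), (T, Q')). (X \<union> T, Q') :: nat set set \<times> nat set"
  let ?tight = "?h ` (SIGMA (X, Q):states n M t j. extensions n M (\<Union>X) (Pow Q))"
  let ?loose = "?h ` (SIGMA (X, Q):states n M t (j - 1). extensions n M (\<Union>X) {A. A \<subseteq> \<Union>X \<and> card A \<le> M})"
  let ?w = "\<lambda>(X :: nat set set, Q :: nat set). ?x ^ card (\<Union>X)"
  let ?p = "real (t + 2) ^ (M * j)"
  have ft: "finite ?tight" "finite ?loose"
    using finite_states finite_extensions by (auto intro!: finite_imageI finite_SigmaI)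
  have wnn: "0 \<le> ?w s" for s by (auto split: prod.splits)
  have st: "sum ?w ?tight \<le> real (2 ^ M * ext_const M) * states_weight n M t j"
  proof (rule successors_weight[OF n, where A = "\<lambda>X Q. Pow Q"])
    fix X Q assume "(X, Q) \<in> states n M t j"
    then have "finite Q" "card Q \<le> M" using reach_bounds[of n M t j X Q] finite_subset by (auto simp: states_def)
    then show "finite (Pow Q) \<and> card (Pow Q) \<le> 2 ^ M" by (simp add: card_Pow)
  qed
  also have "\<dots> \<le> real (2 ^ M * ext_const M) * (real (growth M) ^ t * ?p)"
    by (intro mult_left_mono Suc.IH) simp
  finally have tight: "sum ?w ?tight \<le> real (2 ^ M * ext_const M) * (real (growth M) ^ t * ?p)" .
  have total: "states_weight n M (Suc t) j \<le> real (growth M) * (real (growth M) ^ t * ?p)"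
  proof (cases "j = 0")
    case True
    have "states_weight n M (Suc t) j \<le> sum ?w ?tight"
      unfolding states_weight_def using states_Suc[of n M t j] True ft wnn by (intro sum_mono2) auto
    also note tight
    also have "real (2 ^ M * ext_const M) * (real (growth M) ^ t * ?p) \<le> real (growth M) * (real (growth M) ^ t * ?p)"
      unfolding growth_def by (intro mult_right_mono) auto
    finally show ?thesis .
  next
    case False
    then obtain i where i: "j = Suc i" by (cases j) auto
    have "sum ?w ?loose \<le> real ((M + 1) * ((M + 1) ^ M * (t + 2) ^ M) * ext_const M) * states_weight n M t (j - 1)"
    proof (rule successors_weight[OF n, where A = "\<lambda>X Q. {A. A \<subseteq> \<Union>X \<and> card A \<le> M}"])
      fix X Q assume "(X, Q) \<in> states n M t (j - 1)"
      then have f: "finite (\<Union>X)" "card (\<Union>X) \<le> M * t" using reach_bounds[of n M t "j - 1" X Q] by (auto simp: states_def)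
      have "card {A. A \<subseteq> \<Union>X \<and> card A \<le> M} \<le> (M + 1) * (card (\<Union>X) + 1) ^ M"
        by (rule card_bounded_subsets[OF f(1)])
      also have "\<dots> \<le> (M + 1) * ((M + 1) * (t + 2)) ^ M"
        using f(2) by (intro mult_le_mono power_mono) auto
      also have "\<dots> = (M + 1) * ((M + 1) ^ M * (t + 2) ^ M)" by (simp only: power_mult_distrib)
      finally show "finite {A. A \<subseteq> \<Union>X \<and> card A \<le> M} \<and>
          card {A. A \<subseteq> \<Union>X \<and> card A \<le> M} \<le> (M + 1) * ((M + 1) ^ M * (t + 2) ^ M)"
        using f(1) by simp
    qed
    also have "\<dots> \<le> real ((M + 1) * ((M + 1) ^ M * (t + 2) ^ M) * ext_const M) *
        (real (growth M) ^ t * real (t + 2) ^ (M * (j - 1)))"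
      by (intro mult_left_mono Suc.IH) simp
    also have "\<dots> = real ((M + 1) * (M + 1) ^ M * ext_const M) * (real (growth M) ^ t * ?p)"
      by (simp add: i power_add algebra_simps)
    finally have loose: "sum ?w ?loose \<le> real ((M + 1) * (M + 1) ^ M * ext_const M) * (real (growth M) ^ t * ?p)" .
    have "states_weight n M (Suc t) j \<le> sum ?w (?tight \<union> ?loose)"
      unfolding states_weight_def using states_Suc[of n M t j] False ft wnn by (intro sum_mono2) auto
    also have "\<dots> \<le> sum ?w ?tight + sum ?w ?loose"
      using sum.union_inter[OF ft, of ?w] sum_nonneg[of "?tight \<inter> ?loose" ?w] wnn by (smt (verit))
    also have "\<dots> \<le> real (2 ^ M * ext_const M) * (real (growth M) ^ t * ?p)
       + real ((M + 1) * (M + 1) ^ M * ext_const M) * (real (growth M) ^ t * ?p)"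
      using tight loose by linarith
    also have "\<dots> = real (growth M) * (real (growth M) ^ t * ?p)"
      unfolding growth_def by (simp only: of_nat_add distrib_right)
    finally show ?thesis .
  qed
  also have "\<dots> \<le> real (growth M) * (real (growth M) ^ t * real (Suc t + 2) ^ (M * j))"
    by (intro mult_left_mono power_mono) auto
  finally show ?case by (simp add: mult_ac)
qed

section \<open>From explorations to the random graph\<close>

lemma prob_contains:
  assumes S: "S \<subseteq> all_edges n" and p: "0 \<le> p" "p \<le> 1"
  shows "measure_pmf.prob (Gnp n p) {G. S \<subseteq> edges G} = p ^ card S"
proof -
  let ?B = "\<lambda>e. if e \<in> S then {True} else UNIV"
  have fS: "finite S" using S finite_all_edges finite_subset by blast
  have "measure_pmf.prob (Gnp n p) {G. S \<subseteq> edges G}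
      = measure_pmf.prob (Pi_pmf (all_edges n) False (\<lambda>_. bernoulli_pmf p)) (Pi (all_edges n) ?B)"
    unfolding Gnp_def measure_map_pmf using S by (intro arg_cong2[where f = measure] refl) (auto simp: Pi_def subset_iff split: if_splits)
  also have "\<dots> = (\<Prod>e\<in>all_edges n. measure_pmf.prob (bernoulli_pmf p) (?B e))"
    by (rule measure_Pi_pmf_Pi) (rule finite_all_edges)
  also have "\<dots> = (\<Prod>e\<in>all_edges n. if e \<in> S then p else 1)"
    using p by (intro prod.cong) (auto simp: measure_pmf_single)
  also have "\<dots> = (\<Prod>e\<in>S. p)"
    using S finite_all_edges by (simp add: prod.If_cases Int_absorb1)
  finally show ?thesis by simp
qed

lemma prob_union_bound:
  assumes I: "finite I" and s: "\<And>i. i \<in> I \<Longrightarrow> s i \<subseteq> all_edges n" and p: "0 \<le> p" "p \<le> 1"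
    and E: "\<And>G. G \<in> E \<Longrightarrow> G \<in> set_pmf (Gnp n p) \<Longrightarrow> \<exists>i\<in>I. s i \<subseteq> edges G"
  shows "measure_pmf.prob (Gnp n p) E \<le> (\<Sum>i\<in>I. p ^ card (s i))"
proof -
  have "measure_pmf.prob (Gnp n p) E = measure_pmf.prob (Gnp n p) (E \<inter> set_pmf (Gnp n p))"
    by (simp add: measure_Int_set_pmf)
  also have "\<dots> \<le> measure_pmf.prob (Gnp n p) (\<Union>i\<in>I. {G. s i \<subseteq> edges G})"
    using E by (intro measure_pmf.finite_measure_mono) auto
  also have "\<dots> \<le> (\<Sum>i\<in>I. measure_pmf.prob (Gnp n p) {G. s i \<subseteq> edges G})"
    using I by (intro measure_pmf.finite_measure_subadditive_finite) auto
  also have "\<dots> = (\<Sum>i\<in>I. p ^ card (s i))"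
    using s p by (intro sum.cong refl prob_contains)
  finally show ?thesis .
qed

lemma set_pmf_Gnp: "G \<in> set_pmf (Gnp n p) \<Longrightarrow> verts G = {1..n} \<and> edges G \<subseteq> all_edges n"
  by (auto simp: Gnp_def)

section \<open>First moment estimates\<close>

lemma finite_pos_lower_bound:
  assumes "finite Z" "\<And>z. z \<in> Z \<Longrightarrow> (0::real) < z"
  obtains e where "0 < e" "e \<le> 1" "\<And>z. z \<in> Z \<Longrightarrow> e \<le> z"
proof -
  have "finite (insert 1 Z)" using assms by simp
  then have "0 < Min (insert 1 Z)" "Min (insert 1 Z) \<le> 1" "\<And>z. z \<in> Z \<Longrightarrow> Min (insert 1 Z) \<le> z"
    using assms by (auto simp: Min_gr_iff)
  then show thesis using that by blast
qed

text \<open>Of the factor \<open>c ^ card X\<close> only \<open>c ^ t\<close> is kept. Since each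
  step adds a new edge, this is an exponential gain in the number of steps.\<close>

lemma power_le_lam:
  assumes n: "1 \<le> n" and c: "0 < c" "c \<le> 1" and p: "0 \<le> p" "p \<le> c * real n powr (- 1 / a)"
    and t: "t \<le> card X" and l: "lam a (\<Union>X) X \<le> mu"
  shows "p ^ card X \<le> c ^ t * real n powr mu * (1 / real n) ^ card (\<Union>X)"
proof -
  have n0: "0 < real n" using n by simp
  have "p ^ card X \<le> (c * real n powr (- 1 / a)) ^ card X" using p by (intro power_mono)
  also have "\<dots> = c ^ card X * real n powr (lam a (\<Union>X) X) * real n powr (- real (card (\<Union>X)))"
  proof -
    have "(real n powr (- 1 / a)) ^ card X = real n powr (real (card X) * (- 1 / a))"
      using n0 by (metis powr_powr powr_realpow powr_gt_zero mult.commute)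
    also have "real (card X) * (- 1 / a) = lam a (\<Union>X) X + (- real (card (\<Union>X)))" by (simp add: lam_def)
    finally show ?thesis by (simp only: power_mult_distrib powr_add mult.assoc)
  qed
  also have "\<dots> \<le> c ^ t * real n powr mu * real n powr (- real (card (\<Union>X)))"
    using n c t l by (intro mult_mono power_decreasing powr_mono) auto
  also have "real n powr (- real (card (\<Union>X))) = (1 / real n) ^ card (\<Union>X)"
    using n0 by (simp add: powr_minus powr_realpow power_one_over inverse_eq_divide)
  finally show ?thesis .
qed

lemma power_le_fact_exp: "0 \<le> x \<Longrightarrow> x ^ k \<le> fact k * exp (x::real)"
proof -
  assume x: "0 \<le> x"
  have "x ^ k / fact k \<le> (\<Sum>i. x ^ i /\<^sub>R fact i)"
  proof -
    have "(\<Sum>i\<in>{k}. x ^ i /\<^sub>R fact i) \<le> (\<Sum>i. x ^ i /\<^sub>R fact i)"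
      using x by (intro sum_le_suminf summable_exp_generic) auto
    then show ?thesis by (simp add: divide_inverse mult.commute)
  qed
  then show ?thesis unfolding exp_def by (simp add: field_simps)
qed

text \<open>In \<open>c ^ t\<close> the denominator absorbs \<open>growth M ^ t\<close>. One of the
  two factors \<open>exp (- t)\<close> absorbs the polynomial \<open>(t + 2) ^ (M * J)\<close>,
  bounded through the exponential series, and the other one is left as the gain.\<close>

lemma states_expectation:
  assumes n: "1 \<le> n" and p: "0 \<le> p" "p \<le> exp (- 2) / (real (growth M) + 1) * real n powr (- 1 / a)" and jJ: "j \<le> J"
  shows "(\<Sum>(X, Q)\<in>{(X, Q)\<in>states n M t j. t \<le> card X \<and> lam a (\<Union>X) X \<le> mu}. p ^ card X)
    \<le> fact (M * J) * exp 2 * (real n powr mu * exp (- real t))"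
proof -
  let ?c = "exp (- 2) / (real (growth M) + 1) :: real"
  have c: "0 < ?c" "?c \<le> 1"
  proof -
    have "exp (- 2) \<le> (1::real)" by simp
    then have "exp (- 2) \<le> real (growth M) + 1" by linarith
    then show "?c \<le> 1" by (simp add: divide_le_eq)
  qed (simp add: add_nonneg_pos)
  have "(\<Sum>(X, Q)\<in>{(X, Q)\<in>states n M t j. t \<le> card X \<and> lam a (\<Union>X) X \<le> mu}. p ^ card X)
     \<le> (\<Sum>(X, Q)\<in>{(X, Q)\<in>states n M t j. t \<le> card X \<and> lam a (\<Union>X) X \<le> mu}. ?c ^ t * real n powr mu * (1 / real n) ^ card (\<Union>X))"
    using power_le_lam[OF n c p] by (intro sum_mono) auto
  also have "\<dots> \<le> (\<Sum>(X, Q)\<in>states n M t j. ?c ^ t * real n powr mu * (1 / real n) ^ card (\<Union>X))"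
    using finite_states c by (intro sum_mono2) auto
  also have "\<dots> = ?c ^ t * real n powr mu * states_weight n M t j"
    unfolding states_weight_def sum_distrib_left by (auto intro!: sum.cong)
  also have "\<dots> \<le> ?c ^ t * real n powr mu * (real (growth M) ^ t * real (t + 2) ^ (M * j))"
    using c by (intro mult_left_mono states_weight_bound n) auto
  also have "\<dots> \<le> ?c ^ t * real n powr mu * (real (growth M) ^ t * (fact (M * J) * exp (real (t + 2))))"
  proof -
    have "real (t + 2) ^ (M * j) \<le> real (t + 2) ^ (M * J)" using jJ by (intro power_increasing) auto
    also have "\<dots> \<le> fact (M * J) * exp (real (t + 2))" by (rule power_le_fact_exp) simp
    finally show ?thesis using c by (intro mult_left_mono) auto
  qed
  also have "\<dots> = (?c * real (growth M)) ^ t * (real n powr mu * (fact (M * J) * exp (real (t + 2))))"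
    by (simp only: power_mult_distrib mult_ac)
  also have "\<dots> \<le> exp (- 2) ^ t * (real n powr mu * (fact (M * J) * exp (real (t + 2))))"
  proof (intro mult_right_mono power_mono)
    show "?c * real (growth M) \<le> exp (- 2)" by (simp add: divide_le_eq)
  qed auto
  also have "\<dots> = fact (M * J) * exp 2 * (real n powr mu * exp (- real t))"
    by (simp add: exp_add exp_of_nat_mult[symmetric] exp_minus field_simps flip: exp_of_nat_mult exp_add)
  finally show ?thesis .
qed

definition dense_sets :: "nat \<Rightarrow> nat \<Rightarrow> real \<Rightarrow> nat set set set" where
  "dense_sets n N a = {S. S \<subseteq> all_edges n \<and> card (\<Union>S) \<le> N \<and> a * real (card (\<Union>S)) < real (card S)}"

lemma finite_dense_sets: "finite (dense_sets n N a)"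
  by (rule finite_subset[of _ "Pow (all_edges n)"]) (auto simp: dense_sets_def finite_all_edges)

text \<open>Bounded vertex sets allow only finitely many pairs of a vertex and an edge number, so
  the excess \<open>e / a - v\<close> of a dense set is bounded below by a common positive
  \<open>eta\<close>.\<close>

lemma dense_expectation:
  assumes a: "0 < a"
  obtains eta where "0 < eta" "\<And>n c p. 1 \<le> n \<Longrightarrow> 0 < c \<Longrightarrow> c \<le> 1 \<Longrightarrow> 0 \<le> p \<Longrightarrow> p \<le> c * real n powr (- 1 / a) \<Longrightarrow>
    (\<Sum>S\<in>dense_sets n N a. p ^ card S) \<le> real (ext_const N) * real n powr (- eta)"
proof -
  define Z where "Z = (\<lambda>(v, e). real e / a - real v) ` {(v, e). v \<le> N \<and> e \<le> 2 ^ N \<and> a * real v < real e}"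
  have "{(v, e). v \<le> N \<and> e \<le> 2 ^ N \<and> a * real v < real e} \<subseteq> {..N} \<times> {..2 ^ N}" by auto
  then have fZ: "finite Z" unfolding Z_def by (intro finite_imageI) (meson finite_SigmaI finite_atMost finite_subset)
  have "0 < z" if "z \<in> Z" for z
    using that a by (auto simp: Z_def field_simps)
  then obtain eta where eta: "0 < eta" "\<And>z. z \<in> Z \<Longrightarrow> eta \<le> z"
    using finite_pos_lower_bound[OF fZ] by metis
  show thesis
  proof (rule that[OF eta(1)])
    fix n :: nat and c p :: real
    assume n: "1 \<le> n" and c: "0 < c" "c \<le> 1" and p: "0 \<le> p" "p \<le> c * real n powr (- 1 / a)"
    have "(\<Sum>S\<in>dense_sets n N a. p ^ card S) \<le> (\<Sum>S\<in>dense_sets n N a. real n powr (- eta) * (1 / real n) ^ card (\<Union>S))"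
    proof (rule sum_mono)
      fix S assume "S \<in> dense_sets n N a"
      then have S: "S \<subseteq> all_edges n" "card (\<Union>S) \<le> N" "a * real (card (\<Union>S)) < real (card S)" by (auto simp: dense_sets_def)
      have fS: "finite (\<Union>S)" using Union_all_edges[OF S(1)] by (rule finite_subset) simp
      have "card S \<le> card (Pow (\<Union>S))" using fS by (intro card_mono) auto
      also have "\<dots> \<le> 2 ^ N" using fS S(2) by (simp add: card_Pow power_increasing)
      finally have "real (card S) / a - real (card (\<Union>S)) \<in> Z" using S unfolding Z_def by force
      then have "lam a (\<Union>S) S \<le> - eta" using eta(2) unfolding lam_def by fastforce
      from power_le_lam[OF n c p _ this, of 0]
      show "p ^ card S \<le> real n powr (- eta) * (1 / real n) ^ card (\<Union>S)" by simp
    qed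
    also have "\<dots> = real n powr (- eta) * (\<Sum>S\<in>dense_sets n N a. (1 / real n) ^ card (\<Union>S))"
      by (simp add: sum_distrib_left)
    finally have le: "(\<Sum>S\<in>dense_sets n N a. p ^ card S) \<le>
      real n powr (- eta) * (\<Sum>S\<in>dense_sets n N a. (1 / real n) ^ card (\<Union>S))" .
    \<comment> \<open>A dense set is a one-step extension of the empty state with empty marked set,
      so it is already counted by \<open>extensions_weight\<close>.\<close>
    have "(\<Sum>S\<in>dense_sets n N a. (1 / real n) ^ card (\<Union>S)) = (\<Sum>(T, Q)\<in>(\<lambda>S. (S, {} :: nat set)) ` dense_sets n N a. (1 / real n) ^ card (\<Union>T - {}))"
      by (subst sum.reindex) (auto simp: inj_on_def)
    also have "\<dots> \<le> (\<Sum>(T, Q)\<in>extensions n N {} {{}}. (1 / real n) ^ card (\<Union>T - {}))"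
      by (intro sum_mono2 finite_extensions) (auto simp: extensions_def dense_sets_def)
    also have "\<dots> \<le> real (ext_const N)" using extensions_weight[OF n, where A = "{{}}" and M = N and V = "{}"] by simp
    finally have "real n powr (- eta) * (\<Sum>S\<in>dense_sets n N a. (1 / real n) ^ card (\<Union>S))
      \<le> real n powr (- eta) * real (ext_const N)" by (intro mult_left_mono) auto
    then show "(\<Sum>S\<in>dense_sets n N a. p ^ card S) \<le> real (ext_const N) * real n powr (- eta)"
      using le by (simp only: mult.commute)
  qed
qed

text \<open>Three kinds of witnesses are excluded by expectation: dense sets, states of weight at
  most 2 after exactly \<open>s\<close> steps, and states of weight at most -1 after at most
  \<open>s\<close> steps. For the last kind the sum over \<open>t\<close> converges thanks to the
  factor \<open>exp (- t)\<close>, so no logarithm is lost.\<close>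

theorem zero_statement:
  fixes R :: "graph set" and a :: real
  assumes a: "0 < a"
    and R: "\<And>n G s. 1 \<le> n \<Longrightarrow> 1 \<le> s \<Longrightarrow> verts G = {1..n} \<Longrightarrow> edges G \<subseteq> all_edges n \<Longrightarrow> G \<in> R \<Longrightarrow>
      (\<exists>S\<in>dense_sets n N a. S \<subseteq> edges G) \<or>
      (\<exists>t j X Q. reach n M t j X Q \<and> X \<subseteq> edges G \<and> j \<le> J \<and> t \<le> card X \<and>
         (t = s \<and> lam a (\<Union>X) X \<le> 2 \<or> t \<le> s \<and> lam a (\<Union>X) X \<le> - 1))"
  shows "\<exists>c>0. \<forall>p :: nat \<Rightarrow> real. (\<forall>n. 0 \<le> p n \<and> p n \<le> 1) \<and> (\<forall>n\<ge>1. p n \<le> c * real n powr (- 1 / a)) \<longrightarrow>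
     (\<lambda>n. measure_pmf.prob (Gnp n (p n)) R) \<longlonglongrightarrow> 0"
proof -
  define c where "c = exp (- 2) / (real (growth M) + 1)"
  have c: "0 < c" "c \<le> 1"
  proof -
    have "exp (- 2) \<le> (1::real)" by simp
    then have "exp (- 2) \<le> real (growth M) + 1" by linarith
    then show "c \<le> 1" by (simp add: divide_le_eq c_def)
  qed (simp add: add_nonneg_pos c_def)
  obtain eta where eta: "0 < eta" and dense: "\<And>n c p. 1 \<le> n \<Longrightarrow> 0 < c \<Longrightarrow> c \<le> 1 \<Longrightarrow> 0 \<le> p \<Longrightarrow>
     p \<le> c * real n powr (- 1 / a) \<Longrightarrow> (\<Sum>S\<in>dense_sets n N a. p ^ card S) \<le> real (ext_const N) * real n powr (- eta)"
    using dense_expectation[OF a] by metis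
  define B where "B = (real J + 1) * (fact (M * J) * exp 2)"
  have B0: "0 \<le> B" by (simp add: B_def)
  have "(\<lambda>n. measure_pmf.prob (Gnp n (p n)) R) \<longlonglongrightarrow> 0"
    if p: "\<forall>n. 0 \<le> p n \<and> p n \<le> 1" and pc: "\<forall>n\<ge>1. p n \<le> c * real n powr (- 1 / a)" for p
  proof (rule tendsto_sandwich[OF _ _ tendsto_const])
    let ?f = "\<lambda>n. real (ext_const N) * real n powr (- eta) + 3 * B * real n powr (- 1)"
    show "\<forall>\<^sub>F n in sequentially. 0 \<le> measure_pmf.prob (Gnp n (p n)) R" by simp
    have "((\<lambda>n. real n powr (- eta)) \<longlongrightarrow> 0) sequentially" "((\<lambda>n. real n powr (- 1)) \<longlongrightarrow> 0) sequentially"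
      using eta by (intro tendsto_neg_powr filterlim_real_sequentially; simp)+
    then have "?f \<longlonglongrightarrow> real (ext_const N) * 0 + 3 * B * 0" by (intro tendsto_intros)
    then show "?f \<longlonglongrightarrow> 0" by simp
    show "\<forall>\<^sub>F n in sequentially. measure_pmf.prob (Gnp n (p n)) R \<le> ?f n"
    proof (rule eventually_sequentiallyI[of 1])
      fix n :: nat assume n: "1 \<le> n"
      have pn: "0 \<le> p n" "p n \<le> 1" "p n \<le> c * real n powr (- 1 / a)" using p pc n by auto
      \<comment> \<open>Weight 2 contributes \<open>n powr 2\<close>, which
        \<open>exp (- s) <= n powr (- 3)\<close> turns into \<open>n powr (- 1)\<close>. Adding 1
        keeps \<open>s\<close> positive when \<open>n = 1\<close>.\<close>
      define s where "s = nat \<lceil>3 * ln (real n)\<rceil> + 1"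
      have s: "1 \<le> s" by (simp add: s_def)
      have "3 * ln (real n) \<le> real s" by (simp add: s_def) linarith
      then have "exp (- real s) \<le> exp (- (3 * ln (real n)))" by simp
      also have "\<dots> = real n powr (- 3)" using n by (simp add: powr_def)
      finally have es: "exp (- real s) \<le> real n powr (- 3)" .
      define A where "A = (\<lambda>t j mu. {(X, Q)\<in>states n M t j. t \<le> card X \<and> lam a (\<Union>X) X \<le> mu})"
      have fA: "finite (A t j mu)" for t j mu unfolding A_def using finite_states by (rule rev_finite_subset) auto
      have EA: "(\<Sum>j\<le>J. \<Sum>(X, Q)\<in>A t j mu. p n ^ card X) \<le> B * (real n powr mu * exp (- real t))" for t mu
      proof -
        have "(\<Sum>j\<le>J. \<Sum>(X, Q)\<in>A t j mu. p n ^ card X) \<le> (\<Sum>j\<le>J. fact (M * J) * exp 2 * (real n powr mu * exp (- real t)))"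
          unfolding A_def using states_expectation[OF n pn(1) pn(3)[unfolded c_def]] by (intro sum_mono) auto
        also have "\<dots> = B * (real n powr mu * exp (- real t))" by (simp add: B_def algebra_simps)
        finally show ?thesis .
      qed
      define R1 where "R1 = {G. \<exists>S\<in>dense_sets n N a. S \<subseteq> edges G}"
      define R2 where "R2 = (\<lambda>t mu. {G. \<exists>j\<le>J. \<exists>(X, Q)\<in>A t j mu. X \<subseteq> edges G})"
      have P1: "measure_pmf.prob (Gnp n (p n)) R1 \<le> real (ext_const N) * real n powr (- eta)"
      proof -
        have "measure_pmf.prob (Gnp n (p n)) R1 \<le> (\<Sum>S\<in>dense_sets n N a. p n ^ card S)"
          by (rule prob_union_bound) (use pn finite_dense_sets in \<open>auto simp: R1_def dense_sets_def\<close>)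
        then show ?thesis using dense[OF n c pn(1,3)] by linarith
      qed
      have P2: "measure_pmf.prob (Gnp n (p n)) (R2 t mu) \<le> B * (real n powr mu * exp (- real t))" for t mu
      proof -
        have "measure_pmf.prob (Gnp n (p n)) (R2 t mu) \<le> (\<Sum>i\<in>(SIGMA j:{..J}. A t j mu). p n ^ card (fst (snd i)))"
        proof (rule prob_union_bound)
          show "finite (SIGMA j:{..J}. A t j mu)" using fA by auto
          show "fst (snd i) \<subseteq> all_edges n" if "i \<in> (SIGMA j:{..J}. A t j mu)" for i
            using that reach_bounds(1) by (fastforce simp: A_def states_def)
          show "\<exists>i\<in>SIGMA j:{..J}. A t j mu. fst (snd i) \<subseteq> edges G" if "G \<in> R2 t mu" for G
            using that unfolding R2_def by force
        qed (use pn in auto)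
        also have "\<dots> = (\<Sum>j\<le>J. \<Sum>(X, Q)\<in>A t j mu. p n ^ card X)"
          by (subst sum.Sigma) (use fA in \<open>auto intro!: sum.cong\<close>)
        finally show ?thesis using EA[of t mu] by linarith
      qed
      have "measure_pmf.prob (Gnp n (p n)) R = measure_pmf.prob (Gnp n (p n)) (R \<inter> set_pmf (Gnp n (p n)))"
        by (simp add: measure_Int_set_pmf)
      also have "\<dots> \<le> measure_pmf.prob (Gnp n (p n)) (R1 \<union> (R2 s 2 \<union> (\<Union>t\<in>{..s}. R2 t (- 1))))"
      proof (intro measure_pmf.finite_measure_mono)
        show "R \<inter> set_pmf (Gnp n (p n)) \<subseteq> R1 \<union> (R2 s 2 \<union> (\<Union>t\<in>{..s}. R2 t (- 1)))"
        proof
          fix G assume "G \<in> R \<inter> set_pmf (Gnp n (p n))"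
          then have G: "G \<in> R" "verts G = {1..n}" "edges G \<subseteq> all_edges n" using set_pmf_Gnp[of G n "p n"] by auto
          from R[OF n s G(2,3,1)] show "G \<in> R1 \<union> (R2 s 2 \<union> (\<Union>t\<in>{..s}. R2 t (- 1)))"
          proof
            assume "\<exists>t j X Q. reach n M t j X Q \<and> X \<subseteq> edges G \<and> j \<le> J \<and> t \<le> card X \<and>
               (t = s \<and> lam a (\<Union>X) X \<le> 2 \<or> t \<le> s \<and> lam a (\<Union>X) X \<le> - 1)"
            then obtain t j X Q where h: "reach n M t j X Q" "X \<subseteq> edges G" "j \<le> J" "t \<le> card X"
               "t = s \<and> lam a (\<Union>X) X \<le> 2 \<or> t \<le> s \<and> lam a (\<Union>X) X \<le> - 1" by blast
            from h(5) show ?thesis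
            proof
              assume "t = s \<and> lam a (\<Union>X) X \<le> 2"
              then have "(X, Q) \<in> A s j 2" using h by (simp add: A_def states_def)
              then have "G \<in> R2 s 2" using h unfolding R2_def by blast
              then show ?thesis by blast
            next
              assume *: "t \<le> s \<and> lam a (\<Union>X) X \<le> - 1"
              then have "(X, Q) \<in> A t j (- 1)" using h by (simp add: A_def states_def)
              then have "G \<in> R2 t (- 1)" using h unfolding R2_def by blast
              then show ?thesis using * by blast
            qed
          qed (auto simp: R1_def)
        qed
      qed auto
      also have "\<dots> \<le> measure_pmf.prob (Gnp n (p n)) R1 + (measure_pmf.prob (Gnp n (p n)) (R2 s 2)
           + measure_pmf.prob (Gnp n (p n)) (\<Union>t\<in>{..s}. R2 t (- 1)))"
        by (intro order_trans[OF measure_Un_le] add_left_mono measure_Un_le) auto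
      also have "measure_pmf.prob (Gnp n (p n)) (\<Union>t\<in>{..s}. R2 t (- 1)) \<le> (\<Sum>t\<le>s. measure_pmf.prob (Gnp n (p n)) (R2 t (- 1)))"
        by (intro measure_pmf.finite_measure_subadditive_finite) auto
      also have "\<dots> \<le> (\<Sum>t\<le>s. B * real n powr (- 1) * (1 / 2) ^ t)"
      proof (rule sum_mono)
        fix t
        have "exp (- real t) = exp (- 1) ^ t" by (simp add: exp_of_nat_mult[symmetric])
        also have "\<dots> \<le> (1 / 2) ^ t"
          using exp_ge_add_one_self[of 1] by (intro power_mono) (auto simp: exp_minus field_simps)
        finally have "B * real n powr (- 1) * exp (- real t) \<le> B * real n powr (- 1) * (1 / 2) ^ t"
          using B0 by (intro mult_left_mono) auto
        then show "measure_pmf.prob (Gnp n (p n)) (R2 t (- 1)) \<le> B * real n powr (- 1) * (1 / 2) ^ t"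
          using P2[of t "- 1"] by (simp add: mult.assoc)
      qed
      also have "\<dots> = B * real n powr (- 1) * (\<Sum>t\<le>s. (1 / 2) ^ t)" by (simp add: sum_distrib_left)
      also have "\<dots> \<le> B * real n powr (- 1) * 2"
      proof (rule mult_left_mono)
        have "(\<Sum>t\<le>s. (1 / 2) ^ t) \<le> (\<Sum>t. (1 / 2 :: real) ^ t)" by (intro sum_le_suminf summable_geometric) auto
        also have "\<dots> = 2" by (subst suminf_geometric) auto
        finally show "(\<Sum>t\<le>s. (1 / 2 :: real) ^ t) \<le> 2" .
      qed (use B0 in auto)
      finally have "measure_pmf.prob (Gnp n (p n)) R \<le> measure_pmf.prob (Gnp n (p n)) R1
          + (measure_pmf.prob (Gnp n (p n)) (R2 s 2) + B * real n powr (- 1) * 2)" by simp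
      moreover have "measure_pmf.prob (Gnp n (p n)) (R2 s 2) \<le> B * real n powr (- 1)"
      proof -
        have "real n powr 2 * exp (- real s) \<le> real n powr 2 * real n powr (- 3)" using es by (intro mult_left_mono) auto
        also have "\<dots> = real n powr (2 + - 3)" by (rule powr_add[symmetric])
        also have "2 + - 3 = (- 1 :: real)" by simp
        finally have "B * (real n powr 2 * exp (- real s)) \<le> B * real n powr (- 1)" using B0 by (intro mult_left_mono)
        then show ?thesis using P2[of s 2] by linarith
      qed
      ultimately show "measure_pmf.prob (Gnp n (p n)) R \<le> ?f n" using P1 by linarith
    qed
  qed
  then show ?thesis using c(1) by blast
qed

section \<open>Two-colouring sparse graphs\<close>

definition edges_in :: "'a set set \<Rightarrow> 'a set \<Rightarrow> nat" where
  "edges_in E X = card {e \<in> E. e \<subseteq> X}"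

text \<open>This submodular function is nonnegative on all finite sets when no subgraph has density
  above \<open>m\<close>. On a single edge it equals \<open>2 * m - 1\<close>, the value that
  \<open>good\<close> requires larger sets to exceed.\<close>

definition pot :: "real \<Rightarrow> 'a set set \<Rightarrow> 'a set \<Rightarrow> real" where
  "pot m E X = m * real (card X) - real (edges_in E X)"

text \<open>No subgraph \<open>J\<close> on at least three vertices with \<open>(e\<^sub>J - 1) / (v\<^sub>J - 2) \<ge> m\<close>.\<close>

definition good :: "real \<Rightarrow> 'a set set \<Rightarrow> bool" where
  "good m R \<longleftrightarrow> (\<forall>X. finite X \<longrightarrow> 3 \<le> card X \<longrightarrow> 2 * m - 1 < pot m R X)"

definition star :: "'a \<Rightarrow> 'a set \<Rightarrow> 'a set set" where
  "star v A = (\<lambda>u. {u, v}) ` A"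

lemma pot_submodular:
  assumes "finite R" "finite X" "finite Y"
  shows "pot m R (X \<union> Y) + pot m R (X \<inter> Y) \<le> pot m R X + pot m R Y"
proof -
  let ?S = "\<lambda>X. {e \<in> R. e \<subseteq> X}"
  have "card (?S X) + card (?S Y) = card (?S X \<union> ?S Y) + card (?S X \<inter> ?S Y)"
    using assms by (intro card_Un_Int) auto
  moreover have "card (?S X \<union> ?S Y) \<le> card (?S (X \<union> Y))" using assms by (intro card_mono) auto
  moreover have "?S X \<inter> ?S Y = ?S (X \<inter> Y)" by auto
  ultimately have "edges_in R X + edges_in R Y \<le> edges_in R (X \<union> Y) + edges_in R (X \<inter> Y)"
    unfolding edges_in_def by simp
  then have i: "real (edges_in R X) + real (edges_in R Y) \<le> real (edges_in R (X \<union> Y)) + real (edges_in R (X \<inter> Y))"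
    by linarith
  have c: "real (card X) + real (card Y) = real (card (X \<union> Y)) + real (card (X \<inter> Y))"
    using card_Un_Int[OF assms(2,3)] by linarith
  have "m * real (card X) + m * real (card Y) = m * real (card (X \<union> Y)) + m * real (card (X \<inter> Y))"
    using c by (metis distrib_left)
  then show ?thesis using i unfolding pot_def by linarith
qed

text \<open>The edges of \<open>R\<close> inside \<open>X\<close> and those of \<open>B\<close>
  inside \<open>Y\<close> are different edges of \<open>E\<close> inside the union. The common
  vertices, counted twice on the right, are subtracted.\<close>

lemma pot_two_colours:
  assumes "finite E" "R \<subseteq> E" "B \<subseteq> E" "R \<inter> B = {}" "finite X" "finite Y"
  shows "pot m E (X \<union> Y) \<le> pot m R X + pot m B Y - m * real (card (X \<inter> Y))"
proof -
  have "card {e \<in> R. e \<subseteq> X} + card {e \<in> B. e \<subseteq> Y} = card ({e \<in> R. e \<subseteq> X} \<union> {e \<in> B. e \<subseteq> Y})"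
    using assms by (intro card_Un_disjoint[symmetric]) (auto intro: finite_subset)
  also have "\<dots> \<le> card {e \<in> E. e \<subseteq> X \<union> Y}" using assms by (intro card_mono) auto
  finally have i: "real (edges_in R X) + real (edges_in B Y) \<le> real (edges_in E (X \<union> Y))" unfolding edges_in_def by linarith
  have c: "real (card X) + real (card Y) = real (card (X \<union> Y)) + real (card (X \<inter> Y))"
    using card_Un_Int[OF assms(5,6)] by linarith
  have "m * real (card X) + m * real (card Y) = m * real (card (X \<union> Y)) + m * real (card (X \<inter> Y))"
    using c by (metis distrib_left)
  then show ?thesis using i unfolding pot_def by linarith
qed

lemma inside_small:
  assumes "\<forall>e\<in>R. card e = 2" "finite X" "card X \<le> 1"
  shows "edges_in R X = 0"
proof -
  have "\<not> e \<subseteq> X" if "e \<in> R" for e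
    using assms(1,3) card_mono[OF assms(2), of e] that by auto
  then have "{e \<in> R. e \<subseteq> X} = {}" by blast
  then show ?thesis unfolding edges_in_def by (simp only: card.empty)
qed

lemma inside_two:
  assumes "\<forall>e\<in>R. card e = 2" "card X = 2"
  shows "edges_in R X = (if X \<in> R then 1 else 0)"
proof -
  have "finite X" using assms(2) by (metis card.infinite zero_neq_numeral)
  then have "e = X" if "e \<in> R" "e \<subseteq> X" for e
    using assms that by (intro card_subset_eq) auto
  then have "{e \<in> R. e \<subseteq> X} = (if X \<in> R then {X} else {})" by auto
  then show ?thesis unfolding edges_in_def by simp
qed

lemma good_pot_ge:
  assumes "good m R" "\<forall>e\<in>R. card e = 2" "finite X" "2 \<le> card X"
  shows "2 * m - 1 \<le> pot m R X"
proof (cases "card X = 2")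
  case True
  then show ?thesis using inside_two[OF assms(2) True] by (simp add: pot_def)
next
  case False
  then have "3 \<le> card X" using assms(4) by linarith
  then show ?thesis using assms(1,3) unfolding good_def by fastforce
qed

lemma good_pot_ge_one:
  assumes "good m R" "\<forall>e\<in>R. card e = 2" "finite X" "X \<noteq> {}" "1 \<le> m"
  shows "m \<le> pot m R X"
proof (cases "2 \<le> card X")
  case True
  then show ?thesis using good_pot_ge[OF assms(1-3) True] assms(5) by linarith
next
  case False
  then have "card X = 1" using assms(3,4) by (metis card_0_eq less_2_cases not_le One_nat_def)
  then show ?thesis using inside_small[OF assms(2,3)] by (simp add: pot_def)
qed

section \<open>Adding a vertex with its star, and gluing disjoint pieces\<close>

lemma inside_star:
  assumes fin: "finite R" "finite A" and v: "\<forall>e\<in>R. v \<notin> e" "v \<notin> A" "v \<notin> X" and X: "finite X"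
  shows "edges_in (R \<union> star v A) (insert v X) = edges_in R X + card (A \<inter> X)"
proof -
  have "{e \<in> R \<union> star v A. e \<subseteq> insert v X} = {e \<in> R. e \<subseteq> X} \<union> star v (A \<inter> X)"
    using v unfolding star_def by auto
  moreover have "card ({e \<in> R. e \<subseteq> X} \<union> star v (A \<inter> X)) = card {e \<in> R. e \<subseteq> X} + card (star v (A \<inter> X))"
    using fin v by (intro card_Un_disjoint) (auto simp: star_def)
  moreover have "card (star v (A \<inter> X)) = card (A \<inter> X)"
    unfolding star_def using v by (intro card_image) (auto simp: inj_on_def doubleton_eq_iff)
  ultimately show ?thesis unfolding edges_in_def by simp
qed

lemma pot_star:
  assumes "finite R" "finite A" "\<forall>e\<in>R. v \<notin> e" "v \<notin> A" "v \<notin> X" "finite X"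
  shows "pot m (R \<union> star v A) (insert v X) = pot m R X + m - real (card (A \<inter> X))"
  using assms inside_star[OF assms] by (simp add: pot_def algebra_simps)

lemma good_star:
  assumes R: "finite R" "good m R" and A: "finite A" and v: "\<forall>e\<in>R. v \<notin> e" "v \<notin> A"
    and ok: "\<And>X. finite X \<Longrightarrow> v \<notin> X \<Longrightarrow> 2 \<le> card X \<Longrightarrow> m - 1 + real (card (A \<inter> X)) < pot m R X"
  shows "good m (R \<union> star v A)"
  unfolding good_def
proof (intro allI impI)
  fix X :: "'a set" assume X: "finite X" "3 \<le> card X"
  show "2 * m - 1 < pot m (R \<union> star v A) X"
  proof (cases "v \<in> X")
    case True
    let ?X = "X - {v}"
    have X': "insert v ?X = X" "finite ?X" "v \<notin> ?X" "2 \<le> card ?X" using True X by auto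
    have "pot m (R \<union> star v A) X = pot m R ?X + m - real (card (A \<inter> ?X))"
      using pot_star[OF R(1) A v X'(3,2)] X'(1) by simp
    then show ?thesis using ok[OF X'(2-4)] by linarith
  next
    case False
    then have "{e \<in> R \<union> star v A. e \<subseteq> X} = {e \<in> R. e \<subseteq> X}" by (auto simp: star_def)
    then have "pot m (R \<union> star v A) X = pot m R X" by (simp add: pot_def edges_in_def)
    then show ?thesis using R(2) X unfolding good_def by auto
  qed
qed

text \<open>If \<open>X\<close> meets both pieces, each part has potential at least
  \<open>m\<close>, and \<open>2 * m\<close> exceeds \<open>2 * m - 1\<close>.\<close>

lemma good_disjoint_union:
  assumes R: "good m R" "\<forall>e\<in>R. card e = 2" "finite R" and P: "good m P" "\<forall>e\<in>P. card e = 2" "finite P"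
    and dis: "\<Union>R \<inter> \<Union>P = {}" and m: "1 \<le> m"
  shows "good m (R \<union> P)"
  unfolding good_def
proof (intro allI impI)
  fix X :: "'a set" assume X: "finite X" "3 \<le> card X"
  let ?Y = "X \<inter> \<Union>P" and ?W = "X - \<Union>P"
  have RP: "R \<inter> P = {}"
  proof -
    have "e \<notin> P" if "e \<in> R" for e
    proof
      assume "e \<in> P"
      then have "e = {}" using dis that by blast
      then show False using R(2) that by auto
    qed
    then show ?thesis by blast
  qed
  have "{e \<in> R \<union> P. e \<subseteq> X} = {e \<in> R. e \<subseteq> ?W} \<union> {e \<in> P. e \<subseteq> ?Y}" using dis by blast
  moreover have "card ({e \<in> R. e \<subseteq> ?W} \<union> {e \<in> P. e \<subseteq> ?Y}) = card {e \<in> R. e \<subseteq> ?W} + card {e \<in> P. e \<subseteq> ?Y}"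
    using RP R(3) P(3) by (intro card_Un_disjoint) auto
  ultimately have i: "edges_in (R \<union> P) X = edges_in R ?W + edges_in P ?Y" unfolding edges_in_def by simp
  have c: "card X = card ?W + card ?Y" using X(1) by (metis card_Int_Diff add.commute)
  have s: "pot m (R \<union> P) X = pot m R ?W + pot m P ?Y" unfolding pot_def i c by (simp add: algebra_simps)
  show "2 * m - 1 < pot m (R \<union> P) X"
  proof (cases "?W = {} \<or> ?Y = {}")
    case True
    then show ?thesis
    proof
      assume e: "?W = {}"
      then have "?Y = X" by blast
      moreover have "pot m R ?W = 0" unfolding e using inside_small[OF R(2), of "{}"] by (simp add: pot_def)
      ultimately have ?thesis if "2 * m - 1 < pot m P X" using that s by simp
      then show ?thesis using P(1) X unfolding good_def by simp
    next
      assume e: "?Y = {}"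
      then have "?W = X" by blast
      moreover have "pot m P ?Y = 0" unfolding e using inside_small[OF P(2), of "{}"] by (simp add: pot_def)
      ultimately have ?thesis if "2 * m - 1 < pot m R X" using that s by simp
      then show ?thesis using R(1) X unfolding good_def by simp
    qed
  next
    case False
    then have ne: "?W \<noteq> {}" "?Y \<noteq> {}" by auto
    have "finite ?W" "finite ?Y" using X(1) by auto
    then show ?thesis
      using s good_pot_ge_one[OF R(1,2) _ ne(1) m] good_pot_ge_one[OF P(1,2) _ ne(2) m] by linarith
  qed
qed

text \<open>The 5-cycle serves for K5, which is the union of two edge-disjoint 5-cycles. Three
  vertices span fewer than three of its edges, four at most four, and more at most five.\<close>

lemma good_pentagon:
  assumes "distinct [a, b, c, d, e]"
  shows "good 2 {{a, b}, {b, c}, {c, d}, {d, e}, {e, a}}"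
  unfolding good_def
proof (intro allI impI)
  let ?P = "{{a, b}, {b, c}, {c, d}, {d, e}, {e, a}}"
  fix X :: "'a set" assume X: "finite X" "3 \<le> card X"
  have P5: "card ?P \<le> 5" by (simp add: card_insert_if)
  have le5: "edges_in ?P X \<le> 5"
    unfolding edges_in_def by (rule order_trans[OF card_mono P5]) auto
  consider "card X = 3" | "card X = 4" | "5 \<le> card X" using X(2) by linarith
  then have "edges_in ?P X + 3 < 2 * card X"
  proof cases
    case 1
    then obtain x y z where xyz: "X = {x, y, z}" "x \<noteq> y" "y \<noteq> z" "x \<noteq> z" by (auto simp: card_3_iff)
    have "edges_in ?P X < 3"
    proof (rule ccontr)
      assume "\<not> edges_in ?P X < 3"
      then have ge: "3 \<le> card {f \<in> ?P. f \<subseteq> X}" unfolding edges_in_def by simp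
      have sub: "{f \<in> ?P. f \<subseteq> X} \<subseteq> {{x, y}, {y, z}, {x, z}}"
      proof
        fix f assume f: "f \<in> {f \<in> ?P. f \<subseteq> X}"
        then obtain p q where "f = {p, q}" "p \<noteq> q" using assms by auto
        then show "f \<in> {{x, y}, {y, z}, {x, z}}" using f xyz(1) by (auto simp: insert_commute)
      qed
      have "card {{x, y}, {y, z}, {x, z}} \<le> 3" by (simp add: card_insert_if)
      have eq: "{f \<in> ?P. f \<subseteq> X} = {{x, y}, {y, z}, {x, z}}"
        using ge sub \<open>card {{x, y}, {y, z}, {x, z}} \<le> 3\<close> by (intro card_seteq) auto
      have "{{x, y}, {y, z}, {x, z}} \<subseteq> ?P" unfolding eq[symmetric] by (rule Collect_restrict)
      then have "{x, y} \<in> ?P" "{y, z} \<in> ?P" "{x, z} \<in> ?P" by (simp_all only: insert_subset)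
      then show False using assms xyz(2-4) by (auto simp: doubleton_eq_iff)
    qed
    then show ?thesis using 1 by simp
  next
    case 2
    have "{f \<in> ?P. f \<subseteq> X} \<noteq> ?P"
    proof
      assume eq: "{f \<in> ?P. f \<subseteq> X} = ?P"
      have "f \<subseteq> X" if "f \<in> ?P" for f
      proof -
        have "f \<in> {f \<in> ?P. f \<subseteq> X}" unfolding eq by (rule that)
        then show ?thesis by (simp only: mem_Collect_eq)
      qed
      from this[of "{a, b}"] this[of "{c, d}"] this[of "{d, e}"] have "{a, b, c, d, e} \<subseteq> X" by simp
      then have "card {a, b, c, d, e} \<le> card X" using X(1) by (rule card_mono[rotated])
      then show False using 2 assms by simp
    qed
    moreover have "{f \<in> ?P. f \<subseteq> X} \<subseteq> ?P" by (rule Collect_restrict)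
    ultimately have "{f \<in> ?P. f \<subseteq> X} \<subset> ?P" by (rule psubsetI[rotated])
    then have "edges_in ?P X < card ?P" unfolding edges_in_def by (intro psubset_card_mono) auto
    then show ?thesis using P5 2 by simp
  qed (use le5 in simp)
  then show "2 * 2 - 1 < pot 2 ?P X" unfolding pot_def by linarith
qed

text \<open>This is the failure of the condition in \<open>good_star\<close>: joining
  \<open>v\<close> to \<open>A\<close> in this colour would make \<open>X\<close> together with
  \<open>v\<close> too dense.\<close>

definition blocked :: "real \<Rightarrow> 'a set set \<Rightarrow> 'a \<Rightarrow> 'a set \<Rightarrow> 'a set \<Rightarrow> bool" where
  "blocked m R v A X \<longleftrightarrow> finite X \<and> v \<notin> X \<and> 2 \<le> card X \<and> pot m R X \<le> m - 1 + real (card (A \<inter> X))"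

text \<open>The blocking inequality is compared with the lower bound \<open>2 * m - 1\<close> for
  the potential. In particular, a set of fewer than \<open>m\<close> neighbours is never
  blocked.\<close>

lemma blocked_card:
  assumes "blocked m R v A X" "good m R" "\<forall>e\<in>R. card e = 2"
  shows "m \<le> real (card (A \<inter> X))" "3 \<le> card X \<Longrightarrow> m < real (card (A \<inter> X))"
proof -
  have X: "finite X" "2 \<le> card X" "pot m R X \<le> m - 1 + real (card (A \<inter> X))"
    using assms(1) unfolding blocked_def by auto
  show "m \<le> real (card (A \<inter> X))" using good_pot_ge[OF assms(2,3) X(1,2)] X(3) by linarith
  assume "3 \<le> card X"
  then have "2 * m - 1 < pot m R X" using assms(2) X unfolding good_def by blast
  then show "m < real (card (A \<inter> X))" using X(3) by linarith
qed

text \<open>If a vertex \<open>v\<close> of degree \<open>2 * k + 1\<close> cannot be coloured with \<open>k + 1\<close> edges of one colour, then every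
  \<open>(k + 1)\<close>-subset of its neighbourhood lies in a tight set; by submodularity so does the whole
  neighbourhood, in both colours, which contradicts sparsity.\<close>

lemma cover_neighbourhood:
  fixes N :: "'a set"
  assumes R: "good m R" "\<forall>e\<in>R. card e = 2" "finite R" and k: "2 \<le> k" and N: "finite N" "card N = 2 * k + 1" and m: "1 \<le> m"
    and cov: "\<And>A. A \<subseteq> N \<Longrightarrow> card A = k + 1 \<Longrightarrow> \<exists>X. finite X \<and> v \<notin> X \<and> A \<subseteq> X \<and> pot m R X \<le> m + real k"
  obtains X where "finite X" "v \<notin> X" "N \<subseteq> X" "pot m R X \<le> m + 2 * real k"
proof -
  obtain A where A: "A \<subseteq> N" "card A = k + 1" using N by (metis obtain_subset_with_card_n add_le_mono1 mult_2 le_add1)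
  then obtain x where x: "x \<in> A" by fastforce
  have fA: "finite A" using A N finite_subset by blast
  \<comment> \<open>The complement of \<open>A\<close> has only \<open>k\<close> elements. Filling
    it up with an element of \<open>A\<close> also makes the two covers intersect, so that the
    intersection has potential at least \<open>m\<close>.\<close>
  let ?B = "insert x (N - A)"
  have cB: "card ?B = k + 1" using A N x fA by (simp add: card_Diff_subset)
  obtain X where X: "finite X" "v \<notin> X" "A \<subseteq> X" "pot m R X \<le> m + real k" using cov[OF A] by blast
  have "?B \<subseteq> N" using A x by auto
  then obtain Y where Y: "finite Y" "v \<notin> Y" "?B \<subseteq> Y" "pot m R Y \<le> m + real k" using cov cB by metis
  have "x \<in> X \<inter> Y" using x X Y by auto
  then have "m \<le> pot m R (X \<inter> Y)" using X(1) by (intro good_pot_ge_one[OF R(1,2) _ _ m]) auto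
  then have "pot m R (X \<union> Y) \<le> m + 2 * real k"
    using pot_submodular[OF R(3) X(1) Y(1), of m] X(4) Y(4) by linarith
  moreover have "N \<subseteq> X \<union> Y" using X Y by blast
  ultimately show thesis using that[of "X \<union> Y"] X Y by blast
qed

text \<open>For \<open>k = 1\<close> the bound \<open>m + 2 * k\<close> of
  \<open>cover_neighbourhood\<close> is too weak, and all three pairs of neighbours are used. Two
  covers with two common vertices merge to potential at most
  \<open>2 * (m + 1) - (2 * m - 1) = 3\<close>. Otherwise the three covers meet pairwise in single
  vertices; merging two gives \<open>m + 2\<close>, and the third meets their union in a pair
  \<open>x\<close>, \<open>z\<close>. If that pair is not an edge of \<open>R\<close>, its potential
  is \<open>2 * m\<close> and the total is again 3.\<close>

lemma cover_three:
  fixes N :: "'a set"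
  assumes R: "good m R" "\<forall>e\<in>R. card e = 2" "finite R" and N: "card N = 3" and m: "1 \<le> m" "m < 2"
    and cov: "\<And>A. A \<subseteq> N \<Longrightarrow> card A = 2 \<Longrightarrow> \<exists>X. finite X \<and> v \<notin> X \<and> A \<subseteq> X \<and> pot m R X \<le> m + 1"
  obtains X where "finite X" "v \<notin> X" "N \<subseteq> X" "pot m R X \<le> 3"
proof -
  note result = that
  have two: ?thesis if xyz: "N = {x, y, z}" "x \<noteq> y" "y \<noteq> z" "x \<noteq> z" and nr: "{x, z} \<notin> R" for x y z
  proof -
    obtain X where X: "finite X" "v \<notin> X" "{x, y} \<subseteq> X" "pot m R X \<le> m + 1"
      using cov[of "{x, y}"] xyz by auto
    obtain Y where Y: "finite Y" "v \<notin> Y" "{y, z} \<subseteq> Y" "pot m R Y \<le> m + 1"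
      using cov[of "{y, z}"] xyz by auto
    obtain Z where Z: "finite Z" "v \<notin> Z" "{x, z} \<subseteq> Z" "pot m R Z \<le> m + 1"
      using cov[of "{x, z}"] xyz by auto
    have pair: "pot m R (U \<union> W) \<le> 3" if "finite U" "finite W" "pot m R U \<le> m + 1" "pot m R W \<le> m + 1" "2 \<le> card (U \<inter> W)" for U W
      using pot_submodular[OF R(3) that(1,2), of m] good_pot_ge[OF R(1,2) _ that(5)] that by simp
    show ?thesis
    proof (cases "2 \<le> card (X \<inter> Y) \<or> 2 \<le> card (X \<inter> Z) \<or> 2 \<le> card (Y \<inter> Z)")
      case True
      then show ?thesis
      proof (elim disjE)
        assume "2 \<le> card (X \<inter> Y)"
        then show ?thesis using result[of "X \<union> Y"] pair[OF X(1) Y(1) X(4) Y(4)] X Y xyz by simp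
      next
        assume "2 \<le> card (X \<inter> Z)"
        then show ?thesis using result[of "X \<union> Z"] pair[OF X(1) Z(1) X(4) Z(4)] X Z xyz by simp
      next
        assume "2 \<le> card (Y \<inter> Z)"
        then show ?thesis using result[of "Y \<union> Z"] pair[OF Y(1) Z(1) Y(4) Z(4)] Y Z xyz by simp
      qed
    next
      case False
      have single: "U \<inter> W = {w}" if "finite U" "w \<in> U" "w \<in> W" "\<not> 2 \<le> card (U \<inter> W)" for U W w
      proof -
        have "card (U \<inter> W) \<le> 1" using that by simp
        then have "\<forall>p\<in>U \<inter> W. \<forall>q\<in>U \<inter> W. p = q"
          using card_le_Suc0_iff_eq[of "U \<inter> W"] that(1) by simp
        then show ?thesis using that(2,3) by blast
      qed
      have i: "X \<inter> Z = {x}" "Y \<inter> Z = {z}" "X \<inter> Y = {y}"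
        using False X Y Z by (intro single; simp)+
      have "(X \<union> Y) \<inter> Z = {x, z}" using i by blast
      moreover have "pot m R {x, z} = 2 * m"
        using inside_two[OF R(2), of "{x, z}"] nr xyz by (simp add: pot_def)
      moreover have "m \<le> pot m R (X \<inter> Y)" using X(1) i by (intro good_pot_ge_one[OF R(1,2) _ _ m(1)]) auto
      ultimately have "pot m R (X \<union> Y \<union> Z) \<le> 3"
        using pot_submodular[OF R(3) X(1) Y(1), of m] pot_submodular[OF R(3) _ Z(1), of "X \<union> Y" m] X Y Z by simp
      then show ?thesis using result[of "X \<union> Y \<union> Z"] X Y Z xyz by simp
    qed
  qed
  obtain x y z where xyz: "N = {x, y, z}" "x \<noteq> y" "y \<noteq> z" "x \<noteq> z" using N by (auto simp: card_3_iff)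
  \<comment> \<open>A triangle in \<open>R\<close> has potential \<open>3 * m - 3\<close>, which is
    below \<open>2 * m - 1\<close> as \<open>m < 2\<close>.\<close>
  have "\<not> ({x, y} \<in> R \<and> {y, z} \<in> R \<and> {x, z} \<in> R)"
  proof
    assume "{x, y} \<in> R \<and> {y, z} \<in> R \<and> {x, z} \<in> R"
    then have "{{x, y}, {y, z}, {x, z}} \<subseteq> {e \<in> R. e \<subseteq> N}" using xyz by auto
    then have "card {{x, y}, {y, z}, {x, z}} \<le> edges_in R N"
      unfolding edges_in_def using R(3) by (intro card_mono) auto
    moreover have "card {{x, y}, {y, z}, {x, z}} = 3" using xyz by (simp add: card_insert_if doubleton_eq_iff)
    moreover have "2 * m - 1 < pot m R N" using R(1) N unfolding good_def by (metis card.infinite le_refl zero_neq_numeral)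
    ultimately show False using m N unfolding pot_def by simp
  qed
  then show thesis
    using two[of x y z] two[of y z x] two[of z x y] xyz by (auto simp: insert_commute)
qed

text \<open>For \<open>m = 2\<close> a blocked set with two neighbours can only be that pair itself,
  since a larger one would have to contain more than two of them. The inequality then says that the
  pair is an edge of this colour.\<close>

lemma blocked_two:
  assumes b: "blocked 2 R v A X" and R: "good 2 R" "\<forall>e\<in>R. card e = 2" and A: "finite A" "card A \<le> 2"
  shows "A \<in> R" "card A = 2"
proof -
  have c: "2 \<le> card (A \<inter> X)" "3 \<le> card X \<Longrightarrow> 2 < card (A \<inter> X)" using blocked_card[OF b R] by simp_all
  have X: "finite X" "2 \<le> card X" "pot 2 R X \<le> 2 - 1 + real (card (A \<inter> X))" using b unfolding blocked_def by auto
  have "card (A \<inter> X) \<le> card A" using A by (intro card_mono) auto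
  then have AX: "card (A \<inter> X) = 2" "card A = 2" and cX: "card X = 2" using c A(2) X(2) by linarith+
  have "A \<inter> X = A" using AX A(1) by (intro card_subset_eq) auto
  moreover have "A \<inter> X = X" using AX cX X(1) by (intro card_subset_eq) auto
  ultimately have "A = X" by simp
  then show "A \<in> R" using X(3) AX cX inside_two[OF R(2) cX] by (auto simp: pot_def split: if_splits)
  show "card A = 2" by (rule AX)
qed

text \<open>Let \<open>k\<close> be the integer part of \<open>m\<close>. If \<open>v\<close> has
  degree at most \<open>2 * k\<close>, its edges are halved; a half of at most \<open>k\<close>
  edges can be blocked only if \<open>m = k = 2\<close>, and trying both colourings of the halves
  shows that all pairs of neighbours are adjacent. The only other degree is
  \<open>2 * k + 1\<close>. Then every \<open>k + 1\<close> neighbours are blocked in both colours,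
  so each colour has a tight set covering the neighbourhood, and the union of the two sets with
  \<open>v\<close> is too dense, except for \<open>m = 3 / 2\<close>.\<close>

lemma extend_vertex:
  fixes E :: "'a set set"
  assumes m: "1 < m" and E: "finite E" "\<forall>e\<in>E. card e = 2" and N: "N = {u. {u, v} \<in> E}" "finite N"
    and RB: "R \<union> B = {e \<in> E. v \<notin> e}" "R \<inter> B = {}" "good m R" "good m B"
    and sparse: "\<And>X. finite X \<Longrightarrow> 0 \<le> pot m E X" and d: "real (card N) \<le> 2 * m"
    and n1: "\<not> (m = 3 / 2 \<and> card N = 3)" and n2: "\<not> (m = 2 \<and> card N = 4 \<and> (\<forall>A\<subseteq>N. card A = 2 \<longrightarrow> A \<in> E))"
  shows "\<exists>A\<subseteq>N. good m (R \<union> star v A) \<and> good m (B \<union> star v (N - A))"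
proof (rule ccontr)
  assume neg: "\<not> ?thesis"
  have sub: "R \<subseteq> {e \<in> E. v \<notin> e}" "B \<subseteq> {e \<in> E. v \<notin> e}" unfolding RB(1)[symmetric] by simp_all
  have fR: "finite R" "finite B" using sub E(1) by (auto intro: finite_subset)
  have R2: "\<forall>e\<in>R. card e = 2" and B2: "\<forall>e\<in>B. card e = 2" and Rv: "\<forall>e\<in>R. v \<notin> e" and Bv: "\<forall>e\<in>B. v \<notin> e"
    using sub E(2) by auto
  have vN: "v \<notin> N"
  proof
    assume "v \<in> N"
    then have "card {v, v} = 2" using N(1) E(2) by blast
    then show False by simp
  qed
  have block: "(\<exists>X. blocked m R v A X) \<or> (\<exists>X. blocked m B v (N - A) X)" if A: "A \<subseteq> N" for A
  proof (rule ccontr)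
    assume nb: "\<not> ?thesis"
    have "good m (R \<union> star v A)"
    proof (rule good_star[OF fR(1) RB(3) _ Rv])
      show "finite A" using A N(2) by (auto intro: finite_subset)
      show "v \<notin> A" using A vN by auto
      fix X assume X: "finite X" "v \<notin> X" "2 \<le> card X"
      have "\<not> blocked m R v A X" using nb by blast
      then show "m - 1 + real (card (A \<inter> X)) < pot m R X" using X unfolding blocked_def by (simp add: not_le)
    qed
    moreover have "good m (B \<union> star v (N - A))"
    proof (rule good_star[OF fR(2) RB(4) _ Bv])
      show "finite (N - A)" using A N(2) by (auto intro: finite_subset)
      show "v \<notin> (N - A)" using A vN by auto
      fix X assume X: "finite X" "v \<notin> X" "2 \<le> card X"
      have "\<not> blocked m B v (N - A) X" using nb by blast
      then show "m - 1 + real (card ((N - A) \<inter> X)) < pot m B X" using X unfolding blocked_def by (simp add: not_le)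
    qed
    ultimately show False using neg A by blast
  qed
  define k where "k = nat \<lfloor>m\<rfloor>"
  have k: "real k \<le> m" "m < real k + 1" "1 \<le> k" using m unfolding k_def by linarith+
  have fsub: "finite A" if "A \<subseteq> N" for A using that N(2) finite_subset by blast
  have cd: "card (N - A) = card N - card A" if "A \<subseteq> N" for A
    using that fsub by (simp add: card_Diff_subset)
  have Ile: "card (A \<inter> X) \<le> card A" if "A \<subseteq> N" for A X using fsub[OF that] by (intro card_mono) auto
  show False
  \<comment> \<open>By \<open>d\<close> and \<open>m < k + 1\<close>, a degree above
    \<open>2 * k\<close> is exactly \<open>2 * k + 1\<close>, which forces \<open>m\<close> to be at
    least \<open>k + 1 / 2\<close>.\<close>
  proof (cases "card N \<le> 2 * k")
    case le: True
    show False
    proof (cases "m = 2")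
      case False
      obtain A where A: "A \<subseteq> N" "card A \<le> k" "card (N - A) \<le> k"
      proof (cases "k \<le> card N")
        case True
        then obtain A where "A \<subseteq> N" "card A = k" by (metis obtain_subset_with_card_n)
        then show thesis using that cd le by simp
      next
        case False
        then show thesis using that[of N] by simp
      qed
      have no: False if b: "blocked m C v A' X" and C: "good m C" "\<forall>e\<in>C. card e = 2" and A': "A' \<subseteq> N" "card A' \<le> k" for C A' X
      proof -
        have c: "real (card (A' \<inter> X)) \<le> real k" using Ile[OF A'(1), of X] A'(2) by linarith
        have mk: "m = real k" using blocked_card(1)[OF b C] c k by linarith
        have "\<not> 3 \<le> card X" using blocked_card(2)[OF b C] c mk by linarith
        moreover have "2 \<le> card X" "finite X" using b unfolding blocked_def by auto
        ultimately have "card (A' \<inter> X) \<le> 2" by (metis card_mono inf_le2 le_trans not_less_eq_eq numeral_2_eq_2 numeral_3_eq_3)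
        then have "real k \<le> 2" using blocked_card(1)[OF b C] mk by linarith
        then have "k \<le> 2" by linarith
        moreover have "k \<noteq> 1" using mk m by auto
        ultimately show False using False mk k(3) by auto
      qed
      show False using block[OF A(1)] no[OF _ RB(3) R2 A(1,2)] no[OF _ RB(4) B2 _ A(3)] by blast
    next
      case m2: True
      have "k = 2" using k m2 by linarith
      have bl: "(A \<in> R \<and> card A = 2) \<or> (N - A \<in> B \<and> card (N - A) = 2)" if A: "A \<subseteq> N" "card A \<le> 2" "card (N - A) \<le> 2" for A
        using block[OF A(1)] blocked_two[OF _ _ R2 fsub[OF A(1)] A(2), of v] blocked_two[OF _ _ B2 _ A(3), of v] RB(3,4) N(2) m2 by auto
      have c4: "card N \<le> 4" using le \<open>k = 2\<close> by simp
      consider "card N \<le> 1" | "card N = 2" | "card N = 3" | "card N = 4" using c4 by linarith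
      then show False
      proof cases
        case 1
        then show False using bl[of N] by simp
      next
        case 2
        then obtain A where "A \<subseteq> N" "card A = 1" by (metis obtain_subset_with_card_n one_le_numeral)
        then show False using bl[of A] cd 2 by simp
      next
        case 3
        then obtain A where A: "A \<subseteq> N" "card A = 2" by (metis obtain_subset_with_card_n numeral_le_iff semiring_norm(69) semiring_norm(72) order_refl eval_nat_numeral(3) le_SucI)
        have "N - (N - A) = A" using A by auto
        then show False using bl[of A] bl[of "N - A"] cd[OF A(1)] A 3 RB(2) by auto
      next
        case 4
        have "A \<in> E" if A: "A \<subseteq> N" "card A = 2" for A
        proof -
          have "N - (N - A) = A" using A by auto
          then show ?thesis using bl[of A] bl[of "N - A"] cd[OF A(1)] A 4 RB(1,2) by auto
        qed
        then show False using n2 m2 4 by blast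
      qed
    qed
  next
    case False
    then have dk: "card N = 2 * k + 1" using d k by linarith
    then have mk: "real k + 1 / 2 \<le> m" using d by simp
    have nob: False if b: "blocked m C v A' X" and C: "good m C" "\<forall>e\<in>C. card e = 2" and A': "A' \<subseteq> N" "card A' \<le> k" for C A' X
      using Ile[OF A'(1), of X] A'(2) blocked_card(1)[OF b C] mk by linarith
    have big: "A \<subseteq> X \<and> pot m C X \<le> m + real k" if b: "blocked m C v A X" and C: "good m C" "\<forall>e\<in>C. card e = 2"
      and A: "A \<subseteq> N" "card A = k + 1" for C A X
    proof -
      have "k + 1 \<le> card (A \<inter> X)" using blocked_card(1)[OF b C] mk by linarith
      then have eq: "card (A \<inter> X) = card A" using Ile[OF A(1), of X] A(2) by linarith
      then have "A \<inter> X = A" using fsub[OF A(1)] by (intro card_subset_eq) auto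
      then show ?thesis using b eq A(2) unfolding blocked_def by auto
    qed
    have red: "\<exists>X. finite X \<and> v \<notin> X \<and> A \<subseteq> X \<and> pot m R X \<le> m + real k" if A: "A \<subseteq> N" "card A = k + 1" for A
    proof -
      have "card (N - A) \<le> k" using cd[OF A(1)] A dk by simp
      then obtain X where b: "blocked m R v A X" using block[OF A(1)] nob[OF _ RB(4) B2] by blast
      then show ?thesis using big[OF b RB(3) R2 A] unfolding blocked_def by blast
    qed
    have blue: "\<exists>X. finite X \<and> v \<notin> X \<and> A \<subseteq> X \<and> pot m B X \<le> m + real k" if A: "A \<subseteq> N" "card A = k + 1" for A
    proof -
      have s: "N - A \<subseteq> N" "card (N - A) \<le> k" using cd[OF A(1)] A dk by auto
      have "N - (N - A) = A" using A by auto
      then obtain X where b: "blocked m B v A X" using block[OF s(1)] nob[OF _ RB(3) R2 s] by auto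
      then show ?thesis using big[OF b RB(4) B2 A] unfolding blocked_def by blast
    qed
    \<comment> \<open>Sparsity is applied to \<open>X\<close>, \<open>Y\<close> and \<open>v\<close>
      together. Both covers contain the \<open>2 * k + 1\<close> neighbours, whose vertices are
      therefore counted only once, and \<open>v\<close> adds one vertex and \<open>2 * k + 1\<close>
      edges.\<close>
    have clash: "0 \<le> pot m R X + pot m B Y - m * real (2 * k + 1) + m - real (2 * k + 1)"
      if X: "finite X" "v \<notin> X" "N \<subseteq> X" and Y: "finite Y" "v \<notin> Y" "N \<subseteq> Y" for X Y
    proof -
      let ?E = "{e \<in> E. v \<notin> e}"
      have eqE: "?E \<union> star v N = E"
      proof (rule sym, rule equalityI)
        show "E \<subseteq> ?E \<union> star v N"
        proof
          fix e assume e: "e \<in> E"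
          show "e \<in> ?E \<union> star v N"
          proof (cases "v \<in> e")
            case True
            obtain p q where "e = {p, q}" using E(2) e by (metis card_2_iff)
            with True have "e = {p, v} \<or> e = {q, v}" by auto
            then obtain u where "e = {u, v}" by blast
            then show ?thesis using e N(1) by (auto simp: star_def)
          qed (use e in auto)
        qed
      qed (auto simp: star_def N(1))
      have "pot m (?E \<union> star v N) (insert v (X \<union> Y)) = pot m ?E (X \<union> Y) + m - real (card (N \<inter> (X \<union> Y)))"
        using E(1) N(2) vN X Y by (intro pot_star) auto
      then have "pot m E (insert v (X \<union> Y)) = pot m ?E (X \<union> Y) + m - real (card (N \<inter> (X \<union> Y)))"
        unfolding eqE .
      moreover have "N \<inter> (X \<union> Y) = N" using X by auto
      moreover have "pot m ?E (X \<union> Y) \<le> pot m R X + pot m B Y - m * real (card (X \<inter> Y))"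
        using E(1) RB(1,2) X Y by (intro pot_two_colours) auto
      moreover have "m * real (2 * k + 1) \<le> m * real (card (X \<inter> Y))"
        using card_mono[of "X \<inter> Y" N] X Y dk m by (intro mult_left_mono) auto
      moreover have "0 \<le> pot m E (insert v (X \<union> Y))" using X Y by (intro sparse) auto
      ultimately show ?thesis using dk by simp
    qed
    show False
    proof (cases "k = 1")
      case True
      obtain X where X: "finite X" "v \<notin> X" "N \<subseteq> X" "pot m R X \<le> 3"
        using cover_three[OF RB(3) R2 fR(1), of N v] red dk True k m by (auto simp: numeral_3_eq_3)
      obtain Y where Y: "finite Y" "v \<notin> Y" "N \<subseteq> Y" "pot m B Y \<le> 3"
        using cover_three[OF RB(4) B2 fR(2), of N v] blue dk True k m by (auto simp: numeral_3_eq_3)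
      \<comment> \<open>The clash reads \<open>0 <= 3 - 2 * m\<close>, while \<open>m\<close> is at
        least \<open>3 / 2\<close>.\<close>
      have "m = 3 / 2" using clash[OF X(1-3) Y(1-3)] X(4) Y(4) mk True by simp
      then show False using n1 dk True by simp
    next
      case False
      then have k2: "2 \<le> k" using k(3) by simp
      obtain X where X: "finite X" "v \<notin> X" "N \<subseteq> X" "pot m R X \<le> m + 2 * real k"
        using cover_neighbourhood[OF RB(3) R2 fR(1) k2 N(2) dk, of v] red m by auto
      obtain Y where Y: "finite Y" "v \<notin> Y" "N \<subseteq> Y" "pot m B Y \<le> m + 2 * real k"
        using cover_neighbourhood[OF RB(4) B2 fR(2) k2 N(2) dk, of v] blue m by auto
      \<comment> \<open>The clash reads \<open>0 <= 2 * k - 1 - 2 * m * (k - 1)\<close>. With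
        \<open>m\<close> at least \<open>k + 1 / 2\<close> the right side is at most
        \<open>3 * k - 2 * k ^ 2\<close>, which is negative for \<open>k\<close> at least 2.\<close>
      have "m * real (2 * k + 1) = 2 * (m * (real k - 1)) + 3 * m" by (simp add: algebra_simps)
      moreover have "(real k + 1 / 2) * (real k - 1) \<le> m * (real k - 1)" using mk k2 by (intro mult_right_mono) auto
      moreover have "(real k + 1 / 2) * (real k - 1) = real k * real k - real k / 2 - 1 / 2" by (simp add: field_simps)
      moreover have "2 * real k \<le> real k * real k" using k2 by (intro mult_right_mono) auto
      moreover have "real (2 * k + 1) = 2 * real k + 1" "2 \<le> real k" using k2 by simp_all
      ultimately show False using clash[OF X(1-3) Y(1-3)] X(4) Y(4) by linarith
    qed
  qed
qed

section \<open>Colouring by induction on the vertex set\<close>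

lemma sum_degrees:
  assumes E: "finite E" "\<forall>e\<in>E. card e = 2" "\<Union>E \<subseteq> V" "finite V"
  shows "(\<Sum>w\<in>V. card {u. {u, w} \<in> E}) = 2 * card E"
proof -
  have "card {u. {u, w} \<in> E} = card {e \<in> E. w \<in> e}" for w
  proof (rule bij_betw_same_card[of "\<lambda>u. {u, w}"])
    have "{e \<in> E. w \<in> e} = (\<lambda>u. {u, w}) ` {u. {u, w} \<in> E}"
    proof
      show "{e \<in> E. w \<in> e} \<subseteq> (\<lambda>u. {u, w}) ` {u. {u, w} \<in> E}"
      proof
        fix e assume e: "e \<in> {e \<in> E. w \<in> e}"
        obtain p q where "e = {p, q}" using E(2) e by (metis (no_types, lifting) card_2_iff mem_Collect_eq)
        with e have "e = {p, w} \<or> e = {q, w}" by auto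
        then show "e \<in> (\<lambda>u. {u, w}) ` {u. {u, w} \<in> E}" using e by auto
      qed
    qed auto
    then show "bij_betw (\<lambda>u. {u, w}) {u. {u, w} \<in> E} {e \<in> E. w \<in> e}"
      by (auto simp: bij_betw_def inj_on_def doubleton_eq_iff)
  qed
  then have "(\<Sum>w\<in>V. card {u. {u, w} \<in> E}) = (\<Sum>w\<in>V. card {e \<in> E. w \<in> e})" by simp
  also have "\<dots> = (\<Sum>e\<in>E. 2)"
  proof (rule sum_multicount_gen[OF E(4,1)], intro ballI)
    fix e assume e: "e \<in> E"
    then have "{w \<in> V. w \<in> e} = e" using E(3) by auto
    then show "card {w \<in> V. w \<in> e} = 2" using E(2) e by simp
  qed
  finally show ?thesis by simp
qed

lemma pot_mono: "finite E \<Longrightarrow> E' \<subseteq> E \<Longrightarrow> pot m E X \<le> pot m E' X"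
  unfolding pot_def edges_in_def by (auto intro!: card_mono)

text \<open>Two adjacent cubic vertices \<open>u\<close> and \<open>v\<close> are reinserted
  together. One colour receives the path \<open>a\<close>, \<open>u\<close>, \<open>v\<close>,
  \<open>c\<close>, the other the two pendant edges to \<open>b\<close> and \<open>d\<close>. The
  path is dangerous only for sets containing \<open>a\<close>, \<open>u\<close>, \<open>v\<close>
  and \<open>c\<close>, and there the absence of the edge from \<open>a\<close> to \<open>c\<close>
  provides the missing potential.\<close>

lemma colour_cubic:
  fixes R B :: "'a set set"
  assumes R: "finite R" "good (3 / 2) R" "\<forall>e\<in>R. card e = 2" and B: "finite B" "good (3 / 2) B" "\<forall>e\<in>B. card e = 2"
    and Ru: "\<forall>e\<in>R. u \<notin> e" "\<forall>e\<in>R. v \<notin> e" and Bu: "\<forall>e\<in>B. u \<notin> e" "\<forall>e\<in>B. v \<notin> e"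
    and uv: "u \<noteq> v" and ac: "a \<noteq> c" "{a, c} \<notin> R" and new: "{u, v} \<inter> {a, b, c, d} = {}"
  shows "good (3 / 2) ((R \<union> star u {a}) \<union> star v {u, c})" "good (3 / 2) ((B \<union> star u {b}) \<union> star v {d})"
proof -
  have one: "good (3 / 2) (C \<union> star w {x})" if C: "finite C" "good (3 / 2) C" "\<forall>e\<in>C. card e = 2" "\<forall>e\<in>C. w \<notin> e" "w \<noteq> x" for C :: "'a set set" and w x
  proof (rule good_star[OF C(1,2) _ C(4)])
    fix X assume X: "finite X" "w \<notin> X" "2 \<le> card X"
    have "card ({x} \<inter> X) \<le> 1" by (metis card_mono finite.emptyI finite.insertI inf_le1 is_singletonI is_singleton_altdef)
    then show "3 / 2 - 1 + real (card ({x} \<inter> X)) < pot (3 / 2) C X" using good_pot_ge[OF C(2,3) X(1,3)] by simp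
  qed (use C in auto)
  have s2: "\<forall>e\<in>C \<union> star w {x}. card e = 2" if "\<forall>e\<in>C. card e = 2" "w \<noteq> x" for C :: "'a set set" and w x
    using that by (auto simp: star_def)
  show "good (3 / 2) ((B \<union> star u {b}) \<union> star v {d})"
    using B Bu uv new by (intro one s2) (auto simp: star_def)
  let ?R = "R \<union> star u {a}"
  have R1: "finite ?R" "good (3 / 2) ?R" "\<forall>e\<in>?R. card e = 2" "\<forall>e\<in>?R. v \<notin> e"
  proof -
    show "good (3 / 2) ?R" by (rule one[OF R Ru(1)]) (use new in auto)
    show "\<forall>e\<in>?R. card e = 2" by (rule s2[OF R(3)]) (use new in auto)
  qed (use R(1) Ru(2) uv new in \<open>auto simp: star_def\<close>)
  show "good (3 / 2) (?R \<union> star v {u, c})"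
  proof (rule good_star[OF R1(1,2) _ R1(4)])
    fix X assume X: "finite X" "v \<notin> X" "2 \<le> card X"
    have ge: "2 \<le> pot (3 / 2) ?R X" using good_pot_ge[OF R1(2,3) X(1,3)] by simp
    show "3 / 2 - 1 + real (card ({u, c} \<inter> X)) < pot (3 / 2) ?R X"
    proof (cases "u \<in> X \<and> c \<in> X")
      case False
      then have "{u, c} \<inter> X \<subseteq> {u} \<or> {u, c} \<inter> X \<subseteq> {c}" by auto
      then have "card ({u, c} \<inter> X) \<le> 1" by (metis card_mono finite.emptyI finite.insertI is_singletonI is_singleton_altdef)
      then show ?thesis using ge by simp
    next
      case True
      then have eq: "{u, c} \<inter> X = {u, c}" by auto
      have "u \<noteq> c" using new by auto
      then have c2: "card ({u, c} \<inter> X) = 2" unfolding eq by simp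
      let ?Y = "X - {u}"
      have Y: "finite ?Y" "u \<notin> ?Y" "insert u ?Y = X" "c \<in> ?Y" using X True new by auto
      have pX: "pot (3 / 2) ?R X = pot (3 / 2) R ?Y + 3 / 2 - real (card ({a} \<inter> ?Y))"
        using pot_star[of R "{a}" u ?Y "3 / 2"] R(1) Ru(1) new Y by auto
      show ?thesis
      proof (cases "a \<in> ?Y")
        case False
        then have "{a} \<inter> ?Y = {}" by auto
        moreover have "3 / 2 \<le> pot (3 / 2) R ?Y" using Y by (intro good_pot_ge_one[OF R(2,3)]) auto
        ultimately show ?thesis using pX c2 by simp
      next
        case True
        have cY: "2 \<le> card ?Y"
          using card_mono[OF Y(1), of "{a, c}"] True Y(4) ac(1) by simp
        have "2 < pot (3 / 2) R ?Y"
        proof (cases "card ?Y = 2")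
          case t: True
          have "{a, c} = ?Y" using True Y(1,4) ac(1) t by (intro card_subset_eq) auto
          then have "?Y \<notin> R" using ac(2) by simp
          then show ?thesis using inside_two[OF R(3) t] t by (simp add: pot_def)
        next
          case False
          then have "3 \<le> card ?Y" using cY by linarith
          then show ?thesis using R(2) Y(1) unfolding good_def by fastforce
        qed
        moreover have "card ({a} \<inter> ?Y) = 1" using True by simp
        ultimately show ?thesis using pX c2 by simp
      qed
    qed
  qed (use new uv in auto)
qed

lemma disjoint_extensions:
  assumes "R \<inter> B = {}" "p \<notin> R \<union> B" "q \<notin> R \<union> B" "r \<notin> R \<union> B" "s \<notin> R \<union> B" "t \<notin> R \<union> B"
    "p \<noteq> q" "p \<noteq> t" "q \<noteq> s" "q \<noteq> r" "s \<noteq> t" "t \<noteq> r"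
  shows "(R \<union> {p} \<union> {r, s}) \<inter> (B \<union> {q} \<union> {t}) = {}" "(R \<union> {q} \<union> {t}) \<inter> (B \<union> {p} \<union> {r, s}) = {}"
  using assms by auto

text \<open>By sparsity some vertex has degree at most \<open>2 * m\<close>. Deleting it and
  extending the colouring works outside the two exceptions of \<open>extend_vertex\<close>. Both are
  extremal, so the graph is regular: in the cubic case an adjacent pair is deleted, in the other
  case a whole K5.\<close>

lemma two_colouring_on:
  fixes E :: "'a set set"
  assumes m: "1 < m" and E: "finite E" "\<forall>e\<in>E. card e = 2" and sparse: "\<And>X. finite X \<Longrightarrow> 0 \<le> pot m E X"
    and "finite V"
  shows "\<exists>R B. R \<union> B = {e \<in> E. e \<subseteq> V} \<and> R \<inter> B = {} \<and> good m R \<and> good m B"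
  using \<open>finite V\<close>
proof (induction V rule: finite_psubset_induct)
  case (psubset V)
  define EV where "EV = {e \<in> E. e \<subseteq> V}"
  define N where "N = (\<lambda>w. {u. {u, w} \<in> EV})"
  have EV: "finite EV" "\<forall>e\<in>EV. card e = 2" "\<Union>EV \<subseteq> V" using E by (auto simp: EV_def)
  have sp: "0 \<le> pot m EV X" if "finite X" for X
    using sparse[OF that] pot_mono[OF E(1), of EV m X] by (auto simp: EV_def)
  have NV: "N w \<subseteq> V" for w using EV(3) by (auto simp: N_def)
  have fN: "finite (N w)" for w using NV psubset.hyps finite_subset by blast
  have Nirr: "w \<notin> N w" for w
  proof
    assume "w \<in> N w"
    then have "card {w, w} = 2" using EV(2) by (auto simp: N_def)
    then show False by simp
  qed
  have Nsym: "u \<in> N w \<longleftrightarrow> w \<in> N u" for u w by (simp add: N_def insert_commute)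
  show ?case
  proof (cases "V = {}")
    case True
    have "{e \<in> E. e \<subseteq> V} = {}" using E(2) True by fastforce
    moreover have "good m ({} :: 'a set set)" unfolding good_def
    proof (intro allI impI)
      fix X :: "'a set" assume "3 \<le> card X"
      then have "m * 3 \<le> m * real (card X)" using m by (intro mult_left_mono) auto
      moreover have "pot m {} X = m * real (card X)" by (simp add: pot_def edges_in_def)
      ultimately show "2 * m - 1 < pot m {} X" using m by linarith
    qed
    ultimately show ?thesis by (intro exI[of _ "{}"]) simp
  next
    case False
    have sumdeg: "(\<Sum>w\<in>V. card (N w)) = 2 * card EV"
      unfolding N_def by (rule sum_degrees[OF EV psubset.hyps])
    have "{e \<in> EV. e \<subseteq> V} = EV" using EV(3) by auto
    then have eV: "real (card EV) \<le> m * real (card V)"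
      using sp[OF psubset.hyps] by (simp add: pot_def edges_in_def)
    then have sumle: "(\<Sum>w\<in>V. real (card (N w))) \<le> (\<Sum>w\<in>V. 2 * m)"
      using sumdeg by (simp flip: of_nat_sum) (simp add: mult_ac)
    obtain v where v: "v \<in> V" "\<And>w. w \<in> V \<Longrightarrow> card (N v) \<le> card (N w)"
      using False psubset.hyps arg_min_if_finite(1)[of V "\<lambda>w. card (N w)"] arg_min_least[of V _ "\<lambda>w. card (N w)"] by blast
    have dv: "real (card (N v)) \<le> 2 * m"
    proof (rule ccontr)
      assume "\<not> ?thesis"
      then have "\<And>w. w \<in> V \<Longrightarrow> 2 * m < real (card (N w))" using v(2) by (meson not_le of_nat_le_iff order_less_le_trans)
      then have "(\<Sum>w\<in>V. 2 * m) < (\<Sum>w\<in>V. real (card (N w)))" using False psubset.hyps by (intro sum_strict_mono) auto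
      then show False using sumle by linarith
    qed
    \<comment> \<open>The average degree is at most \<open>2 * m\<close>; if the minimum attains
      this value, all degrees do.\<close>
    have alleq: "card (N w) = card (N v)" if eq: "2 * m = real (card (N v))" and w: "w \<in> V" for w
    proof (rule ccontr)
      assume "card (N w) \<noteq> card (N v)"
      then have "card (N v) < card (N w)" using v(2)[OF w] by linarith
      then have "(\<Sum>w\<in>V. 2 * m) < (\<Sum>w\<in>V. real (card (N w)))"
        using eq w v(2) psubset.hyps by (intro sum_strict_mono_ex1) auto
      then show False using sumle by linarith
    qed
    consider "m = 3 / 2 \<and> card (N v) = 3" | "m = 2 \<and> card (N v) = 4 \<and> (\<forall>A\<subseteq>N v. card A = 2 \<longrightarrow> A \<in> EV)"
      | "\<not> (m = 3 / 2 \<and> card (N v) = 3)" "\<not> (m = 2 \<and> card (N v) = 4 \<and> (\<forall>A\<subseteq>N v. card A = 2 \<longrightarrow> A \<in> EV))" by blast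
    then show ?thesis
    proof cases
      case 3
      obtain R B where RB: "R \<union> B = {e \<in> E. e \<subseteq> V - {v}}" "R \<inter> B = {}" "good m R" "good m B"
        using psubset.IH[of "V - {v}"] v(1) by blast
      have eq: "{e \<in> E. e \<subseteq> V - {v}} = {e \<in> EV. v \<notin> e}" by (auto simp: EV_def)
      obtain A where A: "A \<subseteq> N v" "good m (R \<union> star v A)" "good m (B \<union> star v (N v - A))"
        using extend_vertex[OF m EV(1,2) _ fN RB(1)[unfolded eq] RB(2-4) sp dv 3(1,2)] by (auto simp: N_def)
      have st: "star v (N v) = {e \<in> EV. v \<in> e}"
      proof
        show "{e \<in> EV. v \<in> e} \<subseteq> star v (N v)"
        proof
          fix e assume e: "e \<in> {e \<in> EV. v \<in> e}"
          then obtain p q where "e = {p, q}" using EV(2) by (metis (no_types, lifting) card_2_iff mem_Collect_eq)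
          with e have "e = {p, v} \<or> e = {q, v}" by auto
          then show "e \<in> star v (N v)" using e by (auto simp: star_def N_def)
        qed
      qed (auto simp: star_def N_def)
      have sA: "star v A \<union> star v (N v - A) = star v (N v)" using A(1) by (auto simp: star_def)
      have "(R \<union> star v A) \<union> (B \<union> star v (N v - A)) = (R \<union> B) \<union> (star v A \<union> star v (N v - A))" by blast
      also have "\<dots> = {e \<in> EV. v \<notin> e} \<union> {e \<in> EV. v \<in> e}" unfolding RB(1) eq sA st ..
      also have "\<dots> = EV" by blast
      finally have un: "(R \<union> star v A) \<union> (B \<union> star v (N v - A)) = EV" .
      have d1: "star v A \<inter> star v (N v - A) = {}" by (auto simp: star_def doubleton_eq_iff)
      have "R \<union> B \<subseteq> {e. v \<notin> e}" unfolding RB(1) by blast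
      moreover have "star v C \<subseteq> {e. v \<in> e}" for C by (auto simp: star_def)
      ultimately have "(R \<union> star v A) \<inter> (B \<union> star v (N v - A)) = {}" using RB(2) d1 by blast
      then have "\<exists>R B. R \<union> B = EV \<and> R \<inter> B = {} \<and> good m R \<and> good m B" using un A(2,3) by blast
      then show ?thesis unfolding EV_def .
    next
      case 1
      then have m32: "m = 3 / 2" and c3: "card (N v) = 3" by auto
      then obtain u where u: "u \<in> N v" by fastforce
      then have uV: "u \<in> V" "u \<noteq> v" using NV Nirr by auto
      have c3u: "card (N u) = 3" using alleq[OF _ uV(1)] m32 c3 by simp
      obtain R B where RB: "R \<union> B = {e \<in> E. e \<subseteq> V - {u, v}}" "R \<inter> B = {}" "good m R" "good m B"
        using psubset.IH[of "V - {u, v}"] v(1) by blast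
      have vu: "v \<in> N u" using u Nsym by blast
      have "card (N u - {v}) = 2" "card (N v - {u}) = 2" using c3 c3u u vu by simp_all
      then obtain a b c d where Nu: "N u - {v} = {a, b}" "a \<noteq> b" and Nv: "N v - {u} = {c, d}" "c \<noteq> d"
        by (meson card_2_iff)
      have Nu': "N u = {v, a, b}" using Nu vu by blast
      have Nv': "N v = {u, c, d}" using Nv u by blast
      have new: "{u, v} \<inter> {a, b, c, d} = {}" using Nu Nv Nirr[of u] Nirr[of v] by blast
      have RBs: "R \<subseteq> {e \<in> EV. u \<notin> e \<and> v \<notin> e}" "B \<subseteq> {e \<in> EV. u \<notin> e \<and> v \<notin> e}"
        using RB(1) unfolding EV_def by blast+
      have R: "finite R" "good (3 / 2) R" "\<forall>e\<in>R. card e = 2" "\<forall>e\<in>R. u \<notin> e" "\<forall>e\<in>R. v \<notin> e"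
        using RBs(1) EV RB(3) m32 by (auto intro: finite_subset)
      have B: "finite B" "good (3 / 2) B" "\<forall>e\<in>B. card e = 2" "\<forall>e\<in>B. u \<notin> e" "\<forall>e\<in>B. v \<notin> e"
        using RBs(2) EV RB(4) m32 by (auto intro: finite_subset)
      have star_eq: "star u {x} = {{x, u}}" "star v {u, y} = {{u, v}, {y, v}}" "star v {y} = {{y, v}}" for x y
        by (auto simp: star_def)
      have all: "EV = (R \<union> B) \<union> {{a, u}, {b, u}, {u, v}, {c, v}, {d, v}}"
      proof
        show "EV \<subseteq> (R \<union> B) \<union> {{a, u}, {b, u}, {u, v}, {c, v}, {d, v}}"
        proof
          fix e assume e: "e \<in> EV"
          then obtain p q where pq: "e = {p, q}" using EV(2) by (metis card_2_iff)
          show "e \<in> (R \<union> B) \<union> {{a, u}, {b, u}, {u, v}, {c, v}, {d, v}}"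
          proof (cases "u \<in> e \<or> v \<in> e")
            case True
            then consider "e = {p, u}" | "e = {q, u}" | "e = {p, v}" | "e = {q, v}" using pq by auto
            then consider w where "e = {w, u}" | w where "e = {w, v}" by blast
            then show ?thesis
            proof cases
              case (1 w)
              then have "w \<in> N u" using e by (simp add: N_def)
              then have "w \<in> {v, a, b}" unfolding Nu' .
              then consider "w = v" | "w = a" | "w = b" by blast
              then show ?thesis using 1 by cases (simp_all add: doubleton_eq_iff)
            next
              case (2 w)
              then have "w \<in> N v" using e by (simp add: N_def)
              then have "w \<in> {u, c, d}" unfolding Nv' .
              then consider "w = u" | "w = c" | "w = d" by blast
              then show ?thesis using 2 by cases (simp_all add: doubleton_eq_iff)
            qed
          next
            case False
            then have "e \<in> R \<union> B" using e RB(1) unfolding EV_def by blast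
            then show ?thesis by blast
          qed
        qed
        have "a \<in> N u" "b \<in> N u" "v \<in> N u" "c \<in> N v" "d \<in> N v" unfolding Nu' Nv' by simp_all
        then have "{a, u} \<in> EV" "{b, u} \<in> EV" "{v, u} \<in> EV" "{c, v} \<in> EV" "{d, v} \<in> EV" by (simp_all add: N_def)
        moreover have "R \<union> B \<subseteq> EV" using RBs by blast
        ultimately show "(R \<union> B) \<union> {{a, u}, {b, u}, {u, v}, {c, v}, {d, v}} \<subseteq> EV" by (simp add: insert_commute)
      qed
      \<comment> \<open>The pair \<open>x\<close>, \<open>c\<close> is an edge of at most one
        colour; the path goes to a colour that does not contain it. Since \<open>a\<close> and
        \<open>b\<close> are distinct, one of them differs from \<open>c\<close>.\<close>
      have final: ?thesis if xy: "{x, x'} = {a, b}" "x \<noteq> x'" "x \<noteq> c" for x x'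
      proof -
        have new': "{u, v} \<inter> {x, x', c, d} = {}" using xy new by auto
        have all': "EV = (R \<union> B) \<union> {{x, u}, {x', u}, {u, v}, {c, v}, {d, v}}"
        proof -
          have eq: "{{x, u}, {x', u}} = {{a, u}, {b, u}}" using xy(1,2) Nu(2) by (auto simp: doubleton_eq_iff)
          have "{e1, e2, e3, e4, e5} = {e1, e2} \<union> {e3, e4, e5}" for e1 e2 e3 e4 e5 :: "'a set" by auto
          then show ?thesis using all eq by (simp only:)
        qed
        have dis: "{x, u} \<noteq> {x', u}" "{x, u} \<noteq> {d, v}" "{x', u} \<noteq> {c, v}" "{x', u} \<noteq> {u, v}" "{c, v} \<noteq> {d, v}" "{d, v} \<noteq> {u, v}"
          using xy(2) Nv(2) new' uV(2) by (auto simp: doubleton_eq_iff)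
        have no: "e \<notin> R \<union> B" if "u \<in> e \<or> v \<in> e" for e using that R(4,5) B(4,5) by blast
        have old: "{x, u} \<notin> R \<union> B" "{x', u} \<notin> R \<union> B" "{u, v} \<notin> R \<union> B" "{c, v} \<notin> R \<union> B" "{d, v} \<notin> R \<union> B"
          by (rule no, simp)+
        show ?thesis
        proof (cases "{x, c} \<in> R")
          case False
          let ?R = "(R \<union> star u {x}) \<union> star v {u, c}" and ?B = "(B \<union> star u {x'}) \<union> star v {d}"
          have "?R \<union> ?B = EV" unfolding all' star_eq by auto
          moreover have "?R \<inter> ?B = {}" unfolding star_eq by (rule disjoint_extensions[OF RB(2) old dis])
          moreover have "good m ?R" "good m ?B"
            unfolding m32 by (rule colour_cubic[OF R(1-3) B(1-3) R(4,5) B(4,5) uV(2) xy(3) False new'])+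
          ultimately have "\<exists>R B. R \<union> B = EV \<and> R \<inter> B = {} \<and> good m R \<and> good m B" by blast
          then show ?thesis unfolding EV_def .
        next
          case True
          then have nB: "{x, c} \<notin> B" using RB(2) by auto
          let ?B = "(B \<union> star u {x}) \<union> star v {u, c}" and ?R = "(R \<union> star u {x'}) \<union> star v {d}"
          have "?R \<union> ?B = EV" unfolding all' star_eq by auto
          moreover have "?R \<inter> ?B = {}" unfolding star_eq by (rule disjoint_extensions[OF RB(2) old dis])
          moreover have "good m ?B" "good m ?R"
            unfolding m32 by (rule colour_cubic[OF B(1-3) R(1-3) B(4,5) R(4,5) uV(2) xy(3) nB new'])+
          ultimately have "\<exists>R B. R \<union> B = EV \<and> R \<inter> B = {} \<and> good m R \<and> good m B" by blast
          then show ?thesis unfolding EV_def .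
        qed
      qed
      show ?thesis
      proof (cases "a = c")
        case True
        then show ?thesis using final[of b a] Nu(2) by auto
      next
        case False
        then show ?thesis using final[of a b] Nu(2) by auto
      qed
    next
      case 2
      then have m2: "m = 2" and c4: "card (N v) = 4" and cl: "\<And>A. A \<subseteq> N v \<Longrightarrow> card A = 2 \<Longrightarrow> A \<in> EV" by auto
      \<comment> \<open>The closed neighbourhood is a K5, and 4-regularity leaves no edge from it to
        the rest. It can be removed and coloured separately.\<close>
      define K where "K = insert v (N v)"
      have KV: "K \<subseteq> V" using NV v(1) by (auto simp: K_def)
      have fK: "finite K" using fN by (simp add: K_def)
      have cK: "card K = 5" using c4 fN Nirr by (simp add: K_def)
      have complete: "{p, q} \<in> EV" if pq: "p \<in> K" "q \<in> K" "p \<noteq> q" for p q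
      proof -
        have "p \<noteq> v \<or> q \<noteq> v" using pq(3) by blast
        then consider "p = v" "q \<in> N v" | "q = v" "p \<in> N v" | "p \<in> N v" "q \<in> N v" using pq(1,2) by (auto simp: K_def)
        then show ?thesis
        proof cases
          case 3
          then show ?thesis using cl[of "{p, q}"] pq(3) by simp
        qed (auto simp: N_def insert_commute)
      qed
      have NK: "N p \<subseteq> K" if p: "p \<in> K" for p
      proof -
        have "K - {p} \<subseteq> N p" using complete p by (auto simp: N_def)
        moreover have "card (N p) = 4" using alleq[of p] m2 c4 p KV by auto
        moreover have "card (K - {p}) = 4" using cK p fK by simp
        ultimately have "K - {p} = N p" using fN by (intro card_subset_eq) auto
        then show ?thesis by auto
      qed
      have comp: "e \<subseteq> K" if e: "e \<in> EV" "e \<inter> K \<noteq> {}" for e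
      proof -
        obtain p q where pq: "e = {p, q}" using EV(2) e(1) by (metis card_2_iff)
        then have "q \<in> N p" "p \<in> N q" using e(1) by (auto simp: N_def insert_commute)
        then show ?thesis using pq e(2) NK by auto
      qed
      obtain xs where xs: "set xs = K" "distinct xs" using finite_distinct_list[OF fK] by blast
      then have "length xs = 5" using cK distinct_card by metis
      then obtain a b c d f where "xs = [a, b, c, d, f]"
        by (auto simp: length_Suc_conv numeral_eq_Suc)
      then have Keq: "K = {a, b, c, d, f}" and dist: "distinct [a, b, c, d, f]" using xs by auto
      \<comment> \<open>A pentagon and its complementary pentagram decompose K5.\<close>
      define P where "P = {{a, b}, {b, c}, {c, d}, {d, f}, {f, a}}"
      define P' where "P' = {{a, c}, {c, f}, {f, b}, {b, d}, {d, a}}"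
      have gP: "good 2 P" unfolding P_def by (rule good_pentagon[OF dist])
      have gP': "good 2 P'" unfolding P'_def by (rule good_pentagon) (use dist in auto)
      have P2: "\<forall>e\<in>P. card e = 2" "\<forall>e\<in>P'. card e = 2" "finite P" "finite P'" "\<Union>P \<subseteq> K" "\<Union>P' \<subseteq> K"
        using dist unfolding P_def P'_def Keq by auto
      have PP: "P \<inter> P' = {}" using dist unfolding P_def P'_def by (auto simp: doubleton_eq_iff)
      have PE: "P \<union> P' = {e \<in> EV. e \<subseteq> K}"
      proof
        show "P \<union> P' \<subseteq> {e \<in> EV. e \<subseteq> K}"
        proof
          fix e assume e: "e \<in> P \<union> P'"
          then obtain p q where pq: "e = {p, q}" "p \<noteq> q" using P2(1,2) by (metis UnE card_2_iff)
          moreover have "e \<subseteq> K" using e P2(5,6) by blast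
          ultimately show "e \<in> {e \<in> EV. e \<subseteq> K}" using complete by auto
        qed
        show "{e \<in> EV. e \<subseteq> K} \<subseteq> P \<union> P'"
        proof
          fix e assume e: "e \<in> {e \<in> EV. e \<subseteq> K}"
          then obtain p q where pq: "e = {p, q}" "p \<noteq> q" using EV(2) by (metis (no_types, lifting) card_2_iff mem_Collect_eq)
          then have "p \<in> {a, b, c, d, f}" "q \<in> {a, b, c, d, f}" using e Keq by auto
          then show "e \<in> P \<union> P'" unfolding pq(1) P_def P'_def using pq(2) by (elim insertE emptyE) (simp_all add: insert_commute)
        qed
      qed
      obtain R B where RB: "R \<union> B = {e \<in> E. e \<subseteq> V - K}" "R \<inter> B = {}" "good m R" "good m B"
        using psubset.IH[of "V - K"] v(1) KV by (auto simp: K_def)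
      have RBs: "R \<subseteq> {e \<in> EV. e \<inter> K = {}}" "B \<subseteq> {e \<in> EV. e \<inter> K = {}}"
        using RB(1) unfolding EV_def by blast+
      have "\<Union>R \<inter> K = {}" "\<Union>B \<inter> K = {}" using RBs by auto
      then have dRB: "\<Union>R \<inter> \<Union>P = {}" "\<Union>B \<inter> \<Union>P' = {}" using P2(5,6) by blast+
      have R: "finite R" "\<forall>e\<in>R. card e = 2" and B: "finite B" "\<forall>e\<in>B. card e = 2"
        using RBs EV by (auto intro: finite_subset)
      have eqK: "{e \<in> E. e \<subseteq> V - K} = {e \<in> EV. e \<inter> K = {}}" unfolding EV_def by blast
      have "(R \<union> P) \<union> (B \<union> P') = (R \<union> B) \<union> (P \<union> P')" by (simp add: Un_ac)
      also have "\<dots> = {e \<in> EV. e \<inter> K = {}} \<union> {e \<in> EV. e \<subseteq> K}" unfolding RB(1) eqK PE ..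
      also have "\<dots> = EV" using comp by auto
      finally have "(R \<union> P) \<union> (B \<union> P') = EV" .
      moreover have "(R \<union> P) \<inter> (B \<union> P') = {}"
      proof -
        have out: "e \<notin> P \<union> P'" if "e \<in> R \<union> B" for e
        proof
          assume "e \<in> P \<union> P'"
          then have "e \<subseteq> K" using P2(5,6) by auto
          moreover have "e \<inter> K = {}" "e \<in> EV" using that RBs by auto
          ultimately have "e = {}" by blast
          then show False using EV(2) \<open>e \<in> EV\<close> by auto
        qed
        show ?thesis using out RB(2) PP by auto
      qed
      moreover have "good m (R \<union> P)" "good m (B \<union> P')"
        using good_disjoint_union[OF RB(3) R(2,1) _ P2(1,3) dRB(1)] good_disjoint_union[OF RB(4) B(2,1) _ P2(2,4) dRB(2)]
          gP gP' m2 by auto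
      ultimately have "\<exists>R B. R \<union> B = EV \<and> R \<inter> B = {} \<and> good m R \<and> good m B" by blast
      then show ?thesis unfolding EV_def .
    qed
  qed
qed

theorem two_colouring:
  fixes E :: "'a set set"
  assumes "1 < m" "finite E" "\<forall>e\<in>E. card e = 2" "\<And>X. finite X \<Longrightarrow> 0 \<le> pot m E X"
  obtains R B where "R \<union> B = E" "R \<inter> B = {}" "good m R" "good m B"
proof -
  have "finite e" if "e \<in> E" for e using assms(3) that by (metis card.infinite zero_neq_numeral)
  then have "finite (\<Union>E)" using assms(2) by blast
  moreover have "{e \<in> E. e \<subseteq> \<Union>E} = E" by auto
  ultimately show thesis using two_colouring_on[OF assms, of "\<Union>E"] that by metis
qed

section \<open>Minimal cores\<close>

definition separates :: "'a set set \<Rightarrow> 'a set set \<Rightarrow> 'a set \<Rightarrow> bool" where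
  "separates \<H> \<L> W \<longleftrightarrow> (\<forall>A\<in>\<H>. \<not> A \<subseteq> W) \<and> (\<forall>A\<in>\<L>. A \<inter> W \<noteq> {})"

text \<open>\<open>W\<close> is the set of edges in the first colour.\<close>

definition minimal_core :: "'a set set \<Rightarrow> 'a set set \<Rightarrow> bool" where
  "minimal_core \<H> \<L> \<longleftrightarrow> (\<forall>W. \<not> separates \<H> \<L> W) \<and>
     (\<forall>\<H>' \<L>'. \<H>' \<subseteq> \<H> \<longrightarrow> \<L>' \<subseteq> \<L> \<longrightarrow> (\<H>', \<L>') \<noteq> (\<H>, \<L>) \<longrightarrow> (\<exists>W. separates \<H>' \<L>' W))"

lemma minimal_core_exists:
  assumes "finite \<H>" "finite \<L>" "\<And>W. \<not> separates \<H> \<L> W"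
  obtains \<H>' \<L>' where "\<H>' \<subseteq> \<H>" "\<L>' \<subseteq> \<L>" "minimal_core \<H>' \<L>'"
proof -
  define P where "P = (\<lambda>(\<H>', \<L>'). \<H>' \<subseteq> \<H> \<and> \<L>' \<subseteq> \<L> \<and> (\<forall>W. \<not> separates \<H>' \<L>' W))"
  have "P (\<H>, \<L>)" using assms by (simp add: P_def)
  then obtain q where q: "P q" and qmin: "\<And>r. P r \<Longrightarrow> card (fst q) + card (snd q) \<le> card (fst r) + card (snd r)"
    using ex_has_least_nat[of P "(\<H>, \<L>)" "\<lambda>r. card (fst r) + card (snd r)"] by blast
  obtain \<H>1 \<L>1 where q1: "q = (\<H>1, \<L>1)" by (cases q)
  have s: "\<H>1 \<subseteq> \<H>" "\<L>1 \<subseteq> \<L>" "\<And>W. \<not> separates \<H>1 \<L>1 W" using q by (auto simp: P_def q1)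
  have f: "finite \<H>1" "finite \<L>1" using s assms finite_subset by blast+
  have "minimal_core \<H>1 \<L>1"
    unfolding minimal_core_def
  proof (intro conjI allI impI)
    fix \<H>' \<L>' assume h: "\<H>' \<subseteq> \<H>1" "\<L>' \<subseteq> \<L>1" "(\<H>', \<L>') \<noteq> (\<H>1, \<L>1)"
    show "\<exists>W. separates \<H>' \<L>' W"
    proof (rule ccontr)
      assume "\<not> ?thesis"
      then have "P (\<H>', \<L>')" using h s by (auto simp: P_def)
      then have le: "card \<H>1 + card \<L>1 \<le> card \<H>' + card \<L>'" using qmin[of "(\<H>', \<L>')"] by (simp add: q1)
      have "card \<H>' \<le> card \<H>1" "card \<L>' \<le> card \<L>1" using h f by (auto intro: card_mono)
      then have "card \<H>' = card \<H>1" "card \<L>' = card \<L>1" using le by linarith+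
      then show False using h f card_subset_eq by blast
    qed
  qed (use s in auto)
  then show thesis using that s by blast
qed

lemma minimal_coreD:
  assumes "minimal_core \<H> \<L>"
  shows "\<not> separates \<H> \<L> W"
    and "\<H>' \<subseteq> \<H> \<Longrightarrow> \<L>' \<subseteq> \<L> \<Longrightarrow> \<H>' \<noteq> \<H> \<or> \<L>' \<noteq> \<L> \<Longrightarrow> \<exists>W. separates \<H>' \<L>' W"
  using assms unfolding minimal_core_def by simp_all

text \<open>A colouring that works without \<open>A\<close> must put all of \<open>A\<close> into
  the first colour. Moving \<open>e\<close> to the second colour repairs \<open>A\<close>, so it has
  to create a member of the second family all of whose edges but \<open>e\<close> were already
  outside \<open>W\<close>.\<close>

lemma minimal_core_cross_left:
  assumes c: "minimal_core \<H> \<L>" and A: "A \<in> \<H>" "e \<in> A"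
  shows "\<exists>B\<in>\<L>. A \<inter> B = {e}"
proof -
  have "\<exists>W. separates (\<H> - {A}) \<L> W" using A by (intro minimal_coreD(2)[OF c]) auto
  then obtain W where W: "separates (\<H> - {A}) \<L> W" by blast
  have n: "\<not> separates \<H> \<L> W" "\<not> separates \<H> \<L> (W - {e})" by (rule minimal_coreD(1)[OF c])+
  then have AW: "A \<subseteq> W" using W unfolding separates_def by blast
  have "\<not> C \<subseteq> W - {e}" if "C \<in> \<H>" for C
    using that W A unfolding separates_def by (cases "C = A") blast+
  then obtain B where B: "B \<in> \<L>" "B \<inter> (W - {e}) = {}" using n(2) unfolding separates_def by blast
  then have "B \<inter> W \<noteq> {}" using W unfolding separates_def by blast
  then have "A \<inter> B = {e}" using B AW A by blast
  then show ?thesis using B by blast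
qed

text \<open>Dually, a colouring that works without \<open>B\<close> misses \<open>B\<close>
  altogether, and giving \<open>e\<close> the first colour must complete a member of the first
  family.\<close>

lemma minimal_core_cross_right:
  assumes c: "minimal_core \<H> \<L>" and B: "B \<in> \<L>" "e \<in> B"
  shows "\<exists>A\<in>\<H>. B \<inter> A = {e}"
proof -
  have "\<exists>W. separates \<H> (\<L> - {B}) W" using B by (intro minimal_coreD(2)[OF c]) auto
  then obtain W where W: "separates \<H> (\<L> - {B}) W" by blast
  have n: "\<not> separates \<H> \<L> W" "\<not> separates \<H> \<L> (insert e W)" by (rule minimal_coreD(1)[OF c])+
  then have BW: "B \<inter> W = {}" using W unfolding separates_def by blast
  have "C \<inter> insert e W \<noteq> {}" if "C \<in> \<L>" for C
    using that W B unfolding separates_def by (cases "C = B") blast+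
  then obtain A where A: "A \<in> \<H>" "A \<subseteq> insert e W" using n(2) unfolding separates_def by blast
  then have "\<not> A \<subseteq> W" using W unfolding separates_def by blast
  then have "B \<inter> A = {e}" using A BW B by blast
  then show ?thesis using A by blast
qed

text \<open>If \<open>X\<close> were a proper part, the members inside \<open>X\<close> and those
  avoiding \<open>X\<close> would each form a smaller system and have a separating colouring. No
  member straddles \<open>X\<close>, so the two colourings can be glued.\<close>

lemma minimal_core_connected:
  assumes c: "minimal_core \<H> \<L>" and X: "X \<subseteq> \<Union>(\<H> \<union> \<L>)" "X \<noteq> {}"
    and cl: "\<And>A. A \<in> \<H> \<union> \<L> \<Longrightarrow> A \<inter> X \<noteq> {} \<Longrightarrow> A \<subseteq> X"
  shows "X = \<Union>(\<H> \<union> \<L>)"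
proof (rule ccontr)
  assume ne: "X \<noteq> \<Union>(\<H> \<union> \<L>)"
  let ?in = "\<lambda>S. {A \<in> S. A \<inter> X \<noteq> {}}" and ?out = "\<lambda>S. {A \<in> S. A \<inter> X = {}}"
  obtain A where A: "A \<in> \<H> \<union> \<L>" "A \<inter> X \<noteq> {}" using X by blast
  have "(?out \<H>, ?out \<L>) \<noteq> (\<H>, \<L>)"
  proof
    assume "(?out \<H>, ?out \<L>) = (\<H>, \<L>)"
    then have "A \<in> ?out \<H> \<union> ?out \<L>" using A(1) by simp
    then show False using A(2) by blast
  qed
  moreover have "?out \<H> \<subseteq> \<H>" "?out \<L> \<subseteq> \<L>" by auto
  ultimately have "\<exists>W. separates (?out \<H>) (?out \<L>) W" by (intro minimal_coreD(2)[OF c]) auto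
  then obtain W1 where W1: "separates (?out \<H>) (?out \<L>) W1" by blast
  obtain C where C: "C \<in> \<H> \<union> \<L>" "\<not> C \<subseteq> X" using ne X by blast
  have "(?in \<H>, ?in \<L>) \<noteq> (\<H>, \<L>)"
  proof
    assume "(?in \<H>, ?in \<L>) = (\<H>, \<L>)"
    then have "C \<in> ?in \<H> \<union> ?in \<L>" using C(1) by simp
    then show False using C(2) cl[of C] by blast
  qed
  moreover have "?in \<H> \<subseteq> \<H>" "?in \<L> \<subseteq> \<L>" by auto
  ultimately have "\<exists>W. separates (?in \<H>) (?in \<L>) W" by (intro minimal_coreD(2)[OF c]) auto
  then obtain W2 where W2: "separates (?in \<H>) (?in \<L>) W2" by blast
  let ?W = "(W2 \<inter> X) \<union> (W1 - X)"
  have "separates \<H> \<L> ?W"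
    unfolding separates_def
  proof (intro conjI ballI)
    fix B assume B: "B \<in> \<H>"
    show "\<not> B \<subseteq> ?W"
    proof (cases "B \<inter> X = {}")
      case True
      then have "\<not> B \<subseteq> W1" using W1 B unfolding separates_def by blast
      then show ?thesis using True by blast
    next
      case False
      then have "\<not> B \<subseteq> W2" using W2 B unfolding separates_def by blast
      then show ?thesis using cl[of B] False B by blast
    qed
  next
    fix B assume B: "B \<in> \<L>"
    show "B \<inter> ?W \<noteq> {}"
    proof (cases "B \<inter> X = {}")
      case True
      then have "B \<inter> W1 \<noteq> {}" using W1 B unfolding separates_def by blast
      then show ?thesis using True by blast
    next
      case False
      then have "B \<inter> W2 \<noteq> {}" using W2 B unfolding separates_def by blast
      then show ?thesis using cl[of B] False B by blast
    qed
  qed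
  then show False using minimal_coreD(1)[OF c] by blast
qed

text \<open>The hypotheses on a member of the second family (strictly 2-balanced, density \<open>m\<close>) and of the
  first family (strictly balanced with respect to a second family of density \<open>l\<close>), for edge sets
  of graphs without isolated vertices.\<close>

definition balanced2 :: "real \<Rightarrow> real \<Rightarrow> 'a set set \<Rightarrow> bool" where
  "balanced2 m d A \<longleftrightarrow> finite A \<and> (\<forall>e\<in>A. card e = 2) \<and> 3 \<le> card A \<and> 3 \<le> card (\<Union>A) \<and>
     (real (card A) - 1) / m = real (card (\<Union>A)) - 2 \<and>
     (\<forall>W B. W \<subseteq> \<Union>A \<longrightarrow> B \<subseteq> A \<longrightarrow> \<Union>B \<subseteq> W \<longrightarrow> 3 \<le> card W \<longrightarrow> B \<noteq> A \<longrightarrow> (real (card B) - 1) / m + d \<le> real (card W) - 2)"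

definition balanced_asym :: "real \<Rightarrow> real \<Rightarrow> real \<Rightarrow> 'a set set \<Rightarrow> bool" where
  "balanced_asym a l d A \<longleftrightarrow> finite A \<and> (\<forall>e\<in>A. card e = 2) \<and> 3 \<le> card (\<Union>A) \<and> lam a (\<Union>A) A \<le> 2 - 1 / l \<and>
     (\<forall>W B. W \<subseteq> \<Union>A \<longrightarrow> B \<subseteq> A \<longrightarrow> \<Union>B \<subseteq> W \<longrightarrow> 2 \<le> card W \<longrightarrow> B \<noteq> A \<longrightarrow> lam a (\<Union>A) A \<le> lam a W B - d)"

lemma balanced2D:
  assumes "balanced2 m d A"
  shows "finite A" "\<And>e. e \<in> A \<Longrightarrow> card e = 2" "3 \<le> card A" "3 \<le> card (\<Union>A)"
    "(real (card A) - 1) / m = real (card (\<Union>A)) - 2"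
    "\<And>W B. W \<subseteq> \<Union>A \<Longrightarrow> B \<subseteq> A \<Longrightarrow> \<Union>B \<subseteq> W \<Longrightarrow> 3 \<le> card W \<Longrightarrow> B \<noteq> A \<Longrightarrow> (real (card B) - 1) / m + d \<le> real (card W) - 2"
  using assms unfolding balanced2_def by simp_all

lemma balanced_asymD:
  assumes "balanced_asym a l d A"
  shows "finite A" "\<And>e. e \<in> A \<Longrightarrow> card e = 2" "3 \<le> card (\<Union>A)" "lam a (\<Union>A) A \<le> 2 - 1 / l"
    "\<And>W B. W \<subseteq> \<Union>A \<Longrightarrow> B \<subseteq> A \<Longrightarrow> \<Union>B \<subseteq> W \<Longrightarrow> 2 \<le> card W \<Longrightarrow> B \<noteq> A \<Longrightarrow> lam a (\<Union>A) A \<le> lam a W B - d"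
  using assms unfolding balanced_asym_def by simp_all

lemma finite_Union_edges: "finite A \<Longrightarrow> \<forall>e\<in>A. card e = 2 \<Longrightarrow> finite (\<Union>A)"
  by (metis card.infinite finite_Union zero_neq_numeral)

lemma degree_two_aux:
  assumes A: "\<forall>e\<in>A. card e = 2" "x \<in> \<Union>A"
    and no: "\<And>e. e \<in> A \<Longrightarrow> x \<in> e \<Longrightarrow> \<Union>(A - {e}) \<subseteq> \<Union>A - {x} \<Longrightarrow> False"
  shows "\<exists>e\<in>A. \<exists>f\<in>A. e \<noteq> f \<and> x \<in> e \<and> x \<in> f"
proof (rule ccontr)
  assume neg: "\<not> ?thesis"
  obtain e where e: "e \<in> A" "x \<in> e" using A by blast
  have "\<Union>(A - {e}) \<subseteq> \<Union>A - {x}" using neg e by blast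
  then show False using no e by blast
qed

text \<open>Removing a vertex of degree one with its edge changes the weight by
  \<open>1 / a - 1\<close>, which is not positive, while balancedness demands a gain of at least
  \<open>d\<close>.\<close>

lemma balanced_asym_degree:
  assumes A: "balanced_asym a l d A" and a: "1 \<le> a" and d: "0 < d" and x: "x \<in> \<Union>A"
  shows "\<exists>e\<in>A. \<exists>f\<in>A. e \<noteq> f \<and> x \<in> e \<and> x \<in> f"
proof (rule degree_two_aux)
  show "\<forall>e\<in>A. card e = 2" "x \<in> \<Union>A" using A x by (auto simp: balanced_asym_def)
  fix e assume e: "e \<in> A" "x \<in> e" and s: "\<Union>(A - {e}) \<subseteq> \<Union>A - {x}"
  have f: "finite A" "finite (\<Union>A)" using A finite_Union_edges[of A] by (auto simp: balanced_asym_def)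
  have "0 < card A" using e f by (auto simp: card_gt_0_iff)
  moreover have "card (\<Union>A - {x}) = card (\<Union>A) - 1" "card (A - {e}) = card A - 1" "3 \<le> card (\<Union>A)"
    using x e f balanced_asymD(3)[OF A] by simp_all
  ultimately have c: "card (\<Union>A - {x}) = card (\<Union>A) - 1" "card (A - {e}) = card A - 1" "3 \<le> card (\<Union>A)" "1 \<le> card A"
    by linarith+
  have "lam a (\<Union>A) A \<le> lam a (\<Union>A - {x}) (A - {e}) - d"
    using s e c by (intro balanced_asymD(5)[OF A]) auto
  then have "1 + d \<le> 1 / a" using c by (simp add: lam_def of_nat_diff diff_divide_distrib)
  moreover have "1 / a \<le> 1" using a by simp
  ultimately show False using d by linarith
qed

lemma balanced2_degree:
  assumes A: "balanced2 m d A" and m: "1 < m" and d: "0 \<le> d" and x: "x \<in> \<Union>A"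
  shows "\<exists>e\<in>A. \<exists>f\<in>A. e \<noteq> f \<and> x \<in> e \<and> x \<in> f"
proof (rule degree_two_aux)
  show "\<forall>e\<in>A. card e = 2" "x \<in> \<Union>A" using A x by (auto simp: balanced2_def)
  fix e assume e: "e \<in> A" "x \<in> e" and s: "\<Union>(A - {e}) \<subseteq> \<Union>A - {x}"
  have f: "finite A" "finite (\<Union>A)" using A finite_Union_edges[of A] by (auto simp: balanced2_def)
  have c: "card (\<Union>A - {x}) = card (\<Union>A) - 1" "card (A - {e}) = card A - 1" "3 \<le> card (\<Union>A)" "3 \<le> card A"
    using x e f balanced2D(3,4)[OF A] by simp_all
  have tot: "(real (card A) - 1) / m = real (card (\<Union>A)) - 2" using A by (simp add: balanced2_def)
  show False
  \<comment> \<open>Balancedness concerns only sets of at least three vertices. If just two remain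
    after the removal, they carry a single edge, too few for a graph with three edges.\<close>
  proof (cases "card (\<Union>A) = 3")
    case True
    have c2: "card (\<Union>A - {x}) = 2" using c True by simp
    have "g = \<Union>A - {x}" if "g \<in> A - {e}" for g
      using that s f(2) A c2 by (intro card_subset_eq) (auto simp: balanced2_def)
    then have "A - {e} \<subseteq> {\<Union>A - {x}}" by blast
    then have "card (A - {e}) \<le> 1" using card_mono[of "{\<Union>A - {x}}"] by simp
    then show False using c by simp
  next
    case False
    then have "3 \<le> card (\<Union>A - {x})" using c by simp
    moreover have "A - {e} \<noteq> A" using e by blast
    ultimately have "(real (card (A - {e})) - 1) / m + d \<le> real (card (\<Union>A - {x})) - 2"
      using s by (intro balanced2D(6)[OF A]) auto
    moreover have "real (card (A - {e})) = real (card A) - 1" "real (card (\<Union>A - {x})) = real (card (\<Union>A)) - 1"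
      using c by (simp_all add: of_nat_diff)
    ultimately have "(real (card A) - 1) / m - 1 / m + d \<le> real (card (\<Union>A)) - 3" by (simp add: diff_divide_distrib)
    then have "1 + d \<le> 1 / m" using tot by linarith
    moreover have "1 / m < 1" using m by simp
    ultimately show False using d by linarith
  qed
qed

text \<open>This is the origin of the step size \<open>v0 + e0 * v0\<close>: one member with at most
  \<open>v0\<close> vertices and a further member on each of its at most \<open>e0\<close>
  edges.\<close>

lemma card_compound:
  assumes L: "finite L" "card L \<le> e0" "card (\<Union>L) \<le> v0" and H: "\<And>s. s \<in> L - X \<Longrightarrow> card (\<Union>(H s)) \<le> v0"
  shows "card (\<Union>(L \<union> (\<Union>s\<in>L - X. H s))) \<le> v0 + e0 * v0"
proof -
  have "\<Union>(L \<union> (\<Union>s\<in>L - X. H s)) = \<Union>L \<union> (\<Union>s\<in>L - X. \<Union>(H s))" by blast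
  then have "card (\<Union>(L \<union> (\<Union>s\<in>L - X. H s))) \<le> card (\<Union>L) + card (\<Union>s\<in>L - X. \<Union>(H s))"
    by (simp add: card_Un_le)
  also have "card (\<Union>s\<in>L - X. \<Union>(H s)) \<le> (\<Sum>s\<in>L - X. card (\<Union>(H s)))" using L(1) by (intro card_UN_le) auto
  also have "\<dots> \<le> (\<Sum>s\<in>L - X. v0)" using H by (intro sum_mono) auto
  also have "\<dots> \<le> e0 * v0"
  proof -
    have "card (L - X) \<le> e0" using L(1,2) by (meson Diff_subset card_mono le_trans)
    then show ?thesis by simp
  qed
  finally show ?thesis using L(3) by linarith
qed

section \<open>Attaching members of a core\<close>

lemma lam_add_le:
  assumes X: "finite X" "finite (\<Union>X)" and A: "finite A" "finite (\<Union>A)"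
    and le: "lam a (\<Union>A) A \<le> lam a (\<Union>A \<inter> \<Union>X) (A \<inter> X) - d"
  shows "lam a (\<Union>(X \<union> A)) (X \<union> A) \<le> lam a (\<Union>X) X - d"
proof -
  have "lam a (\<Union>X \<union> \<Union>A) (X \<union> A) = lam a (\<Union>X) X + lam a (\<Union>A) A - lam a (\<Union>X \<inter> \<Union>A) (X \<inter> A)"
    using lam_union[OF X(2) A(2) X(1) A(1)] .
  then show ?thesis using le by (simp add: Int_commute)
qed

text \<open>A new member of the first family that meets \<open>X\<close> in two vertices is
  degenerate by itself, because every proper subgraph, a single edge included, has weight larger by
  \<open>d\<close>. If there is none, the member at hand belongs to the second family, and the
  first-family members crossing it meet \<open>X\<close> in at most one vertex, as
  \<open>attach_compound\<close> requires.\<close>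

lemma attach_asym:
  fixes \<H> \<L> :: "'a set set set"
  assumes H: "\<And>A. A \<in> \<H> \<Longrightarrow> balanced_asym a l d A" and L: "\<And>A. A \<in> \<L> \<Longrightarrow> \<exists>m. 1 / m \<le> 1 / l \<and> balanced2 m d A"
    and v0: "\<And>A. A \<in> \<H> \<union> \<L> \<Longrightarrow> card (\<Union>A) \<le> v0" and e0: "\<And>A. A \<in> \<H> \<union> \<L> \<Longrightarrow> card A \<le> e0"
    and cross: "\<And>A e. A \<in> \<L> \<Longrightarrow> e \<in> A \<Longrightarrow> \<exists>B\<in>\<H>. A \<inter> B = {e}"
    and d: "0 \<le> d" "d \<le> 1" and X: "finite X" "\<And>e. e \<in> X \<Longrightarrow> card e = 2"
    and A: "A \<in> \<H> \<union> \<L>" "\<not> A \<subseteq> X" "e \<in> A" "e \<in> X"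
  shows "\<exists>T. degenerate_step (\<H> \<union> \<L>) a d (v0 + e0 * v0) X T \<or> regular_step (\<H> \<union> \<L>) a (v0 + e0 * v0) X e T"
proof -
  have fX: "finite (\<Union>X)" using X by (intro finite_Union_edges) auto
  have deg: "degenerate_step (\<H> \<union> \<L>) a d (v0 + e0 * v0) X B"
    if B: "B \<in> \<H>" "\<not> B \<subseteq> X" "2 \<le> card (\<Union>B \<inter> \<Union>X)" for B
  proof -
    note b = balanced_asymD[OF H[OF B(1)]]
    have fB: "finite (\<Union>B)" using b by (intro finite_Union_edges) auto
    have "lam a (\<Union>B) B \<le> lam a (\<Union>B \<inter> \<Union>X) (B \<inter> X) - d"
      using B by (intro b(5)) auto
    then have "lam a (\<Union>(X \<union> B)) (X \<union> B) \<le> lam a (\<Union>X) X - d"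
      by (intro lam_add_le[OF X(1) fX b(1) fB])
    moreover have "card (\<Union>B) \<le> v0 + e0 * v0" using v0[of B] B(1) by auto
    ultimately show ?thesis unfolding degenerate_step_def using B by auto
  qed
  show ?thesis
  proof (cases "\<exists>B\<in>\<H>. \<not> B \<subseteq> X \<and> 2 \<le> card (\<Union>B \<inter> \<Union>X)")
    case True
    then show ?thesis using deg by blast
  next
    case False
    have AL: "A \<in> \<L>"
    proof (rule ccontr)
      assume "A \<notin> \<L>"
      then have AH: "A \<in> \<H>" using A(1) by simp
      have "card e \<le> card (\<Union>A \<inter> \<Union>X)" using fX A(3,4) by (intro card_mono) auto
      then show False using False AH A(2) X(2)[OF A(4)] by auto
    qed
    obtain m where m: "1 / m \<le> 1 / l" and bm: "balanced2 m d A" using L[OF AL] by blast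
    note b = balanced2D[OF bm]
    define h where "h = (\<lambda>s. SOME B. B \<in> \<H> \<and> A \<inter> B = {s})"
    have h: "h s \<in> \<H>" "A \<inter> h s = {s}" if "s \<in> A - X" for s
    proof -
      have "\<exists>B. B \<in> \<H> \<and> A \<inter> B = {s}" using cross[OF AL, of s] that by blast
      from someI_ex[OF this] show "h s \<in> \<H>" "A \<inter> h s = {s}" unfolding h_def by blast+
    qed
    have nh: "\<not> h s \<subseteq> X" if "s \<in> A - X" for s using h(2)[OF that] that by blast
    have "degenerate_step (\<H> \<union> \<L>) a d (v0 + e0 * v0) X (A \<union> (\<Union>s\<in>A - X. h s)) \<or>
        regular_step (\<H> \<union> \<L>) a (v0 + e0 * v0) X e (A \<union> (\<Union>s\<in>A - X. h s))"
    proof (rule attach_compound[where m = m and l = l])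
      show "\<And>s. s \<in> A - X \<Longrightarrow> h s \<inter> A = {s}" using h(2) by (simp add: Int_commute)
      show "\<And>s. s \<in> A - X \<Longrightarrow> card (\<Union>(h s) \<inter> \<Union>X) \<le> 1" using False h(1) nh by force
      show "card (\<Union>(A \<union> (\<Union>s\<in>A - X. h s))) \<le> v0 + e0 * v0"
        using b(1) e0 v0 AL h(1) by (intro card_compound) auto
      fix s W B assume s: "s \<in> A - X" and W: "W \<subseteq> \<Union>(h s)" "B \<subseteq> h s" "\<Union>B \<subseteq> W" "2 \<le> card W"
      show "lam a (\<Union>(h s)) (h s) \<le> lam a W B"
      proof (cases "B = h s")
        case True
        then have "W = \<Union>(h s)" using W by blast
        then show ?thesis using True by simp
      next
        case False
        then have "lam a (\<Union>(h s)) (h s) \<le> lam a W B - d" using W by (intro balanced_asymD(5)[OF H[OF h(1)[OF s]]])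
        then show ?thesis using d by linarith
      qed
    qed (use X b A AL m d h(1) balanced_asymD[OF H[OF h(1)]] in auto)
    then show ?thesis by blast
  qed
qed

text \<open>In the symmetric case \<open>K\<^sub>2\<close> is a subgraph of equal weight, so attaching a member along a
  single edge does not decrease the weight.\<close>

lemma balanced2_lam:
  assumes A: "balanced2 m d A" and ma: "0 < a" "a \<le> m" and da: "0 \<le> d" "d \<le> 1 / a"
    and W: "W \<subseteq> \<Union>A" "B \<subseteq> A" "\<Union>B \<subseteq> W" "2 \<le> card W" "B \<noteq> A"
  shows "lam a (\<Union>A) A \<le> lam a W B"
    and "3 \<le> card W \<or> B = {} \<Longrightarrow> lam a (\<Union>A) A \<le> lam a W B - d"
proof -
  note b = balanced2D[OF A]
  have fA: "finite (\<Union>A)" using b by (intro finite_Union_edges) auto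
  have im: "1 / m \<le> 1 / a" using ma by (intro divide_left_mono) auto
  have big: "lam a (\<Union>A) A \<le> lam a W B - d" if "3 \<le> card W"
  proof -
    have "(real (card B) - 1) / m + d \<le> real (card W) - 2" using W that by (intro b(6)) auto
    moreover have "card B \<le> card A" using W b(1) by (intro card_mono) auto
    then have "(real (card A) - real (card B)) * (1 / m) \<le> (real (card A) - real (card B)) * (1 / a)"
      using im by (intro mult_left_mono) auto
    ultimately show ?thesis using b(5) by (simp add: lam_def diff_divide_distrib)
  qed
  have small: "lam a (\<Union>A) A \<le> 2 - 1 / a"
  proof -
    have "(real (card A) - 1) * (1 / m) \<le> (real (card A) - 1) * (1 / a)"
      using im b(3) by (intro mult_left_mono) auto
    then show ?thesis using b(5) by (simp add: lam_def diff_divide_distrib)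
  qed
  have two: "lam a W B = 2 - real (card B) / a \<and> card B \<le> 1" if "\<not> 3 \<le> card W"
  proof -
    have cW: "card W = 2" using that W(4) by linarith
    have "finite W" using W(1) fA finite_subset by blast
    then have "e = W" if "e \<in> B" for e
      using that W b(2) cW by (intro card_subset_eq) auto
    then have "B \<subseteq> {W}" by blast
    then have "card B \<le> 1" using card_mono[of "{W}" B] by simp
    then show ?thesis using cW by (simp add: lam_def)
  qed
  show "lam a (\<Union>A) A \<le> lam a W B"
  proof (cases "3 \<le> card W")
    case False
    then have "lam a W B = 2 - real (card B) / a" "real (card B) / a \<le> 1 / a" using two ma by (auto simp: divide_right_mono)
    then show ?thesis using small by linarith
  qed (use big da in auto)
  show "3 \<le> card W \<or> B = {} \<Longrightarrow> lam a (\<Union>A) A \<le> lam a W B - d"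
    using big two small da by (cases "3 \<le> card W") auto
qed

text \<open>The new difficulty is a crossing member that meets \<open>X\<close> in exactly one edge
  \<open>g\<close>, since attaching it may leave the weight unchanged. Attaching \<open>A\<close>
  first does not raise the weight either, but afterwards the crossing member meets the explored part
  in the two edges \<open>g\<close> and \<open>s\<close>, hence in three vertices, and having at
  least three edges it is not absorbed; so \<open>A\<close> together with it is degenerate.\<close>

lemma attach_sym:
  fixes F \<H> \<L> :: "'a set set set"
  assumes F: "\<And>A. A \<in> F \<Longrightarrow> \<exists>m\<ge>a. balanced2 m d A" and FHL: "\<H> \<subseteq> F" "\<L> \<subseteq> F"
    and v0: "\<And>A. A \<in> F \<Longrightarrow> card (\<Union>A) \<le> v0" and e0: "\<And>A. A \<in> F \<Longrightarrow> card A \<le> e0"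
    and cross: "\<And>A e. A \<in> \<L> \<Longrightarrow> e \<in> A \<Longrightarrow> \<exists>B\<in>\<H>. A \<inter> B = {e}"
    and a: "1 < a" and d: "0 \<le> d" "d \<le> 1 / a" and X: "finite X" "\<And>e. e \<in> X \<Longrightarrow> card e = 2"
    and A: "A \<in> \<L>" "\<not> A \<subseteq> X" "e \<in> A" "e \<in> X"
  shows "\<exists>T. degenerate_step F a d (v0 + e0 * v0) X T \<or> regular_step F a (v0 + e0 * v0) X e T"
proof -
  have a0: "0 < a" using a by simp
  have fX: "finite (\<Union>X)" using X by (intro finite_Union_edges) auto
  have b: "finite B" "finite (\<Union>B)" "\<And>e. e \<in> B \<Longrightarrow> card e = 2" "3 \<le> card B" "3 \<le> card (\<Union>B)" if B: "B \<in> F" for B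
  proof -
    obtain m where "balanced2 m d B" using F[OF B] by blast
    note bb = balanced2D[OF this]
    show "finite B" "finite (\<Union>B)" "\<And>e. e \<in> B \<Longrightarrow> card e = 2" "3 \<le> card B" "3 \<le> card (\<Union>B)"
      using bb finite_Union_edges[of B] by auto
  qed
  have lam1: "lam a (\<Union>B) B \<le> lam a W C"
    if "B \<in> F" "W \<subseteq> \<Union>B" "C \<subseteq> B" "\<Union>C \<subseteq> W" "2 \<le> card W" for B W C
  proof (cases "C = B")
    case True
    then have "W = \<Union>B" using that by blast
    then show ?thesis using True by simp
  next
    case False
    then show ?thesis using F[OF that(1)] balanced2_lam(1)[OF _ a0 _ d that(2-5) False] by blast
  qed
  have lam2: "lam a (\<Union>B) B \<le> lam a W C - d"
    if "B \<in> F" "W \<subseteq> \<Union>B" "C \<subseteq> B" "\<Union>C \<subseteq> W" "2 \<le> card W" "C \<noteq> B" "3 \<le> card W \<or> C = {}" for B W C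
    using F[OF that(1)] balanced2_lam(2)[OF _ a0 _ d that(2-7)] by blast
  have lamF: "lam a (\<Union>B) B \<le> 2 - 1 / a" if B: "B \<in> F" for B
  proof -
    obtain f where f: "f \<in> B" using b(4)[OF B] by fastforce
    have "lam a (\<Union>B) B \<le> lam a f {f}" using f b(3)[OF B f] by (intro lam1[OF B]) auto
    then show ?thesis using b(3)[OF B f] by (simp add: lam_def)
  qed
  have AF: "A \<in> F" using A FHL by auto
  have deg: "degenerate_step F a d (v0 + e0 * v0) X B"
    if B: "B \<in> F" "\<not> B \<subseteq> X" "2 \<le> card (\<Union>B \<inter> \<Union>X)" "3 \<le> card (\<Union>B \<inter> \<Union>X) \<or> B \<inter> X = {}" for B
  proof -
    have "lam a (\<Union>B) B \<le> lam a (\<Union>B \<inter> \<Union>X) (B \<inter> X) - d"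
      using B by (intro lam2) auto
    then have "lam a (\<Union>(X \<union> B)) (X \<union> B) \<le> lam a (\<Union>X) X - d"
      by (intro lam_add_le[OF X(1) fX b(1,2)[OF B(1)]])
    moreover have "card (\<Union>B) \<le> v0 + e0 * v0" using v0[OF B(1)] by simp
    ultimately show ?thesis unfolding degenerate_step_def using B by auto
  qed
  define h where "h = (\<lambda>s. SOME B. B \<in> \<H> \<and> A \<inter> B = {s})"
  have h: "h s \<in> F" "A \<inter> h s = {s}" if "s \<in> A - X" for s
  proof -
    have "\<exists>B. B \<in> \<H> \<and> A \<inter> B = {s}" using cross[OF A(1), of s] that by blast
    from someI_ex[OF this] show "h s \<in> F" "A \<inter> h s = {s}" unfolding h_def using FHL by blast+
  qed
  have nh: "\<not> h s \<subseteq> X" if "s \<in> A - X" for s using h(2)[OF that] that by blast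
  show ?thesis
  proof (cases "\<exists>s\<in>A - X. 2 \<le> card (\<Union>(h s) \<inter> \<Union>X)")
    case True
    then obtain s where s: "s \<in> A - X" "2 \<le> card (\<Union>(h s) \<inter> \<Union>X)" by blast
    let ?B = "h s"
    note hs = h[OF s(1)]
    show ?thesis
    proof (cases "3 \<le> card (\<Union>?B \<inter> \<Union>X) \<or> ?B \<inter> X = {}")
      case True
      then show ?thesis using deg[OF hs(1) nh[OF s(1)] s(2)] by blast
    next
      case False
      then obtain g where g: "g \<in> ?B" "g \<in> X" by blast
      have cW: "card (\<Union>?B \<inter> \<Union>X) = 2" using False s(2) by linarith
      have uniq: "f = \<Union>?B \<inter> \<Union>X" if "f \<in> ?B" "f \<in> X" for f
        using that fX cW b(3)[OF hs(1)] by (intro card_subset_eq) auto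
      let ?Y = "X \<union> A"
      have fY: "finite ?Y" "finite (\<Union>?Y)" using X fX b[OF AF] by auto
      have le1: "lam a (\<Union>?Y) ?Y \<le> lam a (\<Union>X) X - 0"
      proof (rule lam_add_le[OF X(1) fX b(1,2)[OF AF]])
        have "card e \<le> card (\<Union>A \<inter> \<Union>X)" using fX A(3,4) by (intro card_mono) auto
        then have "lam a (\<Union>A) A \<le> lam a (\<Union>A \<inter> \<Union>X) (A \<inter> X)"
          using X(2)[OF A(4)] by (intro lam1[OF AF]) auto
        then show "lam a (\<Union>A) A \<le> lam a (\<Union>A \<inter> \<Union>X) (A \<inter> X) - 0" by simp
      qed
      have le2: "lam a (\<Union>(?Y \<union> ?B)) (?Y \<union> ?B) \<le> lam a (\<Union>?Y) ?Y - d"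
      proof (rule lam_add_le[OF fY b(1,2)[OF hs(1)]])
        let ?W = "\<Union>?B \<inter> \<Union>?Y"
        have gs: "g \<noteq> s" "s \<in> ?B" using g s hs by auto
        have sub: "g \<union> s \<subseteq> ?W" using g s hs by auto
        have fgs: "finite (g \<union> s)" using sub fY by (meson finite_Int finite_subset)
        have "g \<subset> g \<union> s"
        proof (rule psubsetI)
          show "g \<noteq> g \<union> s"
          proof
            assume "g = g \<union> s"
            then have "s \<subseteq> g" by blast
            then have "s = g" using fgs b(3)[OF hs(1)] g gs by (intro card_subset_eq) auto
            then show False using gs by simp
          qed
        qed auto
        then have "card g < card (g \<union> s)" using fgs by (intro psubset_card_mono)
        also have "\<dots> \<le> card ?W" using sub fY by (intro card_mono) auto
        finally have W3: "3 \<le> card ?W" using b(3)[OF hs(1) g(1)] by simp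
        have "?B \<inter> ?Y \<noteq> ?B"
        proof
          assume "?B \<inter> ?Y = ?B"
          then have "?B \<subseteq> {s, \<Union>?B \<inter> \<Union>X}" using uniq hs(2) by blast
          then have "card ?B \<le> card {s, \<Union>?B \<inter> \<Union>X}" by (intro card_mono) auto
          also have "\<dots> \<le> 2" by (simp add: card_insert_if)
          finally show False using b(4)[OF hs(1)] by simp
        qed
        then show "lam a (\<Union>?B) ?B \<le> lam a ?W (?B \<inter> ?Y) - d"
          using W3 by (intro lam2[OF hs(1)]) auto
      qed
      have "X \<union> (A \<union> ?B) = ?Y \<union> ?B" by blast
      then have "lam a (\<Union>(X \<union> (A \<union> ?B))) (X \<union> (A \<union> ?B)) \<le> lam a (\<Union>X) X - d" using le1 le2 by simp
      moreover have "card (\<Union>(A \<union> ?B)) \<le> v0 + e0 * v0"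
      proof -
        have "card (\<Union>(A \<union> ?B)) \<le> card (\<Union>A) + card (\<Union>?B)" by (simp add: Union_Un_distrib card_Un_le)
        moreover have "1 \<le> e0" using e0[OF AF] b(4)[OF AF] by linarith
        then have "v0 \<le> e0 * v0" by simp
        ultimately show ?thesis using v0[OF AF] v0[OF hs(1)] by linarith
      qed
      ultimately have "degenerate_step F a d (v0 + e0 * v0) X (A \<union> ?B)"
        unfolding degenerate_step_def using AF hs(1) A(2) by auto
      then show ?thesis by blast
    qed
  next
    case False
    obtain m where m: "a \<le> m" and bm: "balanced2 m d A" using F[OF AF] by blast
    have "degenerate_step F a d (v0 + e0 * v0) X (A \<union> (\<Union>s\<in>A - X. h s)) \<or>
        regular_step F a (v0 + e0 * v0) X e (A \<union> (\<Union>s\<in>A - X. h s))"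
    proof (rule attach_compound[where m = m and l = a])
      show "1 / m \<le> 1 / a" using a0 m by (intro divide_left_mono) auto
      have "1 / a \<le> 1" using a by simp
      then show "d \<le> 1" using d by linarith
      show "\<And>s. s \<in> A - X \<Longrightarrow> h s \<inter> A = {s}" using h(2) by (simp add: Int_commute)
      show "\<And>s. s \<in> A - X \<Longrightarrow> card (\<Union>(h s) \<inter> \<Union>X) \<le> 1" using False by force
      show "card (\<Union>(A \<union> (\<Union>s\<in>A - X. h s))) \<le> v0 + e0 * v0"
        using b(1)[OF AF] e0 v0 AF h(1) by (intro card_compound) auto
      show "\<And>s W B. s \<in> A - X \<Longrightarrow> W \<subseteq> \<Union>(h s) \<Longrightarrow> B \<subseteq> h s \<Longrightarrow> \<Union>B \<subseteq> W \<Longrightarrow> 2 \<le> card W \<Longrightarrow>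
          lam a (\<Union>(h s)) (h s) \<le> lam a W B" using lam1 h(1) by blast
      show "\<And>s f. s \<in> A - X \<Longrightarrow> f \<in> h s \<Longrightarrow> card f = 2" using b(3)[OF h(1)] .
      show "\<And>s. s \<in> A - X \<Longrightarrow> 3 \<le> card (\<Union>(h s))" using b(5)[OF h(1)] .
      show "\<And>s. s \<in> A - X \<Longrightarrow> lam a (\<Union>(h s)) (h s) \<le> 2 - 1 / a" using lamF[OF h(1)] .
      show "\<And>s. s \<in> A - X \<Longrightarrow> finite (h s)" using b(1)[OF h(1)] .
      show "\<And>s. s \<in> A - X \<Longrightarrow> h s \<in> F" by (rule h(1))
      show "\<And>W B. W \<subseteq> \<Union>A \<Longrightarrow> B \<subseteq> A \<Longrightarrow> \<Union>B \<subseteq> W \<Longrightarrow> 3 \<le> card W \<Longrightarrow> B \<noteq> A \<Longrightarrow>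
          (real (card B) - 1) / m + d \<le> real (card W) - 2" by (rule balanced2D(6)[OF bm])
    qed (use X balanced2D(1-5)[OF bm] A AF d in auto)
    then show ?thesis by blast
  qed
qed

section \<open>Minimal cores can be explored\<close>

theorem exploration_asym:
  fixes \<H> \<L> :: "nat set set set"
  assumes core: "minimal_core \<H> \<L>" and n: "\<Union>(\<H> \<union> \<L>) \<subseteq> all_edges n"
    and H: "\<And>A. A \<in> \<H> \<Longrightarrow> balanced_asym a l d A" and L: "\<And>A. A \<in> \<L> \<Longrightarrow> \<exists>m. 1 < m \<and> 1 / m \<le> 1 / l \<and> balanced2 m d A"
    and v0: "\<And>A. A \<in> \<H> \<union> \<L> \<Longrightarrow> card (\<Union>A) \<le> v0" and e0: "\<And>A. A \<in> \<H> \<union> \<L> \<Longrightarrow> card A \<le> e0"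
    and a: "1 \<le> a" and l: "0 < l" and d: "0 < d" "d \<le> 1"
  shows "exploration (\<H> \<union> \<L>) a d (v0 + e0 * v0) n"
proof
  note cl = minimal_core_cross_left[OF core] and cr = minimal_core_cross_right[OF core]
  have ne: "A \<noteq> {}" if "A \<in> \<H> \<union> \<L>" for A
  proof
    assume "A = {}"
    then show False using that balanced_asymD(3)[OF H, of A] L[of A] balanced2D(3)[of _ d A] by auto
  qed
  have "\<H> \<noteq> {}"
  proof
    assume e: "\<H> = {}"
    have "separates \<H> \<L> UNIV" unfolding separates_def using e ne by auto
    then show False using minimal_coreD(1)[OF core] by blast
  qed
  then obtain A where A: "A \<in> \<H>" by auto
  have "0 \<le> 1 / l" using l by simp
  then have "lam a (\<Union>A) A \<le> 2" using balanced_asymD(4)[OF H[OF A]] by linarith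
  then show "\<exists>A\<in>\<H> \<union> \<L>. lam a (\<Union>A) A \<le> 2" using A by blast
  show "\<Union>(\<H> \<union> \<L>) \<subseteq> all_edges n" by (rule n)
  show "card (\<Union>A) \<le> v0 + e0 * v0" if "A \<in> \<H> \<union> \<L>" for A using v0[OF that] by simp
  show "A \<noteq> {}" if "A \<in> \<H> \<union> \<L>" for A using ne[OF that] .
  show "\<exists>e\<in>A. \<exists>f\<in>A. e \<noteq> f \<and> x \<in> e \<and> x \<in> f" if "A \<in> \<H> \<union> \<L>" "x \<in> \<Union>A" for A x
  proof (cases "A \<in> \<H>")
    case True
    then show ?thesis using balanced_asym_degree[OF H a d(1) that(2)] by blast
  next
    case False
    then have "A \<in> \<L>" using that(1) by simp
    then obtain m where "1 < m" "balanced2 m d A" using L by blast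
    then show ?thesis using balanced2_degree[OF _ _ _ that(2)] d(1) by simp
  qed
  show "\<exists>B\<in>\<H> \<union> \<L>. A \<inter> B = {e}" if "A \<in> \<H> \<union> \<L>" "e \<in> A" for A e
    using that cl[of A e] cr[of A e] by blast
  show "X = \<Union>(\<H> \<union> \<L>)" if "X \<subseteq> \<Union>(\<H> \<union> \<L>)" "X \<noteq> {}" "\<And>A. A \<in> \<H> \<union> \<L> \<Longrightarrow> A \<inter> X \<noteq> {} \<Longrightarrow> A \<subseteq> X" for X
    using minimal_core_connected[OF core that] .
  show "\<exists>T. degenerate_step (\<H> \<union> \<L>) a d (v0 + e0 * v0) X T \<or> regular_step (\<H> \<union> \<L>) a (v0 + e0 * v0) X e T"
    if X: "X \<subseteq> \<Union>(\<H> \<union> \<L>)" and A: "A \<in> \<H> \<union> \<L>" "\<not> A \<subseteq> X" "e \<in> A" "e \<in> X" for X A e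
  proof (rule attach_asym[OF H _ v0 e0 cr _ d(2) _ _ A])
    show "finite X" using X n finite_all_edges by (meson finite_subset)
    show "card f = 2" if "f \<in> X" for f
    proof -
      have "f \<in> all_edges n" using that X n by blast
      then show ?thesis by (simp add: all_edges_def)
    qed
    show "\<exists>m. 1 / m \<le> 1 / l \<and> balanced2 m d A" if "A \<in> \<L>" for A using L[OF that] by blast
  qed (use d in auto)
  show "0 \<le> d" using d by simp
qed

theorem exploration_sym:
  fixes \<H> \<L> :: "nat set set set"
  assumes core: "minimal_core \<H> \<L>" and n: "\<Union>(\<H> \<union> \<L>) \<subseteq> all_edges n"
    and F: "\<And>A. A \<in> \<H> \<union> \<L> \<Longrightarrow> \<exists>m\<ge>a. balanced2 m d A"
    and v0: "\<And>A. A \<in> \<H> \<union> \<L> \<Longrightarrow> card (\<Union>A) \<le> v0" and e0: "\<And>A. A \<in> \<H> \<union> \<L> \<Longrightarrow> card A \<le> e0"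
    and a: "1 < a" and d: "0 < d" "d \<le> 1 / a"
  shows "exploration (\<H> \<union> \<L>) a d (v0 + e0 * v0) n"
proof
  note cl = minimal_core_cross_left[OF core] and cr = minimal_core_cross_right[OF core]
  have a0: "0 < a" using a by simp
  have d0: "0 \<le> d" using d by simp
  have ne: "A \<noteq> {}" if "A \<in> \<H> \<union> \<L>" for A
    using F[OF that] balanced2D(3)[of _ d A] by fastforce
  have "\<H> \<union> \<L> \<noteq> {}" using minimal_coreD(1)[OF core, of "{}"] unfolding separates_def by auto
  then obtain A where A: "A \<in> \<H> \<union> \<L>" by auto
  show "\<exists>A\<in>\<H> \<union> \<L>. lam a (\<Union>A) A \<le> 2"
  proof (rule bexI[OF _ A])
    obtain m where m: "a \<le> m" "balanced2 m d A" using F[OF A] by blast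
    note b = balanced2D[OF m(2)]
    obtain f where f: "f \<in> A" using ne[OF A] by auto
    have "{} \<noteq> A" using f by auto
    then have "lam a (\<Union>A) A \<le> lam a f {}"
      using f b(2)[OF f] by (intro balanced2_lam(1)[OF m(2) a0 m(1) d0 d(2)]) auto
    then show "lam a (\<Union>A) A \<le> 2" using b(2)[OF f] by (simp add: lam_def)
  qed
  show "\<Union>(\<H> \<union> \<L>) \<subseteq> all_edges n" by (rule n)
  show "card (\<Union>A) \<le> v0 + e0 * v0" if "A \<in> \<H> \<union> \<L>" for A using v0[OF that] by simp
  show "A \<noteq> {}" if "A \<in> \<H> \<union> \<L>" for A using ne[OF that] .
  show "\<exists>e\<in>A. \<exists>f\<in>A. e \<noteq> f \<and> x \<in> e \<and> x \<in> f" if "A \<in> \<H> \<union> \<L>" "x \<in> \<Union>A" for A x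
  proof -
    have "\<exists>m\<ge>a. balanced2 m d A" by (rule F[OF that(1)])
    then obtain m where m: "a \<le> m" "balanced2 m d A" by blast
    show ?thesis using balanced2_degree[OF m(2) _ d0 that(2)] m(1) a by simp
  qed
  show "\<exists>B\<in>\<H> \<union> \<L>. A \<inter> B = {e}" if "A \<in> \<H> \<union> \<L>" "e \<in> A" for A e
    using that cl[of A e] cr[of A e] by blast
  show "X = \<Union>(\<H> \<union> \<L>)" if "X \<subseteq> \<Union>(\<H> \<union> \<L>)" "X \<noteq> {}" "\<And>A. A \<in> \<H> \<union> \<L> \<Longrightarrow> A \<inter> X \<noteq> {} \<Longrightarrow> A \<subseteq> X" for X
    using minimal_core_connected[OF core that] .
  show "\<exists>T. degenerate_step (\<H> \<union> \<L>) a d (v0 + e0 * v0) X T \<or> regular_step (\<H> \<union> \<L>) a (v0 + e0 * v0) X e T"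
    if X: "X \<subseteq> \<Union>(\<H> \<union> \<L>)" and A: "A \<in> \<H> \<union> \<L>" "\<not> A \<subseteq> X" "e \<in> A" "e \<in> X" for X A e
  proof -
    have fX: "finite X" using X n finite_all_edges by (meson finite_subset)
    have X2: "card f = 2" if "f \<in> X" for f
    proof -
      have "f \<in> all_edges n" using that X n by blast
      then show ?thesis by (simp add: all_edges_def)
    qed
    show ?thesis
    proof (cases "A \<in> \<L>")
      case True
      show ?thesis by (rule attach_sym[OF F _ _ v0 e0 cr a d0 d(2) fX X2 True A(2-4)]) auto
    next
      case False
      then have "A \<in> \<H>" using A(1) by simp
      then show ?thesis by (intro attach_sym[OF F _ _ v0 e0 cl a d0 d(2) fX X2 _ A(2-4)]) auto
    qed
  qed
  show "0 \<le> d" by (rule d0)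
qed

section \<open>Densities of graphs\<close>

lemma subgraphD:
  assumes "subgraph J G"
  shows "simple_graph J" "verts J \<subseteq> verts G" "edges J \<subseteq> edges G" "finite (verts J)"
    "\<And>e. e \<in> edges J \<Longrightarrow> e \<subseteq> verts J" "\<And>e. e \<in> edges J \<Longrightarrow> card e = 2"
  using assms by (auto simp: subgraph_def simple_graph_def)

lemma simple_finite_edges: "simple_graph G \<Longrightarrow> finite (edges G)"
  unfolding simple_graph_def by (meson Pow_iff finite_Pow_iff finite_subset subsetI)

lemma subgraph_refl: "simple_graph G \<Longrightarrow> subgraph G G"
  by (simp add: subgraph_def)

lemma subgraph_trans: "subgraph J H \<Longrightarrow> subgraph H G \<Longrightarrow> subgraph J G"
  by (auto simp: subgraph_def)

lemma subgraph_pair: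
  assumes "simple_graph G" "W \<subseteq> verts G" "B \<subseteq> edges G" "\<Union>B \<subseteq> W"
  shows "subgraph (W, B) G"
  using assms finite_subset by (auto simp: subgraph_def simple_graph_def)

lemma finite_subgraphs: "simple_graph G \<Longrightarrow> finite {J. subgraph J G}"
proof (rule finite_subset)
  show "{J. subgraph J G} \<subseteq> Pow (verts G) \<times> Pow (edges G)"
    unfolding subgraph_def by (auto simp: mem_Times_iff)
  show "simple_graph G \<Longrightarrow> finite (Pow (verts G) \<times> Pow (edges G))"
    using simple_finite_edges by (auto simp: simple_graph_def)
qed

lemma finite_subgraph_values: "simple_graph G \<Longrightarrow> finite {f J | J. subgraph J G \<and> P J}"
proof -
  assume "simple_graph G"
  then have "finite (f ` {J. subgraph J G})" by (intro finite_imageI finite_subgraphs)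
  then show ?thesis by (rule finite_subset[rotated]) auto
qed

lemma minimal_subgraph:
  assumes "simple_graph H" "P H"
  obtains J where "subgraph J H" "P J" "\<And>J'. proper_subgraph J' J \<Longrightarrow> \<not> P J'"
proof -
  obtain J where J: "subgraph J H \<and> P J" and Jmin: "\<And>K. subgraph K H \<and> P K \<Longrightarrow> nv J + ne J \<le> nv K + ne K"
    using ex_has_least_nat[of "\<lambda>J. subgraph J H \<and> P J" H "\<lambda>J. nv J + ne J"] assms subgraph_refl by blast
  have "\<not> P J'" if J': "proper_subgraph J' J" for J'
  proof
    assume "P J'"
    have sub: "subgraph J' J" "J' \<noteq> J" using J' by (auto simp: proper_subgraph_def)
    then have "nv J + ne J \<le> nv J' + ne J'" using Jmin[of J'] \<open>P J'\<close> J subgraph_trans by blast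
    moreover have f: "finite (verts J)" "finite (edges J)"
      using J subgraphD(4) simple_finite_edges subgraphD(1) by blast+
    moreover have "nv J' \<le> nv J" "ne J' \<le> ne J"
      using sub f by (auto simp: subgraph_def intro: card_mono)
    ultimately have "nv J' = nv J" "ne J' = ne J" by linarith+
    then have "verts J' = verts J" "edges J' = edges J"
      using card_subset_eq[OF f(1) subgraphD(2)[OF sub(1)]] card_subset_eq[OF f(2) subgraphD(3)[OF sub(1)]] by simp_all
    then show False using sub(2) by (simp add: prod_eq_iff)
  qed
  then show thesis using that J by blast
qed

lemma m2_Max:
  assumes "simple_graph H" "edges H \<noteq> {}" "3 \<le> nv H"
  shows "\<And>J. subgraph J H \<Longrightarrow> 3 \<le> nv J \<Longrightarrow> (real (ne J) - 1) / (real (nv J) - 2) \<le> m2 H"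
    and "\<exists>J. subgraph J H \<and> 3 \<le> nv J \<and> m2 H = (real (ne J) - 1) / (real (nv J) - 2)"
proof -
  let ?S = "{(real (ne J) - 1) / (real (nv J) - 2) | J. subgraph J H \<and> nv J \<ge> 3}"
  have eq: "m2 H = Max ?S" using assms by (simp add: m2_def)
  have fin: "finite ?S" by (rule finite_subgraph_values[OF assms(1)])
  have ne: "?S \<noteq> {}" using assms subgraph_refl by blast
  show "(real (ne J) - 1) / (real (nv J) - 2) \<le> m2 H" if "subgraph J H" "3 \<le> nv J" for J
    unfolding eq using that by (intro Max_ge[OF fin] CollectI exI[of _ J]) simp
  show "\<exists>J. subgraph J H \<and> 3 \<le> nv J \<and> m2 H = (real (ne J) - 1) / (real (nv J) - 2)"
    using Max_in[OF fin ne] unfolding eq[symmetric] by auto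
qed

lemma m2_gt_half:
  assumes "1 / 2 < m2 H"
  shows "edges H \<noteq> {}" "3 \<le> nv H"
  using assms by (auto simp: m2_def split: if_splits)

text \<open>The bound \<open>1 / 2\<close> matters: an edge with an isolated vertex has value 0,
  although its subgraph K2 has value \<open>1 / 2\<close>.\<close>

lemma m2_mono:
  assumes H: "simple_graph H" "1 / 2 < m2 H" and J: "subgraph J H"
  shows "m2 J \<le> m2 H"
proof (cases "1 / 2 < m2 J")
  case True
  obtain K where K: "subgraph K J" "3 \<le> nv K" "m2 J = (real (ne K) - 1) / (real (nv K) - 2)"
    using m2_Max(2)[OF subgraphD(1)[OF J] m2_gt_half[OF True]] by blast
  then show ?thesis using m2_Max(1)[OF H(1) m2_gt_half[OF H(2)]] subgraph_trans[OF K(1) J] by simp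
qed (use H in linarith)

lemma m2_asym_Max:
  assumes "simple_graph H" "2 \<le> nv H"
  shows "\<And>J. subgraph J H \<Longrightarrow> 2 \<le> nv J \<Longrightarrow> real (ne J) / (real (nv J) - 2 + 1 / m2_fam L) \<le> m2_asym H L"
    and "\<exists>J. subgraph J H \<and> 2 \<le> nv J \<and> m2_asym H L = real (ne J) / (real (nv J) - 2 + 1 / m2_fam L)"
proof -
  let ?S = "{real (ne J) / (real (nv J) - 2 + 1 / m2_fam L) | J. subgraph J H \<and> nv J \<ge> 2}"
  have eq: "m2_asym H L = Max ?S" using assms by (simp add: m2_asym_def)
  have fin: "finite ?S" by (rule finite_subgraph_values[OF assms(1)])
  have ne: "?S \<noteq> {}" using assms subgraph_refl by blast
  show "real (ne J) / (real (nv J) - 2 + 1 / m2_fam L) \<le> m2_asym H L" if "subgraph J H" "2 \<le> nv J" for J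
    unfolding eq using that by (intro Max_ge[OF fin] CollectI exI[of _ J]) simp
  show "\<exists>J. subgraph J H \<and> 2 \<le> nv J \<and> m2_asym H L = real (ne J) / (real (nv J) - 2 + 1 / m2_fam L)"
    using Max_in[OF fin ne] unfolding eq[symmetric] by auto
qed

lemma m2_asym_mono:
  assumes H: "simple_graph H" "0 < m2_asym H L" and J: "subgraph J H"
  shows "m2_asym J L \<le> m2_asym H L"
proof (cases "2 \<le> nv J")
  case True
  obtain K where K: "subgraph K J" "2 \<le> nv K" "m2_asym J L = real (ne K) / (real (nv K) - 2 + 1 / m2_fam L)"
    using m2_asym_Max(2)[OF subgraphD(1)[OF J] True] by blast
  have "2 \<le> nv H" using H(2) by (auto simp: m2_asym_def split: if_splits)
  then show ?thesis using m2_asym_Max(1)[OF H(1)] subgraph_trans[OF K(1) J] K by simp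
qed (use H in \<open>simp add: m2_asym_def\<close>)

lemma max_density_gt:
  assumes "simple_graph G" "0 \<le> a" "a < max_density G"
  obtains J where "subgraph J G" "a * real (nv J) < real (ne J)"
proof -
  let ?S = "{real (ne J) / real (nv J) | J. subgraph J G \<and> nv J \<ge> 1}"
  have nG: "nv G \<noteq> 0" using assms by (auto simp: max_density_def split: if_splits)
  then have eq: "max_density G = Max ?S" by (simp add: max_density_def)
  have fin: "finite ?S" by (rule finite_subgraph_values[OF assms(1)])
  have "real (ne G) / real (nv G) \<in> ?S"
    using nG subgraph_refl[OF assms(1)] by (intro CollectI exI[of _ G]) (simp add: Suc_le_eq)
  then have "?S \<noteq> {}" by blast
  then have "max_density G \<in> ?S" unfolding eq by (rule Max_in[OF fin])
  then obtain J where J: "subgraph J G" "1 \<le> nv J" "max_density G = real (ne J) / real (nv J)" by blast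
  then have "a * real (nv J) < real (ne J)" using assms(3) by (simp add: pos_less_divide_eq)
  then show thesis using that J by blast
qed

lemma max_density_le:
  assumes G: "simple_graph G" and le: "max_density G \<le> a" and a: "0 \<le> a" and J: "subgraph J G"
  shows "real (ne J) \<le> a * real (nv J)"
proof (cases "nv J = 0")
  case True
  then have "verts J = {}" using subgraphD(4)[OF J] by simp
  then have "edges J = {}" using subgraphD(5,6)[OF J] by fastforce
  then show ?thesis using a by simp
next
  case False
  let ?S = "{real (ne J) / real (nv J) | J. subgraph J G \<and> nv J \<ge> 1}"
  have "nv J \<le> nv G" using J G by (auto simp: subgraph_def simple_graph_def intro: card_mono)
  then have eq: "max_density G = Max ?S" using False by (simp add: max_density_def)
  have fin: "finite ?S" by (rule finite_subgraph_values[OF G])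
  have "real (ne J) / real (nv J) \<in> ?S" using J False by (intro CollectI exI[of _ J]) (simp add: Suc_le_eq)
  then have "real (ne J) / real (nv J) \<le> max_density G" unfolding eq by (rule Max_ge[OF fin])
  then have "real (ne J) / real (nv J) \<le> a" using le by linarith
  then show ?thesis using False by (simp add: pos_divide_le_eq)
qed

text \<open>Strictness forces the maximum to be attained by \<open>L\<close> itself. An isolated
  vertex could be dropped without losing edges, which would give a proper subgraph that is too
  dense; and \<open>m2 L > 1\<close> yields more than \<open>nv L - 1\<close> edges.\<close>

lemma strictly_2_balanced_facts:
  assumes L: "simple_graph L" "strictly_2_balanced L" "1 < m2 L"
  shows "\<Union>(edges L) = verts L" "3 \<le> nv L" "3 \<le> ne L" "(real (ne L) - 1) / m2 L = real (nv L) - 2"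
    and "\<And>J. proper_subgraph J L \<Longrightarrow> 3 \<le> nv J \<Longrightarrow> (real (ne J) - 1) / m2 L < real (nv J) - 2"
proof -
  have half: "1 / 2 < m2 L" using L(3) by simp
  note h = m2_gt_half[OF half]
  note M = m2_Max[OF L(1) h]
  have strict: "(real (ne J) - 1) / (real (nv J) - 2) < m2 L" if J: "proper_subgraph J L" "3 \<le> nv J" for J
  proof (cases "edges J = {}")
    case True
    then have "(real (ne J) - 1) / (real (nv J) - 2) \<le> 0" using J(2) by (simp add: divide_nonpos_pos)
    then show ?thesis using L(3) by linarith
  next
    case False
    have s: "subgraph J L" "simple_graph J" using J by (auto simp: proper_subgraph_def subgraph_def)
    have "(real (ne J) - 1) / (real (nv J) - 2) \<le> m2 J"
      using m2_Max(1)[OF s(2) False J(2) subgraph_refl[OF s(2)] J(2)] .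
    also have "m2 J < m2 L" using L(2) J(1) unfolding strictly_2_balanced_def by blast
    finally show ?thesis .
  qed
  obtain J where J: "subgraph J L" "3 \<le> nv J" "m2 L = (real (ne J) - 1) / (real (nv J) - 2)" using M(2) by blast
  have "J = L" using strict[of J] J by (auto simp: proper_subgraph_def)
  then have tot: "m2 L = (real (ne L) - 1) / (real (nv L) - 2)" using J by simp
  have m0: "0 < m2 L" using L(3) by simp
  have v0: "0 < real (nv L) - 2" using h(2) by simp
  show t: "(real (ne L) - 1) / m2 L = real (nv L) - 2"
    using tot m0 v0 by (simp add: field_simps)
  show "3 \<le> nv L" by (rule h(2))
  have "1 * (real (nv L) - 2) < m2 L * (real (nv L) - 2)" using L(3) v0 by (intro mult_strict_right_mono) auto
  then have gt: "real (nv L) - 2 < real (ne L) - 1" using t m0 by (simp add: field_simps)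
  then show "3 \<le> ne L" using h(2) by linarith
  show pj: "(real (ne J) - 1) / m2 L < real (nv J) - 2" if J: "proper_subgraph J L" "3 \<le> nv J" for J
    using strict[OF J] J(2) m0 by (simp add: field_simps)
  show "\<Union>(edges L) = verts L"
  proof (rule ccontr)
    assume ne: "\<Union>(edges L) \<noteq> verts L"
    have sub: "\<Union>(edges L) \<subseteq> verts L" using L(1) by (auto simp: simple_graph_def)
    let ?J = "(\<Union>(edges L), edges L)"
    have sJ: "subgraph ?J L" using L(1) sub by (intro subgraph_pair) auto
    then have pJ: "proper_subgraph ?J L" using ne by (metis fst_conv proper_subgraph_def)
    have fL: "finite (verts L)" using L(1) by (simp add: simple_graph_def)
    have "card (\<Union>(edges L)) < nv L" using sub ne fL by (intro psubset_card_mono) auto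
    moreover have "3 \<le> card (\<Union>(edges L))"
    proof (rule ccontr)
      assume "\<not> ?thesis"
      then have le: "card (\<Union>(edges L)) \<le> 2" by simp
      have fU: "finite (\<Union>(edges L))" using sub fL finite_subset by blast
      have "e = \<Union>(edges L)" if "e \<in> edges L" for e
        using that L(1) le fU card_mono[OF fU, of e] by (intro card_subset_eq) (auto simp: simple_graph_def)
      then have "edges L \<subseteq> {\<Union>(edges L)}" by blast
      then have "ne L \<le> 1" using card_mono[of "{\<Union>(edges L)}" "edges L"] by simp
      then show False using \<open>3 \<le> ne L\<close> by simp
    qed
    ultimately show False using pj[OF pJ] t by simp
  qed
qed

text \<open>There are finitely many proper subgraphs, so the strict inequalities leave a common gap
  \<open>d\<close>.\<close>

lemma strictly_2_balanced_edges:
  assumes L: "simple_graph L" "strictly_2_balanced L" "1 < m2 L"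
  obtains d where "0 < d" "\<And>d'. d' \<le> d \<Longrightarrow> balanced2 (m2 L) d' (edges L)"
proof -
  note f = strictly_2_balanced_facts[OF L]
  define Z where "Z = {(real (nv J) - 2) - (real (ne J) - 1) / m2 L | J. subgraph J L \<and> (J \<noteq> L \<and> 3 \<le> nv J)}"
  have "finite Z" unfolding Z_def by (rule finite_subgraph_values[OF L(1)])
  moreover have "0 < z" if "z \<in> Z" for z using that f(5) by (auto simp: Z_def proper_subgraph_def)
  ultimately obtain d where d: "0 < d" "\<And>z. z \<in> Z \<Longrightarrow> d \<le> z" using finite_pos_lower_bound by metis
  show thesis
  proof (rule that[OF d(1)])
    fix d' assume d': "d' \<le> d"
    show "balanced2 (m2 L) d' (edges L)"
      unfolding balanced2_def f(1)
    proof (intro conjI allI impI)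
      fix W B assume W: "W \<subseteq> verts L" "B \<subseteq> edges L" "\<Union>B \<subseteq> W" "3 \<le> card W" "B \<noteq> edges L"
      have "subgraph (W, B) L" using W L(1) by (intro subgraph_pair)
      moreover have "(W, B) \<noteq> L" using W(5) by auto
      ultimately have "(real (card W) - 2) - (real (card B) - 1) / m2 L \<in> Z"
        unfolding Z_def using W(4) by (intro CollectI exI[of _ "(W, B)"]) auto
      from d(2)[OF this] show "(real (card B) - 1) / m2 L + d' \<le> real (card W) - 2" using d' by linarith
    qed (use f L(1) simple_finite_edges in \<open>auto simp: simple_graph_def\<close>)
  qed
qed

text \<open>The family minimum \<open>a\<close> may lie below the density of \<open>H\<close>.
  Passing from that density to \<open>a\<close> makes edges heavier in the weight, and a proper
  subgraph has no more edges than \<open>H\<close>, so the gap only widens.\<close>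

lemma strictly_asym_balanced_edges:
  assumes H: "simple_graph H" "strictly_asym_balanced L H" "3 \<le> nv H" "edges H \<noteq> {}"
    and l: "0 < m2_fam L" and a: "0 < a" "a \<le> m2_asym H L"
  obtains d where "0 < d" "\<And>d'. d' \<le> d \<Longrightarrow> balanced_asym a (m2_fam L) d' (edges H)" "\<Union>(edges H) = verts H"
proof -
  let ?l = "m2_fam L" and ?b = "m2_asym H L"
  have v2: "2 \<le> nv H" using H(3) by simp
  note M = m2_asym_Max(2)[OF H(1) v2, of L]
  have l1: "0 < 1 / ?l" using l by simp
  have b0: "0 < ?b" using a by simp
  have strict: "real (ne J) / (real (nv J) - 2 + 1 / ?l) < ?b" if J: "proper_subgraph J H" "2 \<le> nv J" for J
  proof -
    have s: "simple_graph J" using J by (auto simp: proper_subgraph_def subgraph_def)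
    have "real (ne J) / (real (nv J) - 2 + 1 / ?l) \<le> m2_asym J L"
      using m2_asym_Max(1)[OF s J(2) subgraph_refl[OF s] J(2)] .
    also have "\<dots> < ?b" using H(2) J(1) unfolding strictly_asym_balanced_def by blast
    finally show ?thesis .
  qed
  have pj: "real (ne J) / ?b < real (nv J) - 2 + 1 / ?l" if J: "proper_subgraph J H" "2 \<le> nv J" for J
  proof -
    have "0 < real (nv J) - 2 + 1 / ?l" using J(2) l1 by linarith
    then show ?thesis using strict[OF J] b0 by (simp add: pos_divide_less_eq mult.commute)
  qed
  obtain J where J: "subgraph J H" "2 \<le> nv J" "?b = real (ne J) / (real (nv J) - 2 + 1 / ?l)" using M by blast
  have "J = H" using strict[of J] J by (auto simp: proper_subgraph_def)
  then have tot: "?b = real (ne H) / (real (nv H) - 2 + 1 / ?l)" using J by simp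
  have w0: "0 < real (nv H) - 2 + 1 / ?l" using H(3) l1 by linarith
  have t: "real (ne H) / ?b = real (nv H) - 2 + 1 / ?l"
  proof -
    have "?b * (real (nv H) - 2 + 1 / ?l) = real (ne H)" using tot w0 by (metis less_irrefl nonzero_eq_divide_eq)
    then show ?thesis using b0 by (metis less_irrefl nonzero_mult_div_cancel_left)
  qed
  have U: "\<Union>(edges H) = verts H"
  proof (rule ccontr)
    assume ne: "\<Union>(edges H) \<noteq> verts H"
    have sub: "\<Union>(edges H) \<subseteq> verts H" using H(1) by (auto simp: simple_graph_def)
    let ?J = "(\<Union>(edges H), edges H)"
    have sJ: "subgraph ?J H" using H(1) sub by (intro subgraph_pair) auto
    then have pJ: "proper_subgraph ?J H" using ne by (metis fst_conv proper_subgraph_def)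
    have fH: "finite (verts H)" using H(1) by (simp add: simple_graph_def)
    have "card (\<Union>(edges H)) < nv H" using sub ne fH by (intro psubset_card_mono) auto
    moreover have "2 \<le> card (\<Union>(edges H))"
    proof -
      obtain e where e: "e \<in> edges H" using H(4) by auto
      have "card e \<le> card (\<Union>(edges H))" using e sub fH finite_subset by (intro card_mono) auto
      then show ?thesis using e H(1) by (auto simp: simple_graph_def)
    qed
    ultimately show False using pj[OF pJ] t by simp
  qed
  define Z where "Z = {(real (nv J) - 2 + 1 / ?l) - real (ne J) / ?b | J. subgraph J H \<and> (J \<noteq> H \<and> 2 \<le> nv J)}"
  have "finite Z" unfolding Z_def by (rule finite_subgraph_values[OF H(1)])
  moreover have "0 < z" if "z \<in> Z" for z using that pj by (auto simp: Z_def proper_subgraph_def)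
  ultimately obtain d where d: "0 < d" "\<And>z. z \<in> Z \<Longrightarrow> d \<le> z" using finite_pos_lower_bound by metis
  have ib: "1 / ?b \<le> 1 / a" using a by (intro divide_left_mono) auto
  show thesis
  proof (rule that[OF d(1) _ U])
    fix d' assume d': "d' \<le> d"
    show "balanced_asym a ?l d' (edges H)"
      unfolding balanced_asym_def U
    proof (intro conjI allI impI)
      have "real (ne H) * (1 / ?b) \<le> real (ne H) * (1 / a)" using ib by (intro mult_left_mono) auto
      then show "lam a (verts H) (edges H) \<le> 2 - 1 / ?l" using t by (simp add: lam_def)
      fix W B assume W: "W \<subseteq> verts H" "B \<subseteq> edges H" "\<Union>B \<subseteq> W" "2 \<le> card W" "B \<noteq> edges H"
      have "subgraph (W, B) H" using W H(1) by (intro subgraph_pair)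
      moreover have "(W, B) \<noteq> H" using W(5) by auto
      ultimately have "(real (card W) - 2 + 1 / ?l) - real (card B) / ?b \<in> Z"
        unfolding Z_def using W(4) by (intro CollectI exI[of _ "(W, B)"]) auto
      from d(2)[OF this] have le: "real (card B) / ?b + d' \<le> real (card W) - 2 + 1 / ?l" using d' by linarith
      have "card B \<le> ne H" using W H(1) simple_finite_edges by (intro card_mono) auto
      then have "(real (ne H) - real (card B)) * (1 / ?b) \<le> (real (ne H) - real (card B)) * (1 / a)"
        using ib by (intro mult_left_mono) auto
      then show "lam a (verts H) (edges H) \<le> lam a W B - d'"
        using le t by (simp add: lam_def diff_divide_distrib)
    qed (use H simple_finite_edges in \<open>auto simp: simple_graph_def\<close>)
  qed
qed

section \<open>Invariance of balancedness under injective relabelling\<close>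

lemma transport_sub:
  fixes f :: "'a \<Rightarrow> 'b"
  assumes f: "inj_on f (\<Union>A)" and W: "W \<subseteq> \<Union>((`) f ` A)" "B \<subseteq> (`) f ` A" "\<Union>B \<subseteq> W" and fin: "finite (\<Union>A)" "finite A"
  obtains W0 B0 where "W0 \<subseteq> \<Union>A" "B0 \<subseteq> A" "\<Union>B0 \<subseteq> W0" "card W0 = card W" "card B0 = card B" "B \<noteq> (`) f ` A \<Longrightarrow> B0 \<noteq> A"
proof -
  let ?W = "{x \<in> \<Union>A. f x \<in> W}" and ?B = "{e \<in> A. f ` e \<in> B}"
  have inj: "inj_on ((`) f) A" using f by (intro inj_on_subset[OF inj_on_image_Pow[OF f]]) auto
  have "\<Union>((`) f ` A) = f ` \<Union>A" by auto
  then have eW: "f ` ?W = W" using W(1) by blast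
  have eB: "(`) f ` ?B = B" using W(2) by blast
  have "card ?W = card W" using card_image[of f ?W] f eW by (metis (no_types, lifting) inj_on_subset mem_Collect_eq subsetI)
  moreover have "card ?B = card B" using card_image[of "(`) f" ?B] inj eB by (metis (no_types, lifting) inj_on_subset mem_Collect_eq subsetI)
  moreover have "\<Union>?B \<subseteq> ?W" using W(3) by blast
  moreover have "?B \<noteq> A" if "B \<noteq> (`) f ` A" using that eB by metis
  ultimately show thesis using that[of ?W ?B] by blast
qed

lemma transport_card:
  assumes f: "inj_on f (\<Union>A)"
  shows "card ((`) f ` A) = card A" "card (\<Union>((`) f ` A)) = card (\<Union>A)" "\<And>e. e \<in> A \<Longrightarrow> card (f ` e) = card e"
proof -
  have "inj_on ((`) f) A" by (intro inj_on_subset[OF inj_on_image_Pow[OF f]]) auto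
  then show "card ((`) f ` A) = card A" by (rule card_image)
  have "\<Union>((`) f ` A) = f ` \<Union>A" by auto
  then show "card (\<Union>((`) f ` A)) = card (\<Union>A)" using card_image[OF f] by simp
  show "card (f ` e) = card e" if "e \<in> A" for e
    using that f by (intro card_image) (meson Union_upper inj_on_subset)
qed

lemma balanced2_image:
  assumes A: "balanced2 m d A" and f: "inj_on f (\<Union>A)"
  shows "balanced2 m d ((`) f ` A)"
proof -
  note b = balanced2D[OF A] and c = transport_card[OF f]
  have fin: "finite (\<Union>A)" using b by (intro finite_Union_edges) auto
  show ?thesis
    unfolding balanced2_def c
  proof (intro conjI allI impI)
    fix W B assume W: "W \<subseteq> \<Union>((`) f ` A)" "B \<subseteq> (`) f ` A" "\<Union>B \<subseteq> W" "3 \<le> card W" "B \<noteq> (`) f ` A"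
    obtain W0 B0 where "W0 \<subseteq> \<Union>A" "B0 \<subseteq> A" "\<Union>B0 \<subseteq> W0" "card W0 = card W" "card B0 = card B" "B0 \<noteq> A"
      using transport_sub[OF f W(1-3) fin b(1)] W(5) by metis
    then show "(real (card B) - 1) / m + d \<le> real (card W) - 2" using b(6)[of W0 B0] W(4) by simp
  qed (use b c in auto)
qed

lemma balanced_asym_image:
  assumes A: "balanced_asym a l d A" and f: "inj_on f (\<Union>A)"
  shows "balanced_asym a l d ((`) f ` A)"
proof -
  note b = balanced_asymD[OF A] and c = transport_card[OF f]
  have fin: "finite (\<Union>A)" using b by (intro finite_Union_edges) auto
  show ?thesis
    unfolding balanced_asym_def c lam_def
  proof (intro conjI allI impI)
    fix W B assume W: "W \<subseteq> \<Union>((`) f ` A)" "B \<subseteq> (`) f ` A" "\<Union>B \<subseteq> W" "2 \<le> card W" "B \<noteq> (`) f ` A"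
    obtain W0 B0 where "W0 \<subseteq> \<Union>A" "B0 \<subseteq> A" "\<Union>B0 \<subseteq> W0" "card W0 = card W" "card B0 = card B" "B0 \<noteq> A"
      using transport_sub[OF f W(1-3) fin b(1)] W(5) by metis
    then show "real (card (\<Union>A)) - real (card A) / a \<le> real (card W) - real (card B) / a - d"
      using b(5)[of W0 B0] W(4) by (simp add: lam_def)
  qed (use b c in \<open>auto simp: lam_def\<close>)
qed

section \<open>The 0-statement for families of graphs\<close>

text \<open>Copies are recorded by their edge sets, as colourings see only edges. For graphs without
  isolated vertices the vertex set is recovered as the union of the edges.\<close>

definition copies :: "graph set \<Rightarrow> graph \<Rightarrow> nat set set set" where
  "copies F G = {(`) f ` edges H | H f. H \<in> F \<and> inj_on f (verts H) \<and> f ` verts H \<subseteq> verts G \<and> (\<forall>e\<in>edges H. f ` e \<in> edges G)}"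

lemma copies_subset: "A \<in> copies F G \<Longrightarrow> A \<subseteq> edges G"
  by (auto simp: copies_def)

lemma ramsey_not_separates:
  assumes "ramsey_for G [FH, FL]"
  shows "\<not> separates (copies FH G) (copies FL G) W"
proof
  assume sep: "separates (copies FH G) (copies FL G) W"
  define col where "col = (\<lambda>e :: nat set. if e \<in> W then 0 else 1 :: nat)"
  have "\<forall>e\<in>edges G. col e < length [FH, FL]" by (simp add: col_def)
  then obtain i H where i: "i < length [FH, FL]" "H \<in> [FH, FL] ! i" "has_coloured_copy G col i H"
    using assms unfolding ramsey_for_def by blast
  then obtain f where f: "inj_on f (verts H)" "f ` verts H \<subseteq> verts G" "\<And>e. e \<in> edges H \<Longrightarrow> f ` e \<in> edges G"
    "\<And>e. e \<in> edges H \<Longrightarrow> col (f ` e) = i" unfolding has_coloured_copy_def by blast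
  have copy: "(`) f ` edges H \<in> copies F G" if "H \<in> F" for F
    using f that unfolding copies_def by blast
  consider "i = 0" | "i = 1" using i(1) by force
  then show False
  proof cases
    case 1
    have "f ` e \<in> W" if "e \<in> edges H" for e
      using f(4)[OF that] 1 unfolding col_def by (cases "f ` e \<in> W") simp_all
    then have "(`) f ` edges H \<subseteq> W" by blast
    moreover have "(`) f ` edges H \<in> copies FH G" using i(2) 1 by (intro copy) simp
    ultimately show False using sep unfolding separates_def by blast
  next
    case 2
    have "f ` e \<notin> W" if "e \<in> edges H" for e
      using f(4)[OF that] 2 unfolding col_def by (cases "f ` e \<in> W") simp_all
    then have "(`) f ` edges H \<inter> W = {}" by blast
    moreover have "(`) f ` edges H \<in> copies FL G" using i(2) 2 by (intro copy) simp
    ultimately show False using sep unfolding separates_def by blast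
  qed
qed

lemma core_ramsey:
  assumes sub: "\<H> \<subseteq> copies FH G" "\<L> \<subseteq> copies FL G" and nsep: "\<And>W. \<not> separates \<H> \<L> W"
    and U: "\<And>H. H \<in> FH \<union> FL \<Longrightarrow> \<Union>(edges H) = verts H"
  shows "ramsey_for (\<Union>(\<Union>(\<H> \<union> \<L>)), \<Union>(\<H> \<union> \<L>)) [FH, FL]"
  unfolding ramsey_for_def
proof (intro allI impI)
  let ?K = "\<Union>(\<H> \<union> \<L>)"
  let ?G = "(\<Union>?K, ?K)"
  fix col assume col: "\<forall>e\<in>edges ?G. col e < length [FH, FL]"
  have copy: "\<exists>H\<in>F. has_coloured_copy ?G col i H"
    if A: "A \<in> copies F G" "A \<subseteq> ?K" "\<And>e. e \<in> A \<Longrightarrow> col e = i" and F: "F \<subseteq> FH \<union> FL" for A F i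
  proof -
    obtain H f where h: "A = (`) f ` edges H" "H \<in> F" "inj_on f (verts H)" using A(1) unfolding copies_def by blast
    \<comment> \<open>Without isolated vertices, a copy lives on the vertices spanned by the edges
      of the core.\<close>
    have "f ` verts H = \<Union>A" using U[of H] h(2) F unfolding h(1) by (metis image_Union subsetD)
    then have "f ` verts H \<subseteq> \<Union>?K" using A(2) by blast
    then show ?thesis using h A(2,3) unfolding has_coloured_copy_def by (intro bexI[of _ H] exI[of _ f]) auto
  qed
  have "\<not> separates \<H> \<L> {e. col e = 0}" by (rule nsep)
  then consider A where "A \<in> \<H>" "A \<subseteq> {e. col e = 0}" | A where "A \<in> \<L>" "A \<inter> {e. col e = 0} = {}"
    unfolding separates_def by blast
  then show "\<exists>i<length [FH, FL]. \<exists>H\<in>[FH, FL] ! i. has_coloured_copy ?G col i H"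
  proof cases
    case (1 A)
    then have "\<exists>H\<in>FH. has_coloured_copy ?G col 0 H" using sub by (intro copy[of A]) auto
    then show ?thesis by (intro exI[of _ 0]) simp
  next
    case (2 A)
    have "col e = 1" if "e \<in> A" for e
    proof -
      have "e \<in> ?K" using that 2(1) by blast
      then have "col e < 2" using bspec[OF col, of e] by simp
      moreover have "e \<notin> {e. col e = 0}" using that 2(2) by (metis IntI empty_iff)
      then have "col e \<noteq> 0" by simp
      ultimately show ?thesis by arith
    qed
    moreover have "A \<in> copies FL G" "A \<subseteq> ?K" using sub(2) 2(1) by blast+
    ultimately have "\<exists>H\<in>FL. has_coloured_copy ?G col 1 H" by (intro copy[of A]) simp_all
    then show ?thesis by (intro exI[of _ 1]) simp
  qed
qed

theorem zero_from_families:
  assumes a: "0 < a" and d: "0 < d" and U: "\<And>H. H \<in> FH \<union> FL \<Longrightarrow> \<Union>(edges H) = verts H"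
    and dense: "\<And>G. simple_graph G \<Longrightarrow> ramsey_for G [FH, FL] \<Longrightarrow> a < max_density G"
    and expl: "\<And>n G \<H> \<L>. edges G \<subseteq> all_edges n \<Longrightarrow> \<H> \<subseteq> copies FH G \<Longrightarrow> \<L> \<subseteq> copies FL G \<Longrightarrow> minimal_core \<H> \<L> \<Longrightarrow>
       exploration (\<H> \<union> \<L>) a d M n"
  shows "\<exists>c>0. \<forall>p :: nat \<Rightarrow> real. (\<forall>n. 0 \<le> p n \<and> p n \<le> 1) \<and> (\<forall>n\<ge>1. p n \<le> c * real n powr (- 1 / a)) \<longrightarrow>
     (\<lambda>n. measure_pmf.prob (Gnp n (p n)) {G. ramsey_for G [FH, FL]}) \<longlonglongrightarrow> 0"
proof -
  \<comment> \<open>After \<open>D\<close> degenerate steps the weight is at most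
    \<open>2 - d * D\<close>, hence at most -1.\<close>
  define D where "D = nat \<lceil>3 / d\<rceil>"
  have "3 / d \<le> real D" unfolding D_def by linarith
  then have dD: "3 \<le> d * real D" using d by (simp add: field_simps)
  have D1: "1 \<le> D"
  proof (rule ccontr)
    assume "\<not> 1 \<le> D"
    then have "D = 0" by simp
    then show False using dD by simp
  qed
  let ?N = "M * ((M + 1) * D + 1)"
  show ?thesis
  proof (rule zero_statement[OF a, where N = ?N and J = "2 * D" and M = M])
    fix n s :: nat and G :: graph
    assume n: "1 \<le> n" and s: "1 \<le> s" and G: "verts G = {1..n}" "edges G \<subseteq> all_edges n" "G \<in> {G. ramsey_for G [FH, FL]}"
    have fE: "finite (edges G)" using G(2) finite_all_edges finite_subset by blast
    have fin: "finite (copies F G)" for F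
    proof (rule finite_subset)
      show "copies F G \<subseteq> Pow (edges G)" by (intro subsetI PowI copies_subset)
    qed (use fE in simp)
    have nsep: "\<And>W. \<not> separates (copies FH G) (copies FL G) W" using ramsey_not_separates G(3) by blast
    obtain \<H> \<L> where c: "\<H> \<subseteq> copies FH G" "\<L> \<subseteq> copies FL G" "minimal_core \<H> \<L>"
      using minimal_core_exists[OF fin fin nsep] .
    interpret exploration "\<H> \<union> \<L>" a d M n by (rule expl[OF G(2) c])
    let ?K = "\<Union>(\<H> \<union> \<L>)"
    have KG: "?K \<subseteq> edges G" using c(1,2) copies_subset by blast
    from exploration_outcome[OF D1 s]
    show "(\<exists>S\<in>dense_sets n ?N a. S \<subseteq> edges G) \<or>
      (\<exists>t j X Q. reach n M t j X Q \<and> X \<subseteq> edges G \<and> j \<le> 2 * D \<and> t \<le> card X \<and>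
         (t = s \<and> lam a (\<Union>X) X \<le> 2 \<or> t \<le> s \<and> lam a (\<Union>X) X \<le> - 1))"
    proof
      assume small: "card (\<Union>?K) \<le> ?N"
      let ?G = "(\<Union>?K, ?K)"
      have fK: "finite (\<Union>?K)" by (rule fin_verts) simp
      have sG: "simple_graph ?G"
        unfolding simple_graph_def
      proof (intro conjI ballI)
        show "finite (verts ?G)" using fK by simp
        fix e assume e: "e \<in> edges ?G"
        then show "e \<subseteq> verts ?G" by auto
        have "e \<in> all_edges n" using e KG G(2) by auto
        then show "card e = 2" by (simp add: all_edges_def)
      qed
      have "a < max_density ?G"
        by (rule dense[OF sG core_ramsey[OF c(1,2) minimal_coreD(1)[OF c(3)] U]])
      then obtain J where J: "subgraph J ?G" "a * real (nv J) < real (ne J)"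
        using max_density_gt[OF sG] a by (metis less_imp_le)
      note j = subgraphD[OF J(1)]
      have UJ: "\<Union>(edges J) \<subseteq> verts J" using j(5) by blast
      have "card (\<Union>(edges J)) \<le> nv J" using UJ j(4) by (intro card_mono)
      then have "a * real (card (\<Union>(edges J))) \<le> a * real (nv J)" using a by (intro mult_left_mono) auto
      moreover have "card (\<Union>(edges J)) \<le> card (\<Union>?K)" using j(3) fK by (intro card_mono Union_mono) auto
      moreover have "edges J \<subseteq> edges G" using j(3) KG by (metis snd_conv subset_trans)
      ultimately have "edges J \<in> dense_sets n ?N a" using J(2) small G(2) unfolding dense_sets_def by auto
      then show ?thesis using \<open>edges J \<subseteq> edges G\<close> by blast
    next
      assume "\<exists>t j X Q. reach n M t j X Q \<and> X \<subseteq> ?K \<and> j \<le> 2 * D \<and> t \<le> card X \<and>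
         (t = s \<and> lam a (\<Union>X) X \<le> 2 \<or> t \<le> s \<and> lam a (\<Union>X) X \<le> 2 - d * real D)"
      then obtain t j X Q where h: "reach n M t j X Q" "X \<subseteq> ?K" "j \<le> 2 * D" "t \<le> card X"
         "t = s \<and> lam a (\<Union>X) X \<le> 2 \<or> t \<le> s \<and> lam a (\<Union>X) X \<le> 2 - d * real D" by blast
      have "X \<subseteq> edges G" using h(2) KG by (rule subset_trans)
      moreover have "t = s \<and> lam a (\<Union>X) X \<le> 2 \<or> t \<le> s \<and> lam a (\<Union>X) X \<le> - 1" using h(5) dD by linarith
      ultimately show ?thesis using h(1,3,4) by blast
    qed
  qed
qed

lemma uniform_bound:
  assumes "finite F" "\<And>x. x \<in> F \<Longrightarrow> \<exists>d>0. \<forall>d'\<le>d. P x (d' :: real)"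
  obtains d where "0 < d" "\<And>x d'. x \<in> F \<Longrightarrow> d' \<le> d \<Longrightarrow> P x d'"
proof -
  have "\<exists>f. \<forall>x\<in>F. 0 < f x \<and> (\<forall>d'\<le>f x. P x d')" using assms(2) by metis
  then obtain f where f: "\<And>x. x \<in> F \<Longrightarrow> 0 < f x" "\<And>x d'. x \<in> F \<Longrightarrow> d' \<le> f x \<Longrightarrow> P x d'" by blast
  obtain d where "0 < d" "\<And>z. z \<in> f ` F \<Longrightarrow> d \<le> z"
    using finite_pos_lower_bound[of "f ` F"] assms(1) f(1) by (metis (no_types, lifting) finite_imageI imageE)
  then show thesis using that[of d] f(2) by (meson imageI order_trans)
qed

lemma nat_bound: "finite F \<Longrightarrow> \<exists>N. \<forall>x\<in>F. f x \<le> (N :: nat)"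
  by (meson finite_imageI finite_nat_set_iff_bounded_le imageI)

lemma copies_card:
  assumes A: "A \<in> copies F G" and U: "\<And>H. H \<in> F \<Longrightarrow> \<Union>(edges H) = verts H"
  obtains H f where "H \<in> F" "A = (`) f ` edges H" "inj_on f (\<Union>(edges H))" "card (\<Union>A) = nv H" "card A = ne H"
proof -
  obtain H f where h: "A = (`) f ` edges H" "H \<in> F" "inj_on f (verts H)" using A unfolding copies_def by blast
  have inj: "inj_on f (\<Union>(edges H))" using h(3) U[OF h(2)] by simp
  show thesis using that[OF h(2,1) inj] transport_card[OF inj] h(1) U[OF h(2)] by simp
qed

lemma zero_asym:
  assumes FH: "graph_family FH" and FL: "graph_family FL" and bal: "strictly_balanced_pair FH FL"
    and l: "1 < m2_fam FL" and H3: "\<And>H. H \<in> FH \<Longrightarrow> 3 \<le> nv H \<and> edges H \<noteq> {}"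
    and a: "1 < a" "\<And>H. H \<in> FH \<Longrightarrow> a \<le> m2_asym H FL"
    and dense: "\<And>G. simple_graph G \<Longrightarrow> ramsey_for G [FH, FL] \<Longrightarrow> a < max_density G"
  shows "\<exists>c>0. \<forall>p :: nat \<Rightarrow> real. (\<forall>n. 0 \<le> p n \<and> p n \<le> 1) \<and> (\<forall>n\<ge>1. p n \<le> c * real n powr (- 1 / a)) \<longrightarrow>
     (\<lambda>n. measure_pmf.prob (Gnp n (p n)) {G. ramsey_for G [FH, FL]}) \<longlonglongrightarrow> 0"
proof -
  let ?l = "m2_fam FL"
  have l0: "0 < ?l" and a0: "0 < a" using l a by auto
  have m2L: "?l \<le> m2 L" if "L \<in> FL" for L
    using that FL unfolding m2_fam_def graph_family_def by (intro Min_le) auto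
  have fam: "simple_graph H" "strictly_asym_balanced FL H" "3 \<le> nv H" "edges H \<noteq> {}" "a \<le> m2_asym H FL" if "H \<in> FH" for H
    using that FH bal H3 a(2) unfolding graph_family_def strictly_balanced_pair_def by blast+
  have fal: "simple_graph L" "strictly_2_balanced L" "1 < m2 L" if "L \<in> FL" for L
    using that FL bal m2L[OF that] l unfolding graph_family_def strictly_balanced_pair_def by auto
  have UH: "\<Union>(edges H) = verts H" and dH: "\<exists>d>0. \<forall>d'\<le>d. balanced_asym a ?l d' (edges H)" if h: "H \<in> FH" for H
  proof -
    obtain d where d: "0 < d" "\<And>d'. d' \<le> d \<Longrightarrow> balanced_asym a ?l d' (edges H)" "\<Union>(edges H) = verts H"
      using strictly_asym_balanced_edges[OF fam(1-4)[OF h] l0 a0 fam(5)[OF h]] by metis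
    then show "\<Union>(edges H) = verts H" "\<exists>d>0. \<forall>d'\<le>d. balanced_asym a ?l d' (edges H)" by auto
  qed
  have UL: "\<Union>(edges L) = verts L" if "L \<in> FL" for L using strictly_2_balanced_facts(1)[OF fal[OF that]] .
  have dL: "\<exists>d>0. \<forall>d'\<le>d. balanced2 (m2 L) d' (edges L)" if "L \<in> FL" for L
    using strictly_2_balanced_edges[OF fal[OF that]] by metis
  have fin: "finite FH" "finite FL" using FH FL by (auto simp: graph_family_def)
  obtain d1 where d1: "0 < d1" "\<And>H d'. H \<in> FH \<Longrightarrow> d' \<le> d1 \<Longrightarrow> balanced_asym a ?l d' (edges H)"
    by (rule uniform_bound[where P = "\<lambda>H d'. balanced_asym a ?l d' (edges H)", OF fin(1) dH]) (assumption, rule that, assumption, blast)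
  obtain d2 where d2: "0 < d2" "\<And>L d'. L \<in> FL \<Longrightarrow> d' \<le> d2 \<Longrightarrow> balanced2 (m2 L) d' (edges L)"
    by (rule uniform_bound[where P = "\<lambda>L d'. balanced2 (m2 L) d' (edges L)", OF fin(2) dL]) (assumption, rule that, assumption, blast)
  define d where "d = min 1 (min d1 d2)"
  have d: "0 < d" "d \<le> 1" "d \<le> d1" "d \<le> d2" using d1 d2 by (auto simp: d_def)
  have fu: "finite (FH \<union> FL)" using fin by simp
  obtain v0 where v0: "\<And>H. H \<in> FH \<union> FL \<Longrightarrow> nv H \<le> v0" using nat_bound[OF fu, of nv] by blast
  obtain e0 where e0: "\<And>H. H \<in> FH \<union> FL \<Longrightarrow> ne H \<le> e0" using nat_bound[OF fu, of ne] by blast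
  show ?thesis
  proof (rule zero_from_families[OF a0 d(1), where M = "v0 + e0 * v0"])
    show "\<And>H. H \<in> FH \<union> FL \<Longrightarrow> \<Union>(edges H) = verts H" using UH UL by blast
    show "\<And>G. simple_graph G \<Longrightarrow> ramsey_for G [FH, FL] \<Longrightarrow> a < max_density G" by (rule dense)
    fix n G \<H> \<L> assume G: "edges G \<subseteq> all_edges n" and s: "\<H> \<subseteq> copies FH G" "\<L> \<subseteq> copies FL G" and core: "minimal_core \<H> \<L>"
    show "exploration (\<H> \<union> \<L>) a d (v0 + e0 * v0) n"
    proof (rule exploration_asym[OF core, where l = ?l])
      show "\<Union>(\<H> \<union> \<L>) \<subseteq> all_edges n" using s copies_subset G by blast
      show "balanced_asym a ?l d A" if "A \<in> \<H>" for A
      proof -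
        have "A \<in> copies FH G" using that s by blast
        then obtain H f where "H \<in> FH" "A = (`) f ` edges H" "inj_on f (\<Union>(edges H))"
          using copies_card[OF _ UH] by metis
        then show ?thesis using balanced_asym_image d1(2) d(3) by metis
      qed
      show "\<exists>m>1. 1 / m \<le> 1 / ?l \<and> balanced2 m d A" if "A \<in> \<L>" for A
      proof -
        have "A \<in> copies FL G" using that s by blast
        then obtain L f where Lf: "L \<in> FL" "A = (`) f ` edges L" "inj_on f (\<Union>(edges L))"
          using copies_card[OF _ UL] by metis
        then have "balanced2 (m2 L) d A" using balanced2_image d2(2) d(4) by metis
        moreover have "1 / m2 L \<le> 1 / ?l" using m2L[OF Lf(1)] l0 by (intro divide_left_mono) auto
        ultimately show ?thesis using fal(3)[OF Lf(1)] by blast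
      qed
      have cc: "\<exists>H\<in>FH \<union> FL. card (\<Union>A) = nv H \<and> card A = ne H" if "A \<in> \<H> \<union> \<L>" for A
        using that
      proof
        assume "A \<in> \<H>"
        then have "A \<in> copies FH G" using s by blast
        then show ?thesis using copies_card[OF _ UH] by (metis UnI1)
      next
        assume "A \<in> \<L>"
        then have "A \<in> copies FL G" using s by blast
        then show ?thesis using copies_card[OF _ UL] by (metis UnI2)
      qed
      show "card (\<Union>A) \<le> v0" if "A \<in> \<H> \<union> \<L>" for A using cc[OF that] v0 by metis
      show "card A \<le> e0" if "A \<in> \<H> \<union> \<L>" for A using cc[OF that] e0 by metis
    qed (use a l0 d in auto)
  qed
qed

text \<open>A monochromatic copy of \<open>H\<close> would have potential at most
  \<open>2 * a - 1\<close> on its vertex set, since \<open>a * (nv H - 2) <= ne H - 1\<close>; a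
  good colour class does not allow this.\<close>

lemma two_colourable:
  assumes G: "simple_graph G" "max_density G \<le> a" and a: "1 < a"
    and F: "\<And>H. H \<in> FH \<union> FL \<Longrightarrow> simple_graph H \<and> strictly_2_balanced H \<and> a \<le> m2 H"
  shows "\<not> ramsey_for G [FH, FL]"
proof
  assume ram: "ramsey_for G [FH, FL]"
  have fE: "finite (edges G)" by (rule simple_finite_edges[OF G(1)])
  have sparse: "0 \<le> pot a (edges G) X" if "finite X" for X
  proof -
    let ?J = "(X \<inter> verts G, {e \<in> edges G. e \<subseteq> X})"
    have "subgraph ?J G" using G(1) by (intro subgraph_pair) (auto simp: simple_graph_def)
    then have "real (ne ?J) \<le> a * real (nv ?J)" using a by (intro max_density_le[OF G]) auto
    also have "\<dots> \<le> a * real (card X)" using a that by (intro mult_left_mono) (auto intro: card_mono)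
    finally show ?thesis by (simp add: pot_def edges_in_def)
  qed
  have E2: "\<forall>e\<in>edges G. card e = 2" using G(1) by (simp add: simple_graph_def)
  obtain R B where RB: "R \<union> B = edges G" "R \<inter> B = {}" "good a R" "good a B"
    using two_colouring[OF a fE E2 sparse] by metis
  have fRB: "finite R" "finite B" using fE RB(1) by (metis finite_Un)+
  define col where "col = (\<lambda>e :: nat set. if e \<in> R then 0 else 1 :: nat)"
  have "\<forall>e\<in>edges G. col e < length [FH, FL]" by (simp add: col_def)
  then obtain i H where i: "i < length [FH, FL]" "H \<in> [FH, FL] ! i" "has_coloured_copy G col i H"
    using ram unfolding ramsey_for_def by blast
  then obtain f where f: "inj_on f (verts H)" "\<And>e. e \<in> edges H \<Longrightarrow> f ` e \<in> edges G"
    "\<And>e. e \<in> edges H \<Longrightarrow> col (f ` e) = i" unfolding has_coloured_copy_def by blast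
  have "i = 0 \<or> i = 1" using i(1) by auto
  then have HF: "H \<in> FH \<union> FL" using i(2) by auto
  note h = F[OF HF]
  have m1: "1 < m2 H" using h a by auto
  have H: "simple_graph H" "strictly_2_balanced H" using h by auto
  note facts = strictly_2_balanced_facts[OF H m1]
  have bad: False if C: "finite C" "good a C" "\<And>e. e \<in> edges H \<Longrightarrow> f ` e \<in> C" for C
  proof -
    let ?X = "f ` verts H"
    have cX: "card ?X = nv H" by (rule card_image[OF f(1)])
    have fX: "finite ?X" using H(1) by (simp add: simple_graph_def)
    have "(`) f ` edges H \<subseteq> {e \<in> C. e \<subseteq> ?X}" using C(3) H(1) unfolding simple_graph_def by blast
    then have "card ((`) f ` edges H) \<le> edges_in C ?X" unfolding edges_in_def using C(1) by (intro card_mono) auto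
    moreover have "card ((`) f ` edges H) = ne H" using transport_card(1)[of f "edges H"] f(1) facts(1) by simp
    ultimately have "pot a C ?X \<le> a * real (nv H) - real (ne H)" unfolding pot_def cX by simp
    moreover have "2 * a - 1 < pot a C ?X" using C(2) fX facts(2) cX unfolding good_def by metis
    moreover have "a * (real (nv H) - 2) \<le> m2 H * (real (nv H) - 2)" using h facts(2) by (intro mult_right_mono) auto
    moreover have "m2 H * (real (nv H) - 2) = real (ne H) - 1" using facts(4) m1 by (simp add: field_simps)
    ultimately show False by (simp add: algebra_simps)
  qed
  show False
  proof (cases "i = 0")
    case True
    have "f ` e \<in> R" if "e \<in> edges H" for e
      using f(3)[OF that] True unfolding col_def by (cases "f ` e \<in> R") simp_all
    then show False using bad[OF fRB(1) RB(3)] by blast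
  next
    case False
    have "f ` e \<notin> R" if "e \<in> edges H" for e
      using f(3)[OF that] False unfolding col_def by (cases "f ` e \<in> R") simp_all
    then have "\<And>e. e \<in> edges H \<Longrightarrow> f ` e \<in> B" using f(2) RB(1) by blast
    then show False using bad[OF fRB(2) RB(4)] by blast
  qed
qed

text \<open>If both families have the same density \<open>a\<close>, no pair of them is strictly balanced (\<open>K\<^sub>2\<close> already
  attains the asymmetric density), so the deterministic assertion says nothing and its conclusion
  has to be supplied by the two-colouring theorem.\<close>

lemma zero_sym:
  assumes fin: "finite FH" "finite FL" and a: "1 < a"
    and F: "\<And>H. H \<in> FH \<union> FL \<Longrightarrow> simple_graph H \<and> strictly_2_balanced H \<and> a \<le> m2 H"
  shows "\<exists>c>0. \<forall>p :: nat \<Rightarrow> real. (\<forall>n. 0 \<le> p n \<and> p n \<le> 1) \<and> (\<forall>n\<ge>1. p n \<le> c * real n powr (- 1 / a)) \<longrightarrow>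
     (\<lambda>n. measure_pmf.prob (Gnp n (p n)) {G. ramsey_for G [FH, FL]}) \<longlonglongrightarrow> 0"
proof -
  have a0: "0 < a" using a by simp
  have fal: "simple_graph L" "strictly_2_balanced L" "1 < m2 L" if "L \<in> FH \<union> FL" for L
    using F[OF that] a by auto
  have U: "\<Union>(edges L) = verts L" if "L \<in> FH \<union> FL" for L using strictly_2_balanced_facts(1)[OF fal[OF that]] .
  have dL: "\<exists>d>0. \<forall>d'\<le>d. balanced2 (m2 L) d' (edges L)" if "L \<in> FH \<union> FL" for L
    using strictly_2_balanced_edges[OF fal[OF that]] by metis
  have fu: "finite (FH \<union> FL)" using fin by simp
  obtain d1 where d1: "0 < d1" "\<And>L d'. L \<in> FH \<union> FL \<Longrightarrow> d' \<le> d1 \<Longrightarrow> balanced2 (m2 L) d' (edges L)"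
    by (rule uniform_bound[where P = "\<lambda>L d'. balanced2 (m2 L) d' (edges L)", OF fu dL]) (assumption, rule that, assumption, blast)
  define d where "d = min (1 / a) d1"
  have d: "0 < d" "d \<le> 1 / a" "d \<le> d1" using d1 a0 by (auto simp: d_def)
  obtain v0 where v0: "\<And>H. H \<in> FH \<union> FL \<Longrightarrow> nv H \<le> v0" using nat_bound[OF fu, of nv] by blast
  obtain e0 where e0: "\<And>H. H \<in> FH \<union> FL \<Longrightarrow> ne H \<le> e0" using nat_bound[OF fu, of ne] by blast
  show ?thesis
  proof (rule zero_from_families[OF a0 d(1) U, where M = "v0 + e0 * v0"])
    show "a < max_density G" if "simple_graph G" "ramsey_for G [FH, FL]" for G
      using two_colourable[OF that(1) _ a F] that(2) by (meson not_le)
    fix n G \<H> \<L> assume G: "edges G \<subseteq> all_edges n" and s: "\<H> \<subseteq> copies FH G" "\<L> \<subseteq> copies FL G" and core: "minimal_core \<H> \<L>"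
    have "copies FH G \<union> copies FL G = copies (FH \<union> FL) G" unfolding copies_def by blast
    then have cop: "A \<in> copies (FH \<union> FL) G" if "A \<in> \<H> \<union> \<L>" for A using that s by blast
    show "exploration (\<H> \<union> \<L>) a d (v0 + e0 * v0) n"
    proof (rule exploration_sym[OF core])
      show "\<Union>(\<H> \<union> \<L>) \<subseteq> all_edges n" using s copies_subset G by blast
      show "\<exists>m\<ge>a. balanced2 m d A" if A: "A \<in> \<H> \<union> \<L>" for A
      proof -
        obtain L f where Lf: "L \<in> FH \<union> FL" "A = (`) f ` edges L" "inj_on f (\<Union>(edges L))"
          using copies_card[OF cop[OF A] U] by metis
        then have "balanced2 (m2 L) d A" using balanced2_image d1(2) d(3) by metis
        then show ?thesis using F[OF Lf(1)] by blast
      qed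
      have cc: "\<exists>H\<in>FH \<union> FL. card (\<Union>A) = nv H \<and> card A = ne H" if "A \<in> \<H> \<union> \<L>" for A
        using copies_card[OF cop[OF that] U] by metis
      show "card (\<Union>A) \<le> v0" if "A \<in> \<H> \<union> \<L>" for A using cc[OF that] v0 by metis
      show "card A \<le> e0" if "A \<in> \<H> \<union> \<L>" for A using cc[OF that] e0 by metis
    qed (use a d in auto)
  qed
qed

section \<open>Reduction to two strictly balanced families\<close>

lemma has_coloured_copy_subgraph:
  assumes "has_coloured_copy G col i H" "subgraph J H"
  shows "has_coloured_copy G col i J"
proof -
  obtain f where f: "inj_on f (verts H)" "f ` verts H \<subseteq> verts G" "\<forall>e\<in>edges H. f ` e \<in> edges G \<and> col (f ` e) = i"
    using assms(1) unfolding has_coloured_copy_def by blast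
  note s = subgraphD(2,3)[OF assms(2)]
  have "inj_on f (verts J)" "f ` verts J \<subseteq> verts G" "\<forall>e\<in>edges J. f ` e \<in> edges G \<and> col (f ` e) = i"
    using f s by (auto intro: inj_on_subset)
  then show ?thesis unfolding has_coloured_copy_def by blast
qed

lemma ramsey_for_subgraphs:
  assumes r: "ramsey_for G [A, B]" and A: "\<And>H. H \<in> A \<Longrightarrow> \<exists>J\<in>A'. subgraph J H" and B: "\<And>H. H \<in> B \<Longrightarrow> \<exists>J\<in>B'. subgraph J H"
  shows "ramsey_for G [A', B']"
  unfolding ramsey_for_def
proof (intro allI impI)
  fix col assume "\<forall>e\<in>edges G. col e < length [A', B']"
  then have "\<forall>e\<in>edges G. col e < length [A, B]" by simp
  then obtain i H where i: "i < length [A, B]" "H \<in> [A, B] ! i" "has_coloured_copy G col i H"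
    using r unfolding ramsey_for_def by blast
  have "i = 0 \<and> H \<in> A \<or> i = 1 \<and> H \<in> B" using i(1,2) by (auto simp: less_Suc_eq)
  then have "\<exists>J\<in>[A', B'] ! i. subgraph J H" using A[of H] B[of H] by (elim disjE conjE) simp_all
  then show "\<exists>i<length [A', B']. \<exists>H\<in>[A', B'] ! i. has_coloured_copy G col i H"
    using has_coloured_copy_subgraph[OF i(3)] i(1) by auto
qed

text \<open>A colouring with the first two colours is also one with all of them. A copy of a graph
  with an edge shows its colour, so it must belong to one of the first two families; an edgeless
  graph would occur in every colour.\<close>

lemma ramsey_for_first_two:
  assumes r: "ramsey_for G Hs" and len: "2 \<le> length Hs" and E: "\<And>F H. F \<in> set Hs \<Longrightarrow> H \<in> F \<Longrightarrow> edges H \<noteq> {}"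
  shows "ramsey_for G [Hs ! 0, Hs ! 1]"
  unfolding ramsey_for_def
proof (intro allI impI)
  fix col assume col: "\<forall>e\<in>edges G. col e < length [Hs ! 0, Hs ! 1]"
  then have "\<forall>e\<in>edges G. col e < length Hs" using len by fastforce
  then obtain i H where i: "i < length Hs" "H \<in> Hs ! i" "has_coloured_copy G col i H"
    using r unfolding ramsey_for_def by blast
  obtain e where e: "e \<in> edges H" using E[OF nth_mem[OF i(1)] i(2)] by auto
  obtain f where "f ` e \<in> edges G" "col (f ` e) = i" using i(3) e unfolding has_coloured_copy_def by blast
  then have i2: "i < length [Hs ! 0, Hs ! 1]" using col by blast
  then have "i = 0 \<or> i = 1" by auto
  then have "H \<in> [Hs ! 0, Hs ! 1] ! i" using i(2) by auto
  then show "\<exists>i<length [Hs ! 0, Hs ! 1]. \<exists>H\<in>[Hs ! 0, Hs ! 1] ! i. has_coloured_copy G col i H"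
    using i(3) i2 by blast
qed

definition vanishes_below :: "real \<Rightarrow> graph set \<Rightarrow> bool" where
  "vanishes_below a R \<longleftrightarrow> (\<exists>c>0. \<forall>p :: nat \<Rightarrow> real. (\<forall>n. 0 \<le> p n \<and> p n \<le> 1) \<and>
     (\<forall>n\<ge>1. p n \<le> c * real n powr (- 1 / a)) \<longrightarrow> (\<lambda>n. measure_pmf.prob (Gnp n (p n)) R) \<longlonglongrightarrow> 0)"

lemma vanishes_below_mono:
  assumes v: "vanishes_below b R'" and R: "R \<subseteq> R'" and ab: "0 < a" "a \<le> b"
  shows "vanishes_below a R"
proof -
  obtain c where c: "0 < c" "\<And>p :: nat \<Rightarrow> real. (\<forall>n. 0 \<le> p n \<and> p n \<le> 1) \<and> (\<forall>n\<ge>1. p n \<le> c * real n powr (- 1 / b)) \<Longrightarrow>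
      (\<lambda>n. measure_pmf.prob (Gnp n (p n)) R') \<longlonglongrightarrow> 0" using v unfolding vanishes_below_def by blast
  have "(\<lambda>n. measure_pmf.prob (Gnp n (p n)) R) \<longlonglongrightarrow> 0"
    if p: "\<forall>n. 0 \<le> p n \<and> p n \<le> 1" "\<forall>n\<ge>1. p n \<le> c * real n powr (- 1 / a)" for p :: "nat \<Rightarrow> real"
  proof -
    have "p n \<le> c * real n powr (- 1 / b)" if n: "1 \<le> n" for n
    proof -
      have "1 / b \<le> 1 / a" using ab by (intro divide_left_mono) auto
      then have "real n powr (- 1 / a) \<le> real n powr (- 1 / b)" using n by (intro powr_mono) auto
      then have "c * real n powr (- 1 / a) \<le> c * real n powr (- 1 / b)" using c(1) by (intro mult_left_mono) auto
      then show ?thesis using p(2) n by fastforce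
    qed
    then have lim: "(\<lambda>n. measure_pmf.prob (Gnp n (p n)) R') \<longlonglongrightarrow> 0" using p(1) by (intro c(2)) blast
    show ?thesis
    proof (rule tendsto_sandwich[OF _ _ tendsto_const lim])
      show "\<forall>\<^sub>F n in sequentially. measure_pmf.prob (Gnp n (p n)) R \<le> measure_pmf.prob (Gnp n (p n)) R'"
        using R by (intro always_eventually allI measure_pmf.finite_measure_mono) auto
    qed simp
  qed
  then show ?thesis using c(1) unfolding vanishes_below_def by blast
qed

lemma fam_Min:
  assumes "graph_family F"
  shows "\<And>H. H \<in> F \<Longrightarrow> m2_fam F \<le> m2 H" "\<exists>H\<in>F. m2_fam F = m2 H"
    "\<And>H. H \<in> F \<Longrightarrow> m2_asym_fam F L \<le> m2_asym H L" "\<exists>H\<in>F. m2_asym_fam F L = m2_asym H L"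
proof -
  have F: "finite F" "F \<noteq> {}" using assms by (auto simp: graph_family_def)
  show "m2_fam F \<le> m2 H" if "H \<in> F" for H unfolding m2_fam_def using F that by (intro Min_le) auto
  show "m2_asym_fam F L \<le> m2_asym H L" if "H \<in> F" for H unfolding m2_asym_fam_def using F that by (intro Min_le) auto
  have "m2_fam F \<in> m2 ` F" unfolding m2_fam_def using F by (intro Min_in) auto
  then show "\<exists>H\<in>F. m2_fam F = m2 H" by auto
  have "m2_asym_fam F L \<in> (\<lambda>H. m2_asym H L) ` F" unfolding m2_asym_fam_def using F by (intro Min_in) auto
  then show "\<exists>H\<in>F. m2_asym_fam F L = m2_asym H L" by auto
qed

lemma m2_asym_cong: "m2_fam L = m2_fam L' \<Longrightarrow> m2_asym H L = m2_asym H L'"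
  by (simp add: m2_asym_def)

lemma edge_le_one:
  assumes "simple_graph K" "nv K = 2"
  shows "ne K \<le> 1"
proof -
  have "e = verts K" if "e \<in> edges K" for e
    using that assms by (intro card_subset_eq) (auto simp: simple_graph_def)
  then have "edges K \<subseteq> {verts K}" by blast
  then show ?thesis using card_mono[of "{verts K}" "edges K"] by simp
qed

text \<open>The fraction \<open>e / (v - 2 + 1 / l)\<close> is the mediant of
  \<open>(e - 1) / (v - 2)\<close> and of \<open>1 / (1 / l) = l\<close>, so it lies on the same
  side of \<open>l\<close> as the former.\<close>

lemma asym_ratio:
  assumes l: "0 < (l::real)" and v: "2 < v"
  shows "l < e / (v - 2 + 1 / l) \<longleftrightarrow> l < (e - 1) / (v - 2)"
proof -
  have w: "0 < v - 2 + 1 / l" using l v by (simp add: add_pos_pos)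
  have "l < e / (v - 2 + 1 / l) \<longleftrightarrow> l * (v - 2 + 1 / l) < e" using w by (simp add: pos_less_divide_eq)
  also have "l * (v - 2 + 1 / l) = l * (v - 2) + 1" using l by (simp add: algebra_simps)
  also have "l * (v - 2) + 1 < e \<longleftrightarrow> l < (e - 1) / (v - 2)" using v by (auto simp: pos_less_divide_eq)
  finally show ?thesis .
qed

text \<open>On two vertices the asymmetric ratio is at most \<open>m2_fam L\<close>, attained by K2.
  A value above it comes from a subgraph with at least three vertices, where the mediant comparison
  applies.\<close>

lemma m2_asym_gt_iff:
  assumes H: "simple_graph H" and l: "1 < m2_fam L"
  shows "m2_fam L < m2_asym H L \<longleftrightarrow> m2_fam L < m2 H"
proof
  let ?l = "m2_fam L"
  have l0: "0 < ?l" using l by simp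
  assume gt: "?l < m2_asym H L"
  then have v2: "2 \<le> nv H" using l by (auto simp: m2_asym_def split: if_splits)
  obtain K where K: "subgraph K H" "2 \<le> nv K" "m2_asym H L = real (ne K) / (real (nv K) - 2 + 1 / ?l)"
    using m2_asym_Max(2)[OF H v2] by blast
  have sK: "simple_graph K" using subgraphD(1)[OF K(1)] .
  have "nv K \<noteq> 2"
  proof
    assume "nv K = 2"
    then have "m2_asym H L = real (ne K) * ?l" using K(3) by simp
    moreover have "real (ne K) * ?l \<le> 1 * ?l" using edge_le_one[OF sK \<open>nv K = 2\<close>] l0 by (intro mult_right_mono) auto
    ultimately show False using gt by simp
  qed
  then have v3: "3 \<le> nv K" using K(2) by linarith
  then have r: "?l < (real (ne K) - 1) / (real (nv K) - 2)" using gt K(3) asym_ratio[OF l0, of "real (nv K)" "real (ne K)"] by simp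
  have "ne K \<noteq> 0"
  proof
    assume "ne K = 0"
    then have "(real (ne K) - 1) / (real (nv K) - 2) \<le> 0" using v3 by (simp add: divide_nonpos_pos)
    then show False using r l0 by linarith
  qed
  then have "edges K \<noteq> {}" by auto
  then have eH: "edges H \<noteq> {}" using subgraphD(3)[OF K(1)] by auto
  have "nv K \<le> nv H" using K(1) H by (auto simp: subgraph_def simple_graph_def intro: card_mono)
  then have "3 \<le> nv H" using v3 by simp
  then show "?l < m2 H" using m2_Max(1)[OF H eH _ K(1) v3] r by simp
next
  let ?l = "m2_fam L"
  have l0: "0 < ?l" using l by simp
  assume gt: "?l < m2 H"
  then have half: "1 / 2 < m2 H" using l by simp
  obtain K where K: "subgraph K H" "3 \<le> nv K" "m2 H = (real (ne K) - 1) / (real (nv K) - 2)"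
    using m2_Max(2)[OF H m2_gt_half[OF half]] by blast
  have "?l < real (ne K) / (real (nv K) - 2 + 1 / ?l)"
    using gt K asym_ratio[OF l0, of "real (nv K)" "real (ne K)"] by simp
  also have "\<dots> \<le> m2_asym H L" using m2_gt_half(2)[OF half] K by (intro m2_asym_Max(1)[OF H]) auto
  finally show "?l < m2_asym H L" .
qed

lemma m2_asym_fam_pos:
  assumes A: "graph_family A" and gt: "\<And>H. H \<in> A \<Longrightarrow> 1 < m2 H" and l: "1 < m2_fam B"
  shows "0 < m2_asym_fam A B"
proof -
  obtain H where H: "H \<in> A" "m2_asym_fam A B = m2_asym H B" using fam_Min(4)[OF A] by blast
  have sH: "simple_graph H" using A H(1) by (auto simp: graph_family_def)
  have h: "edges H \<noteq> {}" "3 \<le> nv H" using m2_gt_half[of H] gt[OF H(1)] by auto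
  have "0 < ne H" using h(1) simple_finite_edges[OF sH] by (simp add: card_gt_0_iff)
  moreover have "0 < real (nv H) - 2 + 1 / m2_fam B" using h(2) l by (intro add_pos_pos) auto
  ultimately have "0 < real (ne H) / (real (nv H) - 2 + 1 / m2_fam B)" by simp
  also have "\<dots> \<le> m2_asym H B" using h(2) by (intro m2_asym_Max(1)[OF sH] subgraph_refl sH) auto
  finally show ?thesis using H(2) by simp
qed

text \<open>Each graph is replaced by a minimal subgraph of the same density. Smaller graphs are
  easier to find, so the Ramsey property can only become more likely, while the density is
  unchanged.\<close>

lemma balanced_subfamily_2:
  assumes F: "graph_family F" and gt: "\<And>H. H \<in> F \<Longrightarrow> 1 < m2 H"
  obtains F' where "graph_family F'" "\<And>J. J \<in> F' \<Longrightarrow> strictly_2_balanced J" "m2_fam F' = m2_fam F"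
    "\<And>H. H \<in> F \<Longrightarrow> \<exists>J\<in>F'. subgraph J H"
proof -
  have "\<exists>J. subgraph J H \<and> m2 J = m2 H \<and> strictly_2_balanced J" if H: "H \<in> F" for H
  proof -
    have sH: "simple_graph H" using F H by (auto simp: graph_family_def)
    have half: "1 / 2 < m2 H" using gt[OF H] by simp
    obtain J where J: "subgraph J H" "m2 J = m2 H" "\<And>K. proper_subgraph K J \<Longrightarrow> m2 K \<noteq> m2 H"
      using minimal_subgraph[of H "\<lambda>J. m2 J = m2 H", OF sH refl] by metis
    have "m2 K < m2 J" if K: "proper_subgraph K J" for K
    proof -
      have "subgraph K H" using K J(1) subgraph_trans unfolding proper_subgraph_def by blast
      then have "m2 K \<le> m2 H" by (rule m2_mono[OF sH half])
      then show ?thesis using J(2) J(3)[OF K] by linarith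
    qed
    then show ?thesis using J unfolding strictly_2_balanced_def by blast
  qed
  then obtain s where s: "\<And>H. H \<in> F \<Longrightarrow> subgraph (s H) H \<and> m2 (s H) = m2 H \<and> strictly_2_balanced (s H)" by metis
  have fam: "graph_family (s ` F)"
    using F s subgraphD(1) unfolding graph_family_def by (metis (no_types, lifting) finite_imageI image_is_empty imageE)
  have "m2 ` s ` F = m2 ` F" unfolding image_image by (intro image_cong refl) (simp add: s)
  then have "m2_fam (s ` F) = m2_fam F" by (simp add: m2_fam_def)
  moreover have "\<exists>J\<in>s ` F. subgraph J H" if "H \<in> F" for H using s[OF that] that by (intro bexI[of _ "s H"]) auto
  moreover have "strictly_2_balanced J" if "J \<in> s ` F" for J using that s by auto
  ultimately show thesis using that[OF fam] by blast
qed

lemma balanced_subfamily_asym: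
  assumes F: "graph_family F" and gt: "\<And>H. H \<in> F \<Longrightarrow> 0 < m2_asym H L"
  obtains F' where "graph_family F'" "\<And>J. J \<in> F' \<Longrightarrow> strictly_asym_balanced L J" "m2_asym_fam F' L = m2_asym_fam F L"
    "\<And>H. H \<in> F \<Longrightarrow> \<exists>J\<in>F'. subgraph J H"
proof -
  have "\<exists>J. subgraph J H \<and> m2_asym J L = m2_asym H L \<and> strictly_asym_balanced L J" if H: "H \<in> F" for H
  proof -
    have sH: "simple_graph H" using F H by (auto simp: graph_family_def)
    obtain J where J: "subgraph J H" "m2_asym J L = m2_asym H L" "\<And>K. proper_subgraph K J \<Longrightarrow> m2_asym K L \<noteq> m2_asym H L"
      using minimal_subgraph[of H "\<lambda>J. m2_asym J L = m2_asym H L", OF sH refl] by metis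
    have "m2_asym K L < m2_asym J L" if K: "proper_subgraph K J" for K
    proof -
      have "subgraph K H" using K J(1) subgraph_trans unfolding proper_subgraph_def by blast
      then have "m2_asym K L \<le> m2_asym H L" by (rule m2_asym_mono[OF sH gt[OF H]])
      then show ?thesis using J(2) J(3)[OF K] by linarith
    qed
    then show ?thesis using J unfolding strictly_asym_balanced_def by blast
  qed
  then obtain s where s: "\<And>H. H \<in> F \<Longrightarrow> subgraph (s H) H \<and> m2_asym (s H) L = m2_asym H L \<and> strictly_asym_balanced L (s H)" by metis
  have fam: "graph_family (s ` F)"
    using F s subgraphD(1) unfolding graph_family_def by (metis (no_types, lifting) finite_imageI image_is_empty imageE)
  have "(\<lambda>H. m2_asym H L) ` s ` F = (\<lambda>H. m2_asym H L) ` F" unfolding image_image by (intro image_cong refl) (simp add: s)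
  then have "m2_asym_fam (s ` F) L = m2_asym_fam F L" by (simp add: m2_asym_fam_def)
  moreover have "\<exists>J\<in>s ` F. subgraph J H" if "H \<in> F" for H using s[OF that] that by (intro bexI[of _ "s H"]) auto
  moreover have "strictly_asym_balanced L J" if "J \<in> s ` F" for J using that s by auto
  ultimately show thesis using that[OF fam] by blast
qed

text \<open>The second family is balanced first; the asymmetric density depends on it only through
  \<open>m2_fam\<close>, which is preserved. The first family is then balanced with respect to the
  asymmetric density if its own density is strictly larger, and with respect to \<open>m2\<close> if
  the densities agree.\<close>

theorem probabilistic_from_deterministic:
  assumes det: "\<And>H1 H2 G. graph_family H1 \<Longrightarrow> graph_family H2 \<Longrightarrow> strictly_balanced_pair H1 H2 \<Longrightarrow>
      m2_fam H1 \<ge> m2_fam H2 \<Longrightarrow> m2_fam H2 > 1 \<Longrightarrow> simple_graph G \<Longrightarrow> ramsey_for G [H1, H2] \<Longrightarrow> max_density G > m2_asym_fam H1 H2"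
    and A: "graph_family A" and B: "graph_family B" and AB: "m2_fam B \<le> m2_fam A" and B1: "1 < m2_fam B"
  shows "vanishes_below (m2_asym_fam A B) {G. ramsey_for G [A, B]}"
proof -
  let ?l = "m2_fam B"
  have gtB: "1 < m2 H" if "H \<in> B" for H using fam_Min(1)[OF B that] B1 by linarith
  have gtA: "1 < m2 H" if "H \<in> A" for H using fam_Min(1)[OF A that] B1 AB by linarith
  have sA: "simple_graph H" if "H \<in> A" for H using A that by (auto simp: graph_family_def)
  obtain B' where B': "graph_family B'" "\<And>J. J \<in> B' \<Longrightarrow> strictly_2_balanced J" "m2_fam B' = ?l"
    "\<And>H. H \<in> B \<Longrightarrow> \<exists>J\<in>B'. subgraph J H" using balanced_subfamily_2[OF B gtB] by metis
  show ?thesis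
  proof (cases "?l < m2_fam A")
    case True
    have big: "?l < m2_asym H B'" if "H \<in> A" for H
    proof -
      have "?l < m2 H" using fam_Min(1)[OF A that] True by linarith
      then show ?thesis using m2_asym_gt_iff[OF sA[OF that], of B'] B1 B'(3) by simp
    qed
    then have "0 < m2_asym H B'" if "H \<in> A" for H using that B1 by (meson less_trans zero_less_one)
    then obtain A' where A': "graph_family A'" "\<And>J. J \<in> A' \<Longrightarrow> strictly_asym_balanced B' J" "m2_asym_fam A' B' = m2_asym_fam A B'"
      "\<And>H. H \<in> A \<Longrightarrow> \<exists>J\<in>A'. subgraph J H" using balanced_subfamily_asym[OF A] by metis
    let ?a = "m2_asym_fam A' B'"
    have eqa: "m2_asym_fam A B = ?a"
      using m2_asym_cong[OF B'(3)] A'(3) by (simp add: m2_asym_fam_def)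
    have la: "?l < ?a" using fam_Min(4)[OF A, of B'] big A'(3) by auto
    have le: "?a \<le> m2_asym J B'" if "J \<in> A'" for J using fam_Min(3)[OF A'(1) that] .
    have m2J: "?l < m2 J" if J: "J \<in> A'" for J
    proof -
      have "simple_graph J" using A'(1) J by (auto simp: graph_family_def)
      then show ?thesis using m2_asym_gt_iff[of J B'] la le[OF J] B'(3) B1 by simp
    qed
    have l': "1 < m2_fam B'" using B'(3) B1 by simp
    have pair: "strictly_balanced_pair A' B'" using A'(2) B'(2) unfolding strictly_balanced_pair_def by blast
    have "m2_fam B' \<le> m2_fam A'" using fam_Min(2)[OF A'(1)] m2J B'(3) by (metis less_imp_le)
    then have dense: "?a < max_density G" if "simple_graph G" "ramsey_for G [A', B']" for G
      using det[OF A'(1) B'(1) pair _ l' that] by simp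
    have H3: "3 \<le> nv H \<and> edges H \<noteq> {}" if "H \<in> A'" for H
      using m2_gt_half[of H] m2J[OF that] B1 by simp
    have a1: "1 < ?a" using la B1 by linarith
    have "vanishes_below ?a {G. ramsey_for G [A', B']}"
      unfolding vanishes_below_def
    proof (rule zero_asym[OF A'(1) B'(1) pair l' _ a1])
      show "\<And>H. H \<in> A' \<Longrightarrow> 3 \<le> nv H \<and> edges H \<noteq> {}" by (rule H3)
      show "\<And>H. H \<in> A' \<Longrightarrow> ?a \<le> m2_asym H B'" by (rule le)
      show "\<And>G. simple_graph G \<Longrightarrow> ramsey_for G [A', B'] \<Longrightarrow> ?a < max_density G" by (rule dense)
    qed
    moreover have "{G. ramsey_for G [A, B]} \<subseteq> {G. ramsey_for G [A', B']}"
      using ramsey_for_subgraphs A'(4) B'(4) by blast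
    moreover have "0 < ?a" using a1 by linarith
    ultimately have "vanishes_below ?a {G. ramsey_for G [A, B]}" using order_refl by (rule vanishes_below_mono)
    then show ?thesis unfolding eqa .
  next
    case False
    then have eq: "m2_fam A = ?l" using AB by linarith
    obtain A' where A': "graph_family A'" "\<And>J. J \<in> A' \<Longrightarrow> strictly_2_balanced J" "m2_fam A' = m2_fam A"
      "\<And>H. H \<in> A \<Longrightarrow> \<exists>J\<in>A'. subgraph J H" using balanced_subfamily_2[OF A gtA] by metis
    have "vanishes_below ?l {G. ramsey_for G [A', B']}"
      unfolding vanishes_below_def
    proof (rule zero_sym[OF _ _ B1])
      show "finite A'" "finite B'" using A'(1) B'(1) by (auto simp: graph_family_def)
      fix H assume H: "H \<in> A' \<union> B'"
      then have "simple_graph H" using A'(1) B'(1) by (auto simp: graph_family_def)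
      moreover have "strictly_2_balanced H" using H A'(2) B'(2) by blast
      moreover have "?l \<le> m2 H" using H fam_Min(1)[OF A'(1), of H] fam_Min(1)[OF B'(1), of H] A'(3) B'(3) eq by auto
      ultimately show "simple_graph H \<and> strictly_2_balanced H \<and> ?l \<le> m2 H" by blast
    qed
    moreover have "{G. ramsey_for G [A, B]} \<subseteq> {G. ramsey_for G [A', B']}"
      using ramsey_for_subgraphs A'(4) B'(4) by blast
    moreover have "0 < m2_asym_fam A B" by (rule m2_asym_fam_pos[OF A gtA B1])
    \<comment> \<open>For equal densities the asymmetric density does not exceed the common value,
      so a statement for that value covers the smaller edge probabilities.\<close>
    moreover have "m2_asym_fam A B \<le> ?l"
    proof -
      obtain H where H: "H \<in> A" "m2_fam A = m2 H" using fam_Min(2)[OF A] by blast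
      have "\<not> ?l < m2_asym H B" using m2_asym_gt_iff[OF sA[OF H(1)] B1] H(2) eq by simp
      then show ?thesis using fam_Min(3)[OF A H(1), of B] by linarith
    qed
    ultimately show ?thesis by (rule vanishes_below_mono)
  qed
qed

section \<open>Appearance of sparse graphs\<close>

lemma finite_set_pmf_Gnp: "finite (set_pmf (Gnp n p))"
proof (rule finite_subset)
  show "set_pmf (Gnp n p) \<subseteq> {{1..n}} \<times> Pow (all_edges n)" by (auto simp: Gnp_def)
qed (simp add: finite_all_edges)

text \<open>Instead of the Cauchy-Schwarz inequality, the pointwise bound
  \<open>2 * X <= s * X ^ 2 + Y / s\<close> is integrated, where \<open>X\<close> counts the
  contained sets and \<open>Y\<close> indicates that there is one. The choice
  \<open>s = 1 / (B * mu)\<close> turns it into \<open>2 * mu <= mu + B * mu * P\<close> for the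
  probability \<open>P\<close>.\<close>

lemma second_moment:
  fixes S :: "'i \<Rightarrow> nat set set"
  assumes I: "finite I" and S: "\<And>i. i \<in> I \<Longrightarrow> S i \<subseteq> all_edges n" and p: "0 \<le> p" "p \<le> 1"
    and mu: "(\<Sum>i\<in>I. p ^ card (S i)) = mu" "0 < mu"
    and B: "(\<Sum>i\<in>I. \<Sum>j\<in>I. p ^ card (S i \<union> S j)) \<le> B * mu\<^sup>2" "0 < B"
  shows "1 / B \<le> measure_pmf.prob (Gnp n p) {G. \<exists>i\<in>I. S i \<subseteq> edges G}"
proof -
  let ?M = "Gnp n p"
  let ?A = "\<lambda>i. {G. S i \<subseteq> edges G}"
  define X where "X = (\<lambda>G. \<Sum>i\<in>I. indicator (?A i) G :: real)"
  define Y where "Y = (indicator {G. \<exists>i\<in>I. S i \<subseteq> edges G} :: graph \<Rightarrow> real)"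
  have int: "integrable ?M (f :: graph \<Rightarrow> real)" for f by (rule integrable_measure_pmf_finite[OF finite_set_pmf_Gnp])
  have EX: "measure_pmf.expectation ?M X = mu"
    unfolding X_def mu(1)[symmetric]
    by (subst Bochner_Integration.integral_sum[OF int]) (auto intro!: sum.cong prob_contains S p)
  have sq: "(X G)\<^sup>2 = (\<Sum>i\<in>I. \<Sum>j\<in>I. indicator {G. S i \<union> S j \<subseteq> edges G} G)" for G
    unfolding X_def power2_eq_square sum_product by (intro sum.cong refl) (auto simp: indicator_def)
  have EX2: "measure_pmf.expectation ?M (\<lambda>G. (X G)\<^sup>2) = (\<Sum>i\<in>I. \<Sum>j\<in>I. p ^ card (S i \<union> S j))"
  proof -
    have "measure_pmf.expectation ?M (\<lambda>G. (X G)\<^sup>2) =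
       (\<Sum>i\<in>I. \<Sum>j\<in>I. measure_pmf.expectation ?M (indicator {G. S i \<union> S j \<subseteq> edges G} :: graph \<Rightarrow> real))"
      unfolding sq by (simp add: Bochner_Integration.integral_sum[OF int])
    also have "\<dots> = (\<Sum>i\<in>I. \<Sum>j\<in>I. measure_pmf.prob ?M {G. S i \<union> S j \<subseteq> edges G})" by simp
    also have "\<dots> = (\<Sum>i\<in>I. \<Sum>j\<in>I. p ^ card (S i \<union> S j))"
      using S p by (intro sum.cong refl prob_contains) auto
    finally show ?thesis .
  qed
  have EY: "measure_pmf.expectation ?M Y = measure_pmf.prob ?M {G. \<exists>i\<in>I. S i \<subseteq> edges G}" by (simp add: Y_def)
  define s where "s = 1 / (B * mu)"
  have s: "0 < s" using B mu by (simp add: s_def)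
  have pw: "2 * X G \<le> s * (X G)\<^sup>2 + (1 / s) * Y G" for G
  proof (cases "\<exists>i\<in>I. S i \<subseteq> edges G")
    case True
    then have "Y G = 1" by (simp add: Y_def)
    moreover have "0 \<le> (s * X G - 1)\<^sup>2" by simp
    then have "2 * (s * X G) \<le> s * (s * (X G)\<^sup>2) + 1" by (simp add: power2_eq_square algebra_simps)
    then have "2 * X G \<le> s * (X G)\<^sup>2 + 1 / s" using s by (simp add: field_simps power2_eq_square)
    ultimately show ?thesis by simp
  next
    case False
    then have "X G = 0" unfolding X_def by (intro sum.neutral) auto
    then show ?thesis using s by (simp add: Y_def)
  qed
  have "measure_pmf.expectation ?M (\<lambda>G. 2 * X G) \<le> measure_pmf.expectation ?M (\<lambda>G. s * (X G)\<^sup>2 + (1 / s) * Y G)"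
    by (intro integral_mono int pw)
  then have "2 * mu \<le> s * (\<Sum>i\<in>I. \<Sum>j\<in>I. p ^ card (S i \<union> S j)) + (1 / s) * measure_pmf.prob ?M {G. \<exists>i\<in>I. S i \<subseteq> edges G}"
    using EX EX2 EY by (simp add: Bochner_Integration.integral_add[OF int int])
  also have "s * (\<Sum>i\<in>I. \<Sum>j\<in>I. p ^ card (S i \<union> S j)) \<le> s * (B * mu\<^sup>2)" using B s by (intro mult_left_mono) auto
  also have "s * (B * mu\<^sup>2) = mu" using B(2) mu(2) by (simp add: s_def power2_eq_square)
  also have "1 / s = B * mu" by (simp add: s_def)
  finally have "mu * 1 \<le> mu * (B * measure_pmf.prob ?M {G. \<exists>i\<in>I. S i \<subseteq> edges G})" by (simp add: mult_ac)
  then have "1 \<le> B * measure_pmf.prob ?M {G. \<exists>i\<in>I. S i \<subseteq> edges G}" using mu(2) by (simp only: mult_le_cancel_left_pos)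
  then show ?thesis using B(2) by (simp add: divide_le_eq mult.commute)
qed

text \<open>Copies of \<open>G\<close> whose \<open>x\<close>-th vertex lies in the \<open>x\<close>-th block of \<open>N\<close> consecutive numbers: two of
  them share exactly the edges inside the set of vertices on which they agree.\<close>

lemma transversal_copies:
  fixes V :: "nat set" and E :: "nat set set"
  assumes V: "finite V" "card V = k" and E: "\<And>e. e \<in> E \<Longrightarrow> e \<subseteq> V \<and> card e = 2" and N: "k * N \<le> n"
  shows "\<exists>g :: (nat \<Rightarrow> nat) \<Rightarrow> nat \<Rightarrow> nat.
    (\<forall>\<phi>\<in>V \<rightarrow>\<^sub>E {..<N}. inj_on (g \<phi>) V \<and> g \<phi> ` V \<subseteq> {1..n} \<and> (`) (g \<phi>) ` E \<subseteq> all_edges n \<and>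
       card ((`) (g \<phi>) ` E) = card E) \<and>
    (\<forall>\<phi>\<in>V \<rightarrow>\<^sub>E {..<N}. \<forall>\<psi>\<in>V \<rightarrow>\<^sub>E {..<N}.
       card ((`) (g \<phi>) ` E \<union> (`) (g \<psi>) ` E) + card {e \<in> E. e \<subseteq> {x \<in> V. \<phi> x = \<psi> x}} = 2 * card E)"
proof -
  have fE: "finite E" using E V(1) by (meson PowI finite_Pow_iff finite_subset subsetI)
  obtain h where h: "bij_betw h V {0..<k}" using V ex_bij_betw_finite_nat by blast
  define g where "g = (\<lambda>\<phi> x. h x * N + \<phi> x + 1 :: nat)"
  have hk: "h x < k" if "x \<in> V" for x using h that by (auto dest: bij_betwE)
  have key: "x = y \<and> \<phi> x = \<psi> y"
    if "\<phi> \<in> (V \<rightarrow>\<^sub>E {..<N})" "\<psi> \<in> (V \<rightarrow>\<^sub>E {..<N})" "x \<in> V" "y \<in> V" "g \<phi> x = g \<psi> y" for \<phi> \<psi> x y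
  proof -
    have lt: "\<phi> x < N" "\<psi> y < N" using that by (auto simp: PiE_iff)
    have eq: "\<phi> x + h x * N = \<psi> y + h y * N" using that(5) by (simp add: g_def)
    have "h x = (\<phi> x + h x * N) div N" using lt by simp
    also have "\<dots> = h y" unfolding eq using lt by simp
    finally have "h x = h y" .
    then have "x = y" using h that(3,4) by (auto simp: bij_betw_def inj_on_def)
    then show ?thesis using eq by simp
  qed
  have inj: "inj_on (g \<phi>) V" if "\<phi> \<in> (V \<rightarrow>\<^sub>E {..<N})" for \<phi> using key[OF that that] by (auto simp: inj_on_def)
  have rng: "g \<phi> x \<in> {1..n}" if "\<phi> \<in> (V \<rightarrow>\<^sub>E {..<N})" "x \<in> V" for \<phi> x
  proof -
    have "\<phi> x < N" using that by (auto simp: PiE_iff)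
    then have "g \<phi> x \<le> h x * N + N" by (simp add: g_def)
    also have "\<dots> = (h x + 1) * N" by simp
    also have "\<dots> \<le> k * N" using hk[OF that(2)] by (intro mult_le_mono1) simp
    finally show ?thesis using N by (simp add: g_def)
  qed
  have injE: "inj_on ((`) (g \<phi>)) E" if "\<phi> \<in> (V \<rightarrow>\<^sub>E {..<N})" for \<phi>
    by (rule inj_on_subset[OF inj_on_image_Pow[OF inj[OF that]]]) (use E in auto)
  show ?thesis
  proof (rule exI[of _ g], rule conjI; intro ballI)
    fix \<phi> assume phi: "\<phi> \<in> (V \<rightarrow>\<^sub>E {..<N})"
    have "g \<phi> ` e \<in> all_edges n" if "e \<in> E" for e
      using E[OF that] rng[OF phi] card_image[OF inj_on_subset[OF inj[OF phi]], of e] unfolding all_edges_def by auto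
    then show "inj_on (g \<phi>) V \<and> g \<phi> ` V \<subseteq> {1..n} \<and> (`) (g \<phi>) ` E \<subseteq> all_edges n \<and> card ((`) (g \<phi>) ` E) = card E"
      using inj[OF phi] rng[OF phi] card_image[OF injE[OF phi]] by auto
  next
    fix \<phi> \<psi> assume phi: "\<phi> \<in> (V \<rightarrow>\<^sub>E {..<N})" and psi: "\<psi> \<in> (V \<rightarrow>\<^sub>E {..<N})"
    let ?D = "{e \<in> E. e \<subseteq> {x \<in> V. \<phi> x = \<psi> x}}"
    have "(`) (g \<phi>) ` E \<inter> (`) (g \<psi>) ` E = (`) (g \<phi>) ` ?D"
    proof
      show "(`) (g \<phi>) ` E \<inter> (`) (g \<psi>) ` E \<subseteq> (`) (g \<phi>) ` ?D"
      proof
        fix s assume "s \<in> (`) (g \<phi>) ` E \<inter> (`) (g \<psi>) ` E"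
        then obtain e f where ef: "e \<in> E" "f \<in> E" "s = g \<phi> ` e" "s = g \<psi> ` f" by auto
        have "x \<in> {x \<in> V. \<phi> x = \<psi> x}" if x: "x \<in> e" for x
        proof -
          have "g \<phi> x \<in> g \<psi> ` f" using ef x by auto
          then obtain y where y: "y \<in> f" "g \<phi> x = g \<psi> y" by auto
          have "x \<in> V" "y \<in> V" using E ef x y by auto
          then show ?thesis using key[OF phi psi] y by auto
        qed
        then have "e \<in> ?D" using ef(1) by blast
        then show "s \<in> (`) (g \<phi>) ` ?D" using ef(3) by blast
      qed
      show "(`) (g \<phi>) ` ?D \<subseteq> (`) (g \<phi>) ` E \<inter> (`) (g \<psi>) ` E"
      proof
        fix s assume "s \<in> (`) (g \<phi>) ` ?D"
        then obtain e where e: "e \<in> E" "e \<subseteq> {x \<in> V. \<phi> x = \<psi> x}" "s = g \<phi> ` e" by auto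
        have "g \<phi> ` e = g \<psi> ` e" using e(2) by (intro image_cong refl) (auto simp: g_def)
        then show "s \<in> (`) (g \<phi>) ` E \<inter> (`) (g \<psi>) ` E" using e by blast
      qed
    qed
    moreover have "card ((`) (g \<phi>) ` ?D) = card ?D" by (rule card_image[OF inj_on_subset[OF injE[OF phi]]]) auto
    moreover have "card ((`) (g \<phi>) ` E) + card ((`) (g \<psi>) ` E) =
        card ((`) (g \<phi>) ` E \<union> (`) (g \<psi>) ` E) + card ((`) (g \<phi>) ` E \<inter> (`) (g \<psi>) ` E)"
      using fE by (intro card_Un_Int) auto
    ultimately show "card ((`) (g \<phi>) ` E \<union> (`) (g \<psi>) ` E) + card ?D = 2 * card E"
      using card_image[OF injE[OF phi]] card_image[OF injE[OF psi]] by simp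
  qed
qed

lemma card_agreeing:
  assumes V: "finite V" and D: "D \<subseteq> V" and phi: "\<phi> \<in> (V \<rightarrow>\<^sub>E {..<N})"
  shows "card {\<psi> \<in> (V \<rightarrow>\<^sub>E {..<N :: nat}). {x \<in> V. \<phi> x = \<psi> x} = D} \<le> N ^ (card V - card D)"
proof -
  have fin: "finite (V \<rightarrow>\<^sub>E {..<N})" using V by (intro finite_PiE) auto
  have fVD: "finite (V - D)" using V by simp
  have "card {\<psi> \<in> (V \<rightarrow>\<^sub>E {..<N}). {x \<in> V. \<phi> x = \<psi> x} = D} \<le> card ((V - D) \<rightarrow>\<^sub>E {..<N})"
  proof (rule card_inj_on_le[where f = "\<lambda>\<psi>. restrict \<psi> (V - D)"])
    show "inj_on (\<lambda>\<psi>. restrict \<psi> (V - D)) {\<psi> \<in> (V \<rightarrow>\<^sub>E {..<N}). {x \<in> V. \<phi> x = \<psi> x} = D}"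
    proof (rule inj_onI)
      fix \<psi> \<psi>' assume a: "\<psi> \<in> {\<psi> \<in> (V \<rightarrow>\<^sub>E {..<N}). {x \<in> V. \<phi> x = \<psi> x} = D}" "\<psi>' \<in> {\<psi> \<in> (V \<rightarrow>\<^sub>E {..<N}). {x \<in> V. \<phi> x = \<psi> x} = D}"
        and r: "restrict \<psi> (V - D) = restrict \<psi>' (V - D)"
      show "\<psi> = \<psi>'"
      proof (rule PiE_ext)
        show "\<psi> \<in> (V \<rightarrow>\<^sub>E {..<N})" "\<psi>' \<in> (V \<rightarrow>\<^sub>E {..<N})" using a by auto
        fix x assume x: "x \<in> V"
        show "\<psi> x = \<psi>' x"
        proof (cases "x \<in> D")
          case True
          then have "x \<in> {x \<in> V. \<phi> x = \<psi> x}" "x \<in> {x \<in> V. \<phi> x = \<psi>' x}" using a by auto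
          then show ?thesis by simp
        next
          case False
          then show ?thesis using fun_cong[OF r, of x] x by simp
        qed
      qed
    qed
    show "(\<lambda>\<psi>. restrict \<psi> (V - D)) ` {\<psi> \<in> (V \<rightarrow>\<^sub>E {..<N}). {x \<in> V. \<phi> x = \<psi> x} = D} \<subseteq> (V - D) \<rightarrow>\<^sub>E {..<N}"
      by (auto simp: PiE_iff)
    show "finite ((V - D) \<rightarrow>\<^sub>E {..<N})" using fVD by (intro finite_PiE) auto
  qed
  also have "\<dots> = N ^ (card V - card D)"
    using V D fVD by (simp add: card_PiE card_Diff_subset finite_subset)
  finally show ?thesis .
qed

lemma power_powr:
  assumes "0 < (x :: real)"
  shows "(x powr y) ^ k = x powr (real k * y)"
proof -
  have "(x powr y) ^ k = (x powr y) powr real k" using assms by (intro powr_realpow[symmetric]) simp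
  then show ?thesis by (simp add: powr_powr mult.commute)
qed

lemma ramsey_for_embedding:
  assumes r: "ramsey_for G Hs" and g: "inj_on g (verts G)" "g ` verts G \<subseteq> verts G'" "\<And>e. e \<in> edges G \<Longrightarrow> g ` e \<in> edges G'"
  shows "ramsey_for G' Hs"
  unfolding ramsey_for_def
proof (intro allI impI)
  fix col assume "\<forall>e\<in>edges G'. col e < length Hs"
  then have "\<forall>e\<in>edges G. (col \<circ> (`) g) e < length Hs" using g(3) by simp
  then obtain i H where i: "i < length Hs" "H \<in> Hs ! i" "has_coloured_copy G (col \<circ> (`) g) i H"
    using r unfolding ramsey_for_def by blast
  then obtain f where f: "inj_on f (verts H)" "f ` verts H \<subseteq> verts G" "\<forall>e\<in>edges H. f ` e \<in> edges G \<and> col (g ` f ` e) = i"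
    unfolding has_coloured_copy_def comp_def by blast
  have "inj_on (g \<circ> f) (verts H)" using f(1,2) g(1) by (meson comp_inj_on inj_on_subset)
  moreover have "(g \<circ> f) ` verts H \<subseteq> verts G'" using f(2) g(2) unfolding image_comp[symmetric] by blast
  moreover have "\<forall>e\<in>edges H. (g \<circ> f) ` e \<in> edges G' \<and> col ((g \<circ> f) ` e) = i"
    using f(3) g(3) unfolding image_comp[symmetric] by blast
  ultimately show "\<exists>i<length Hs. \<exists>H\<in>Hs ! i. has_coloured_copy G' col i H"
    using i(1,2) unfolding has_coloured_copy_def by blast
qed

text \<open>Pairs of transversal copies are grouped by the set \<open>D\<close> of vertices on which
  they agree. Relative to independent copies such a group contributes a factor of about
  \<open>1 / (n ^ card D * p ^ e)\<close>, with \<open>e\<close> the number of edges inside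
  \<open>D\<close>. The density bound \<open>e <= a * card D\<close> keeps this bounded, and there
  are only \<open>2 ^ nv G\<close> sets \<open>D\<close>.\<close>

lemma prob_copy_lower_bound:
  assumes G: "simple_graph G" and dens: "max_density G \<le> a" and a: "0 < a" and c: "0 < c"
    and k: "1 \<le> nv G" and r: "ramsey_for G Hs"
  obtains B where "0 < B" "\<And>n. nv G \<le> n \<Longrightarrow>
     1 / B \<le> measure_pmf.prob (Gnp n (min 1 (c * real n powr (- 1 / a)))) {G. ramsey_for G Hs}"
proof -
  let ?V = "verts G" and ?E = "edges G"
  let ?k = "nv G"
  have V: "finite ?V" and E: "e \<subseteq> ?V \<and> card e = 2" if "e \<in> ?E" for e using G that by (auto simp: simple_graph_def)
  have fV: "finite ?V" using G by (simp add: simple_graph_def)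
  have fE: "finite ?E" by (rule simple_finite_edges[OF G])
  define c1 where "c1 = min 1 c"
  have c1: "0 < c1" "c1 \<le> 1" "c1 \<le> c" using c by (auto simp: c1_def)
  \<comment> \<open>The numerator pays for \<open>n <= 2 * nv G * N\<close>, the denominator for the
    constant in the edge probability. Capping that constant at 1 lets its power be bounded by the
    one with exponent \<open>ne G\<close>.\<close>
  define B0 where "B0 = (2 * real ?k) ^ ?k / c1 ^ ne G"
  define B where "B = 2 ^ ?k * B0"
  have B0: "0 < B0" using k c1 by (simp add: B0_def)
  then have B: "0 < B" by (simp add: B_def)
  show thesis
  proof (rule that[OF B])
    fix n assume n: "?k \<le> n"
    have n1: "1 \<le> n" using n k by linarith
    then have n0: "0 < real n" by simp
    define p where "p = min 1 (c * real n powr (- 1 / a))"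
    define N where "N = n div ?k"
    have Nn: "?k * N \<le> n" by (simp add: N_def)
    have N1: "1 \<le> N" using n k by (simp add: N_def Suc_le_eq div_greater_zero_iff)
    have "n < ?k * N + ?k" using k mult_div_mod_eq[of ?k n] mod_less_divisor[of ?k n] unfolding N_def by linarith
    also have "\<dots> \<le> 2 * ?k * N" using N1 by simp
    finally have nN: "real n \<le> 2 * real ?k * real N" by (metis less_imp_le of_nat_le_iff of_nat_mult of_nat_numeral)
    have p: "0 < p" "p \<le> 1" "c1 * real n powr (- 1 / a) \<le> p"
    proof -
      show "0 < p" "p \<le> 1" using c n0 by (auto simp: p_def)
      have "real n powr (- 1 / a) \<le> real n powr 0" using n1 a by (intro powr_mono) auto
      then have "real n powr (- 1 / a) \<le> 1" using n0 by simp
      then have "c1 * real n powr (- 1 / a) \<le> 1 * 1" using c1 by (intro mult_mono) auto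
      moreover have "c1 * real n powr (- 1 / a) \<le> c * real n powr (- 1 / a)" using c1 by (intro mult_right_mono) auto
      ultimately show "c1 * real n powr (- 1 / a) \<le> p" by (simp add: p_def)
    qed
    let ?I = "?V \<rightarrow>\<^sub>E {..<N}"
    have fI: "finite ?I" using fV by (intro finite_PiE) auto
    have cI: "card ?I = N ^ ?k" using fV by (simp add: card_PiE)
    have "\<exists>g :: (nat \<Rightarrow> nat) \<Rightarrow> nat \<Rightarrow> nat.
      (\<forall>\<phi>\<in>?I. inj_on (g \<phi>) ?V \<and> g \<phi> ` ?V \<subseteq> {1..n} \<and> (`) (g \<phi>) ` ?E \<subseteq> all_edges n \<and> card ((`) (g \<phi>) ` ?E) = ne G) \<and>
      (\<forall>\<phi>\<in>?I. \<forall>\<psi>\<in>?I. card ((`) (g \<phi>) ` ?E \<union> (`) (g \<psi>) ` ?E) + card {e \<in> ?E. e \<subseteq> {x \<in> ?V. \<phi> x = \<psi> x}} = 2 * ne G)"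
      by (rule transversal_copies[OF fV refl E Nn])
    then obtain g :: "(nat \<Rightarrow> nat) \<Rightarrow> nat \<Rightarrow> nat" where
      G1: "\<forall>\<phi>\<in>?I. inj_on (g \<phi>) ?V \<and> g \<phi> ` ?V \<subseteq> {1..n} \<and> (`) (g \<phi>) ` ?E \<subseteq> all_edges n \<and> card ((`) (g \<phi>) ` ?E) = ne G" and
      G2: "\<forall>\<phi>\<in>?I. \<forall>\<psi>\<in>?I. card ((`) (g \<phi>) ` ?E \<union> (`) (g \<psi>) ` ?E) + card {e \<in> ?E. e \<subseteq> {x \<in> ?V. \<phi> x = \<psi> x}} = 2 * ne G"
      by (elim exE conjE) (rule that; assumption)
    note g1 = bspec[OF G1] and g2 = bspec[OF bspec[OF G2]]
    let ?S = "\<lambda>\<phi>. (`) (g \<phi>) ` ?E"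
    define mu where "mu = real N ^ ?k * p ^ ne G"
    have mu0: "0 < mu" using N1 p by (simp add: mu_def)
    have m1: "(\<Sum>\<phi>\<in>?I. p ^ card (?S \<phi>)) = mu" using g1 cI by (simp add: mu_def)
    let ?e = "\<lambda>D. card {e \<in> ?E. e \<subseteq> D}"
    have bound: "real N ^ (?k - card D) * p ^ (2 * ne G - ?e D) \<le> B0 * (real N ^ ?k * p ^ (2 * ne G))" if D: "D \<subseteq> ?V" for D
    proof -
      have eE: "?e D \<le> ne G" using fE by (intro card_mono) auto
      have dk: "card D \<le> ?k" using D fV by (intro card_mono)
      have "subgraph (D, {e \<in> ?E. e \<subseteq> D}) G" using G D by (intro subgraph_pair) auto
      from max_density_le[OF G dens _ this] have ed: "real (?e D) \<le> a * real (card D)" using a by simp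
      have q: "real n powr (- real (card D)) \<le> (real n powr (- 1 / a)) ^ ?e D"
      proof -
        have "(real n powr (- 1 / a)) ^ ?e D = real n powr (real (?e D) * (- 1 / a))"
          by (rule power_powr[OF n0])
        moreover have "real (?e D) / a \<le> real (card D)" using ed a by (simp add: divide_le_eq mult.commute)
        then have "- real (card D) \<le> real (?e D) * (- 1 / a)" by simp
        then have "real n powr (- real (card D)) \<le> real n powr (real (?e D) * (- 1 / a))" using n1 by (intro powr_mono) auto
        ultimately show ?thesis by simp
      qed
      have "c1 ^ ne G * real n powr (- real (card D)) \<le> c1 ^ ?e D * (real n powr (- 1 / a)) ^ ?e D"
        using c1 q eE by (intro mult_mono power_decreasing) auto
      also have "\<dots> = (c1 * real n powr (- 1 / a)) ^ ?e D" by (simp add: power_mult_distrib)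
      also have "\<dots> \<le> p ^ ?e D" using p c1 by (intro power_mono) auto
      finally have pe: "c1 ^ ne G * real n powr (- real (card D)) \<le> p ^ ?e D" .
      have "real n ^ card D \<le> (2 * real ?k * real N) ^ card D" using nN n0 by (intro power_mono) auto
      also have "\<dots> = (2 * real ?k) ^ card D * real N ^ card D" by (simp add: power_mult_distrib)
      also have "\<dots> \<le> (2 * real ?k) ^ ?k * real N ^ card D" using k dk by (intro mult_right_mono power_increasing) auto
      finally have nd: "real n ^ card D \<le> (2 * real ?k) ^ ?k * real N ^ card D" .
      have "1 = real n ^ card D * real n powr (- real (card D))" using n0 by (simp add: powr_minus powr_realpow)
      also have "\<dots> \<le> ((2 * real ?k) ^ ?k * real N ^ card D) * (p ^ ?e D / c1 ^ ne G)"
        using nd pe c1 p by (intro mult_mono) (auto simp: le_divide_eq mult.commute)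
      also have "\<dots> = B0 * (real N ^ card D * p ^ ?e D)" by (simp add: B0_def)
      finally have one: "1 \<le> B0 * (real N ^ card D * p ^ ?e D)" .
      have "real N ^ (?k - card D) * p ^ (2 * ne G - ?e D) * 1
          \<le> real N ^ (?k - card D) * p ^ (2 * ne G - ?e D) * (B0 * (real N ^ card D * p ^ ?e D))"
        using one p by (intro mult_left_mono) auto
      also have "\<dots> = B0 * ((real N ^ (?k - card D) * real N ^ card D) * (p ^ (2 * ne G - ?e D) * p ^ ?e D))" by (simp only: mult_ac)
      also have "real N ^ (?k - card D) * real N ^ card D = real N ^ ?k" using dk by (simp flip: power_add)
      also have "p ^ (2 * ne G - ?e D) * p ^ ?e D = p ^ (2 * ne G)" using eE by (simp flip: power_add)
      finally show ?thesis by simp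
    qed
    have inner: "(\<Sum>\<psi>\<in>?I. p ^ card (?S \<phi> \<union> ?S \<psi>)) \<le> B * (real N ^ ?k * p ^ (2 * ne G))" if phi: "\<phi> \<in> ?I" for \<phi>
    proof -
      let ?agr = "\<lambda>\<psi>. {x \<in> ?V. \<phi> x = \<psi> x}"
      have "(\<Sum>\<psi>\<in>?I. p ^ card (?S \<phi> \<union> ?S \<psi>)) = (\<Sum>\<psi>\<in>?I. p ^ (2 * ne G - ?e (?agr \<psi>)))"
      proof (rule sum.cong[OF refl])
        fix \<psi> assume "\<psi> \<in> ?I"
        from g2[OF phi this] have "card (?S \<phi> \<union> ?S \<psi>) = 2 * ne G - ?e (?agr \<psi>)" by linarith
        then show "p ^ card (?S \<phi> \<union> ?S \<psi>) = p ^ (2 * ne G - ?e (?agr \<psi>))" by simp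
      qed
      also have "\<dots> = (\<Sum>D\<in>Pow ?V. \<Sum>\<psi>\<in>{\<psi> \<in> ?I. ?agr \<psi> = D}. p ^ (2 * ne G - ?e (?agr \<psi>)))"
        using fI fV by (intro sum.group[symmetric]) auto
      also have "\<dots> = (\<Sum>D\<in>Pow ?V. \<Sum>\<psi>\<in>{\<psi> \<in> ?I. ?agr \<psi> = D}. p ^ (2 * ne G - ?e D))"
        by (intro sum.cong refl) auto
      also have "\<dots> \<le> (\<Sum>D\<in>Pow ?V. real N ^ (?k - card D) * p ^ (2 * ne G - ?e D))"
      proof (rule sum_mono)
        fix D assume "D \<in> Pow ?V"
        then have "card {\<psi> \<in> ?I. ?agr \<psi> = D} \<le> N ^ (?k - card D)" using card_agreeing[OF fV _ phi] by blast
        then have "real (card {\<psi> \<in> ?I. ?agr \<psi> = D}) \<le> real (N ^ (?k - card D))" by (rule of_nat_mono)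
        then have "real (card {\<psi> \<in> ?I. ?agr \<psi> = D}) \<le> real N ^ (?k - card D)" by (simp only: of_nat_power)
        then show "(\<Sum>\<psi>\<in>{\<psi> \<in> ?I. ?agr \<psi> = D}. p ^ (2 * ne G - ?e D)) \<le> real N ^ (?k - card D) * p ^ (2 * ne G - ?e D)"
          unfolding sum_constant using p by (intro mult_right_mono) auto
      qed
      also have "\<dots> \<le> (\<Sum>D\<in>Pow ?V. B0 * (real N ^ ?k * p ^ (2 * ne G)))" using bound by (intro sum_mono) auto
      also have "\<dots> = B * (real N ^ ?k * p ^ (2 * ne G))" using fV by (simp add: B_def card_Pow)
      finally show ?thesis .
    qed
    have "(\<Sum>\<phi>\<in>?I. \<Sum>\<psi>\<in>?I. p ^ card (?S \<phi> \<union> ?S \<psi>)) \<le> (\<Sum>\<phi>\<in>?I. B * (real N ^ ?k * p ^ (2 * ne G)))"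
      by (intro sum_mono inner)
    also have "\<dots> = B * mu\<^sup>2"
    proof -
      have "p ^ (2 * ne G) = p ^ ne G * p ^ ne G" by (simp add: mult_2 power_add)
      then show ?thesis unfolding sum_constant cI mu_def power2_eq_square by (simp only: of_nat_power mult_ac)
    qed
    finally have m2: "(\<Sum>\<phi>\<in>?I. \<Sum>\<psi>\<in>?I. p ^ card (?S \<phi> \<union> ?S \<psi>)) \<le> B * mu\<^sup>2" .
    have "1 / B \<le> measure_pmf.prob (Gnp n p) {G'. \<exists>\<phi>\<in>?I. ?S \<phi> \<subseteq> edges G'}"
      using g1 p by (intro second_moment[OF fI _ _ _ m1 mu0 m2 B]) auto
    also have "\<dots> = measure_pmf.prob (Gnp n p) ({G'. \<exists>\<phi>\<in>?I. ?S \<phi> \<subseteq> edges G'} \<inter> set_pmf (Gnp n p))"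
      by (simp add: measure_Int_set_pmf)
    also have "\<dots> \<le> measure_pmf.prob (Gnp n p) {G. ramsey_for G Hs}"
    proof (intro measure_pmf.finite_measure_mono subsetI)
      fix G' assume "G' \<in> {G'. \<exists>\<phi>\<in>?I. ?S \<phi> \<subseteq> edges G'} \<inter> set_pmf (Gnp n p)"
      then have ex: "\<exists>\<phi>\<in>?I. ?S \<phi> \<subseteq> edges G'" and G': "G' \<in> set_pmf (Gnp n p)" by simp_all
      from ex obtain \<phi> where phi: "\<phi> \<in> ?I" "?S \<phi> \<subseteq> edges G'" by (elim bexE)
      have "ramsey_for G' Hs"
      proof (rule ramsey_for_embedding[OF r])
        show "inj_on (g \<phi>) ?V" using g1[OF phi(1)] by (elim conjE)
        show "g \<phi> ` ?V \<subseteq> verts G'" using g1[OF phi(1)] conjunct1[OF set_pmf_Gnp[OF G']] by (elim conjE) simp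
        show "g \<phi> ` e \<in> edges G'" if "e \<in> ?E" for e using phi(2) that by (intro subsetD[OF phi(2)] imageI)
      qed
      then show "G' \<in> {G. ramsey_for G Hs}" by simp
    qed auto
    finally show "1 / B \<le> measure_pmf.prob (Gnp n (min 1 (c * real n powr (- 1 / a)))) {G. ramsey_for G Hs}"
      by (simp add: p_def)
  qed
qed

theorem deterministic_from_probabilistic:
  assumes lim: "\<And>p :: nat \<Rightarrow> real. (\<forall>n. 0 \<le> p n \<and> p n \<le> 1) \<Longrightarrow> (\<forall>n\<ge>1. p n \<le> c * real n powr (- 1 / a)) \<Longrightarrow>
      (\<lambda>n. measure_pmf.prob (Gnp n (p n)) {G. ramsey_for G Hs}) \<longlonglongrightarrow> 0"
    and c: "0 < c" and a: "0 < a" and G: "simple_graph G" "ramsey_for G Hs"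
  shows "a < max_density G"
proof (rule ccontr)
  assume "\<not> ?thesis"
  then have dens: "max_density G \<le> a" by simp
  define p where "p = (\<lambda>n :: nat. min 1 (c * real n powr (- 1 / a)))"
  have "(\<lambda>n. measure_pmf.prob (Gnp n (p n)) {G. ramsey_for G Hs}) \<longlonglongrightarrow> 0"
    using c by (intro lim) (auto simp: p_def)
  moreover obtain B where B: "0 < B" "\<And>n. nv G \<le> n \<Longrightarrow> 1 / B \<le> measure_pmf.prob (Gnp n (p n)) {G. ramsey_for G Hs}"
  proof (cases "nv G = 0")
    \<comment> \<open>If the graph without vertices is Ramsey, so is every graph, and the
      probability is constantly 1.\<close>
    case True
    have "verts G = {}" using True G(1) by (simp add: simple_graph_def)
    moreover have "edges G = {}"
    proof -
      have "False" if "e \<in> edges G" for e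
        using that G(1) \<open>verts G = {}\<close> unfolding simple_graph_def by fastforce
      then show ?thesis by blast
    qed
    ultimately have "ramsey_for G' Hs" for G' by (intro ramsey_for_embedding[OF G(2), of id]) auto
    then show thesis by (intro that[of 1]) auto
  next
    case False
    then have "1 \<le> nv G" by simp
    from prob_copy_lower_bound[OF G(1) dens a c this G(2)] show thesis using that unfolding p_def by blast
  qed
  ultimately have "1 / B \<le> 0" using B(2) by (intro LIMSEQ_le_const) auto
  then show False using B(1) by (simp add: divide_le_0_iff)
qed

theorem theorem1p11:
  shows
    "(\<forall>Hs :: graph set list.
        length Hs \<ge> 2 \<and>
        (\<forall>F\<in>set Hs. graph_family F \<and> (\<forall>H\<in>F. edges H \<noteq> {})) \<and>
        sorted_wrt (\<lambda>F F'. m2_fam F \<ge> m2_fam F') Hs \<and>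
        m2_fam (Hs ! 1) > 1
        \<longrightarrow>
        (\<exists>c>0. \<forall>p :: nat \<Rightarrow> real.
           (\<forall>n. 0 \<le> p n \<and> p n \<le> 1) \<and>
           (\<forall>n\<ge>1. p n \<le> c * real n powr (- 1 / m2_asym_fam (Hs ! 0) (Hs ! 1)))
           \<longrightarrow>
           (\<lambda>n. measure_pmf.prob (Gnp n (p n)) {G. ramsey_for G Hs}) \<longlonglongrightarrow> 0))
     \<longleftrightarrow>
     (\<forall>H1 H2 :: graph set.
        graph_family H1 \<and> graph_family H2 \<and>
        strictly_balanced_pair H1 H2 \<and>
        m2_fam H1 \<ge> m2_fam H2 \<and> m2_fam H2 > 1
        \<longrightarrow>
        (\<forall>G :: graph. simple_graph G \<and> ramsey_for G [H1, H2]
           \<longrightarrow> max_density G > m2_asym_fam H1 H2))"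
proof (intro iffI allI impI; (elim conjE)?)
  fix H1 H2 :: "graph set" and G :: graph
  assume prob: "\<forall>Hs :: graph set list.
        length Hs \<ge> 2 \<and>
        (\<forall>F\<in>set Hs. graph_family F \<and> (\<forall>H\<in>F. edges H \<noteq> {})) \<and>
        sorted_wrt (\<lambda>F F'. m2_fam F \<ge> m2_fam F') Hs \<and>
        m2_fam (Hs ! 1) > 1
        \<longrightarrow>
        (\<exists>c>0. \<forall>p :: nat \<Rightarrow> real.
           (\<forall>n. 0 \<le> p n \<and> p n \<le> 1) \<and>
           (\<forall>n\<ge>1. p n \<le> c * real n powr (- 1 / m2_asym_fam (Hs ! 0) (Hs ! 1)))
           \<longrightarrow>
           (\<lambda>n. measure_pmf.prob (Gnp n (p n)) {G. ramsey_for G Hs}) \<longlonglongrightarrow> 0)"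
    and fam: "graph_family H1" "graph_family H2" and le: "m2_fam H2 \<le> m2_fam H1" and gt: "1 < m2_fam H2"
    and G: "simple_graph G" "ramsey_for G [H1, H2]"
  \<comment> \<open>Density above 1 excludes edgeless members, which the probabilistic assertion
    requires.\<close>
  have e1: "edges H \<noteq> {}" if "H \<in> H1" for H using m2_gt_half(1)[of H] fam_Min(1)[OF fam(1) that] le gt by simp
  have e2: "edges H \<noteq> {}" if "H \<in> H2" for H using m2_gt_half(1)[of H] fam_Min(1)[OF fam(2) that] gt by simp
  obtain c where c: "0 < c" "\<And>p :: nat \<Rightarrow> real. (\<forall>n. 0 \<le> p n \<and> p n \<le> 1) \<and>
       (\<forall>n\<ge>1. p n \<le> c * real n powr (- 1 / m2_asym_fam H1 H2)) \<Longrightarrow>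
       (\<lambda>n. measure_pmf.prob (Gnp n (p n)) {G. ramsey_for G [H1, H2]}) \<longlonglongrightarrow> 0"
    using prob[rule_format, of "[H1, H2]"] fam le gt e1 e2 by auto
  show "m2_asym_fam H1 H2 < max_density G"
    by (rule deterministic_from_probabilistic[OF c(2) c(1) m2_asym_fam_pos[OF fam(1) _ gt] G])
      (use fam_Min(1)[OF fam(1)] le gt in force)+
next
  fix Hs :: "graph set list"
  assume det: "\<forall>H1 H2 :: graph set.
        graph_family H1 \<and> graph_family H2 \<and>
        strictly_balanced_pair H1 H2 \<and>
        m2_fam H1 \<ge> m2_fam H2 \<and> m2_fam H2 > 1
        \<longrightarrow>
        (\<forall>G :: graph. simple_graph G \<and> ramsey_for G [H1, H2]
           \<longrightarrow> max_density G > m2_asym_fam H1 H2)"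
    and len: "2 \<le> length Hs" and fam: "\<forall>F\<in>set Hs. graph_family F \<and> (\<forall>H\<in>F. edges H \<noteq> {})"
    and sorted: "sorted_wrt (\<lambda>F F'. m2_fam F \<ge> m2_fam F') Hs" and gt: "m2_fam (Hs ! 1) > 1"
  have "0 < length Hs" "1 < length Hs" using len by linarith+
  then have "Hs ! 0 \<in> set Hs" "Hs ! 1 \<in> set Hs" by simp_all
  then have A: "graph_family (Hs ! 0)" and B: "graph_family (Hs ! 1)" using fam by blast+
  have le: "m2_fam (Hs ! 1) \<le> m2_fam (Hs ! 0)" using sorted_wrt_nth_less[OF sorted, of 0 1] len by simp
  let ?a = "m2_asym_fam (Hs ! 0) (Hs ! 1)"
  have "vanishes_below ?a {G. ramsey_for G [Hs ! 0, Hs ! 1]}"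
    by (rule probabilistic_from_deterministic[OF _ A B le gt]) (use det in blast)
  moreover have "{G. ramsey_for G Hs} \<subseteq> {G. ramsey_for G [Hs ! 0, Hs ! 1]}"
    using ramsey_for_first_two[OF _ len] fam by blast
  moreover have "0 < ?a" using fam_Min(1)[OF A] le gt by (intro m2_asym_fam_pos[OF A _ gt]) force
  ultimately have "vanishes_below ?a {G. ramsey_for G Hs}" using order_refl by (rule vanishes_below_mono)
  then show "\<exists>c>0. \<forall>p :: nat \<Rightarrow> real.
           (\<forall>n. 0 \<le> p n \<and> p n \<le> 1) \<and>
           (\<forall>n\<ge>1. p n \<le> c * real n powr (- 1 / m2_asym_fam (Hs ! 0) (Hs ! 1)))
           \<longrightarrow>
           (\<lambda>n. measure_pmf.prob (Gnp n (p n)) {G. ramsey_for G Hs}) \<longlonglongrightarrow> 0"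
    unfolding vanishes_below_def .
qed

end
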